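(* Let $\mathcal A$ and $\mathcal B$ be Grothendieck abelian categories and let $F:\mathcal A\rightleftarrows\mathcal B:G$ be an adjunction with $F$ left adjoint to $G$. Let $(\mathcal D,\mathcal E)$ and $(\mathcal D',\mathcal E')$ be cotorsion pairs on $\mathcal A$ and $\mathcal B$ respectively, inducing model structures on $\mathrm{Ch}(\mathcal A)$ and $\mathrm{Ch}(\mathcal B)$ respectively. Assume that one of the following two (equivalent) pairs of conditions holds: (1a) $\mathcal D$ is $F$-right split, and (1b) $F(\mathcal D)\subset\mathcal D'$; (2a) $\mathcal E'$ is $G$-left split, and (2b) $G(\mathcal E')\subset\mathcal E$. Then $F$ and $G$ induce (by degreewise application) a Quillen adjunction $\mathrm{Ch}(F):\mathrm{Ch}(\mathcal A)\rightleftarrows\mathrm{Ch}(\mathcal B):\mathrm{Ch}(G)$.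
   Context: All abelian categories are assumed to have $\mathrm{Ext}^n(A,B)$ a set for all $n$, $A$, $B$. $\mathrm{Ch}(\mathcal A)$ is the category of unbounded cochain complexes; $Z^nA^\bullet=\ker(d^n:A^n\to A^{n+1})$; $\mathrm{Ac}$ is the class of acyclic (exact) complexes. Cotorsion pair: classes of objects $(\mathcal D,\mathcal E)$ in an abelian category $\mathcal A$ such that $D\in\mathcal D$ iff $\mathrm{Ext}^1(D,E)=0$ for all $E\in\mathcal E$, and $E\in\mathcal E$ iff $\mathrm{Ext}^1(D,E)=0$ for all $D\in\mathcal D$. It is complete if for every object $X$ there are short exact sequences $0\to X\to E\to D\to 0$ and $0\to E'\to D'\to X\to 0$ with $D,D'\in\mathcal D$ and $E,E'\in\mathcal E$. Given a cotorsion pair $(\mathcal D,\mathcal E)$ on $\mathcal A$: $\tilde{\mathcal D}$ (resp. $\tilde{\mathcal E}$) is the class of exact complexes $A^\bullet$ with all $Z^nA^\bullet\in\mathcal D$ (resp. $\in\mathcal E$). $\mathrm{dg}\tilde{\mathcal D}$ is the class of complexes $A^\bullet$ with all $A^n\in\mathcal D$ such that every map $A^\bullet\to E^\bullet$ with $E^\bullet\in\tilde{\mathcal E}$ is null-homotopic. $\mathrm{dg}\tilde{\mathcal E}$ is the class of complexes $A^\bullet$ with all $A^n\in\mathcal E$ such that every map $D^\bullet\to A^\bullet$ with $D^\bullet\in\tilde{\mathcal D}$ is null-homotopic. We say that $(\mathcal D,\mathcal E)$ induces a model structure if $(\mathrm{dg}\tilde{\mathcal D},\tilde{\mathcal E})$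 and $(\tilde{\mathcal D},\mathrm{dg}\tilde{\mathcal E})$ are complete cotorsion pairs on $\mathrm{Ch}(\mathcal A)$ and are compatible, i.e. $\tilde{\mathcal D}=\mathrm{dg}\tilde{\mathcal D}\cap\mathrm{Ac}$ and $\tilde{\mathcal E}=\mathrm{dg}\tilde{\mathcal E}\cap\mathrm{Ac}$. The induced model structure on $\mathrm{Ch}(\mathcal A)$ has as weak equivalences the quasi-isomorphisms, as cofibrations the monomorphisms with cokernel in $\mathrm{dg}\tilde{\mathcal D}$, and as fibrations the epimorphisms with kernel in $\mathrm{dg}\tilde{\mathcal E}$. Right split: for a right exact functor $F:\mathcal A\to\mathcal B$, a class $\mathcal S\subset\mathrm{Ob}(\mathcal A)$ is $F$-right split if for every short exact sequence $0\to X\to Y\to S\to 0$ with $S\in\mathcal S$ the sequence $0\to FX\to FY\to FS\to 0$ is exact. Left split: for a left exact functor $G:\mathcal B\to\mathcal A$, a class $\mathcal S\subset\mathrm{Ob}(\mathcal B)$ is $G$-left split if for every short exact sequence $0\to S\to X\to Y\to 0$ with $S\in\mathcal S$ the sequence $0\to GS\to GX\to GY\to 0$ is exact. *)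

theory Defs
  imports Main
begin

section \<open>Categories\<close>

text \<open>
  A category is given by a set of objects and a family of hom-sets.  The hom-sets need not be
  disjoint, and composition, addition and the morphism part of a functor do not take objects as
  arguments; this loses no generality, since morphisms can be tagged with their domain and codomain.
  Values outside the hom-sets are unconstrained.
\<close>

record ('o, 'm) cat =
  Obj :: "'o set"
  Hom :: "'o \<Rightarrow> 'o \<Rightarrow> 'm set"
  Ident :: "'o \<Rightarrow> 'm"
  Comp :: "'m \<Rightarrow> 'm \<Rightarrow> 'm"  (infixr "\<cdot>\<index>" 75)

record ('o, 'm) addcat = "('o, 'm) cat" +
  Plus :: "'m \<Rightarrow> 'm \<Rightarrow> 'm"  (infixl "\<boxplus>\<index>" 65)
  Zero :: "'o \<Rightarrow> 'o \<Rightarrow> 'm"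

locale category =
  fixes C :: "('o, 'm, 'z) cat_scheme" (structure)
  assumes ident_hom: "X \<in> Obj C \<Longrightarrow> Ident C X \<in> Hom C X X"
    and comp_hom: "\<lbrakk>X \<in> Obj C; Y \<in> Obj C; Z \<in> Obj C; f \<in> Hom C X Y; g \<in> Hom C Y Z\<rbrakk>
          \<Longrightarrow> g \<cdot> f \<in> Hom C X Z"
    and ident_left: "\<lbrakk>X \<in> Obj C; Y \<in> Obj C; f \<in> Hom C X Y\<rbrakk> \<Longrightarrow> Ident C Y \<cdot> f = f"
    and ident_right: "\<lbrakk>X \<in> Obj C; Y \<in> Obj C; f \<in> Hom C X Y\<rbrakk> \<Longrightarrow> f \<cdot> Ident C X = f"
    and comp_assoc: "\<lbrakk>W \<in> Obj C; X \<in> Obj C; Y \<in> Obj C; Z \<in> Obj C;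
          f \<in> Hom C W X; g \<in> Hom C X Y; h \<in> Hom C Y Z\<rbrakk> \<Longrightarrow> (h \<cdot> g) \<cdot> f = h \<cdot> (g \<cdot> f)"

definition is_mono :: "('o, 'm, 'z) cat_scheme \<Rightarrow> 'o \<Rightarrow> 'o \<Rightarrow> 'm \<Rightarrow> bool" where
  "is_mono C X Y f \<longleftrightarrow> f \<in> Hom C X Y \<and>
     (\<forall>W\<in>Obj C. \<forall>g\<in>Hom C W X. \<forall>h\<in>Hom C W X. f \<cdot>\<^bsub>C\<^esub> g = f \<cdot>\<^bsub>C\<^esub> h \<longrightarrow> g = h)"

definition is_epi :: "('o, 'm, 'z) cat_scheme \<Rightarrow> 'o \<Rightarrow> 'o \<Rightarrow> 'm \<Rightarrow> bool" where
  "is_epi C X Y f \<longleftrightarrow> f \<in> Hom C X Y \<and>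
     (\<forall>W\<in>Obj C. \<forall>g\<in>Hom C Y W. \<forall>h\<in>Hom C Y W. g \<cdot>\<^bsub>C\<^esub> f = h \<cdot>\<^bsub>C\<^esub> f \<longrightarrow> g = h)"

definition is_iso :: "('o, 'm, 'z) cat_scheme \<Rightarrow> 'o \<Rightarrow> 'o \<Rightarrow> 'm \<Rightarrow> bool" where
  "is_iso C X Y f \<longleftrightarrow> f \<in> Hom C X Y \<and>
     (\<exists>g\<in>Hom C Y X. g \<cdot>\<^bsub>C\<^esub> f = Ident C X \<and> f \<cdot>\<^bsub>C\<^esub> g = Ident C Y)"

definition is_zero_obj :: "('o, 'm, 'z) cat_scheme \<Rightarrow> 'o \<Rightarrow> bool" where
  "is_zero_obj C Z \<longleftrightarrow> Z \<in> Obj C \<and>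
     (\<forall>X\<in>Obj C. (\<exists>!f. f \<in> Hom C X Z) \<and> (\<exists>!f. f \<in> Hom C Z X))"

subsection \<open>Functors and adjunctions\<close>

record ('o, 'm, 'p, 'n) func =
  omap :: "'o \<Rightarrow> 'p"
  mmap :: "'m \<Rightarrow> 'n"

definition is_functor ::
  "('o, 'm, 'z) cat_scheme \<Rightarrow> ('p, 'n, 'y) cat_scheme \<Rightarrow> ('o, 'm, 'p, 'n) func \<Rightarrow> bool" where
  "is_functor C D F \<longleftrightarrow>
     (\<forall>X\<in>Obj C. omap F X \<in> Obj D) \<and>
     (\<forall>X\<in>Obj C. \<forall>Y\<in>Obj C. \<forall>f\<in>Hom C X Y. mmap F f \<in> Hom D (omap F X) (omap F Y)) \<and>
     (\<forall>X\<in>Obj C. mmap F (Ident C X) = Ident D (omap F X)) \<and>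
     (\<forall>X\<in>Obj C. \<forall>Y\<in>Obj C. \<forall>Z\<in>Obj C. \<forall>f\<in>Hom C X Y. \<forall>g\<in>Hom C Y Z.
        mmap F (g \<cdot>\<^bsub>C\<^esub> f) = mmap F g \<cdot>\<^bsub>D\<^esub> mmap F f)"

definition is_nat_trans ::
  "('o, 'm, 'z) cat_scheme \<Rightarrow> ('p, 'n, 'y) cat_scheme \<Rightarrow> ('o, 'm, 'p, 'n) func
     \<Rightarrow> ('o, 'm, 'p, 'n) func \<Rightarrow> ('o \<Rightarrow> 'n) \<Rightarrow> bool" where
  "is_nat_trans C D F G \<tau> \<longleftrightarrow>
     (\<forall>X\<in>Obj C. \<tau> X \<in> Hom D (omap F X) (omap G X)) \<and>
     (\<forall>X\<in>Obj C. \<forall>Y\<in>Obj C. \<forall>f\<in>Hom C X Y. \<tau> Y \<cdot>\<^bsub>D\<^esub> mmap F f = mmap G f \<cdot>\<^bsub>D\<^esub> \<tau> X)"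

text \<open>The functor \<open>F\<close> is left adjoint to \<open>G\<close>, with \<open>\<phi> X Y\<close> mapping the
  hom-set of \<open>F X\<close> and \<open>Y\<close> to that of \<open>X\<close> and \<open>G Y\<close>.\<close>

definition is_adjunction ::
  "('o, 'm, 'z) cat_scheme \<Rightarrow> ('p, 'n, 'y) cat_scheme \<Rightarrow> ('o, 'm, 'p, 'n) func
     \<Rightarrow> ('p, 'n, 'o, 'm) func \<Rightarrow> ('o \<Rightarrow> 'p \<Rightarrow> 'n \<Rightarrow> 'm) \<Rightarrow> bool" where
  "is_adjunction C D F G \<phi> \<longleftrightarrow>
     is_functor C D F \<and> is_functor D C G \<and>
     (\<forall>X\<in>Obj C. \<forall>Y\<in>Obj D. bij_betw (\<phi> X Y) (Hom D (omap F X) Y) (Hom C X (omap G Y))) \<and>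
     (\<forall>X\<in>Obj C. \<forall>X'\<in>Obj C. \<forall>Y\<in>Obj D. \<forall>Y'\<in>Obj D.
        \<forall>u\<in>Hom C X' X. \<forall>f\<in>Hom D (omap F X) Y. \<forall>v\<in>Hom D Y Y'.
          \<phi> X' Y' (v \<cdot>\<^bsub>D\<^esub> f \<cdot>\<^bsub>D\<^esub> mmap F u) = mmap G v \<cdot>\<^bsub>C\<^esub> \<phi> X Y f \<cdot>\<^bsub>C\<^esub> u)"

subsection \<open>Colimits\<close>

definition is_cocone ::
  "('i, 'j, 'y) cat_scheme \<Rightarrow> ('o, 'm, 'z) cat_scheme \<Rightarrow> ('i, 'j, 'o, 'm) func
     \<Rightarrow> 'o \<Rightarrow> ('i \<Rightarrow> 'm) \<Rightarrow> bool" where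
  "is_cocone J C K L \<kappa> \<longleftrightarrow> L \<in> Obj C \<and>
     (\<forall>i\<in>Obj J. \<kappa> i \<in> Hom C (omap K i) L) \<and>
     (\<forall>i\<in>Obj J. \<forall>j\<in>Obj J. \<forall>u\<in>Hom J i j. \<kappa> j \<cdot>\<^bsub>C\<^esub> mmap K u = \<kappa> i)"

definition is_colimit ::
  "('i, 'j, 'y) cat_scheme \<Rightarrow> ('o, 'm, 'z) cat_scheme \<Rightarrow> ('i, 'j, 'o, 'm) func
     \<Rightarrow> 'o \<Rightarrow> ('i \<Rightarrow> 'm) \<Rightarrow> bool" where
  "is_colimit J C K L \<kappa> \<longleftrightarrow> is_cocone J C K L \<kappa> \<and>
     (\<forall>M \<mu>. is_cocone J C K M \<mu> \<longrightarrow>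
        (\<exists>!h. h \<in> Hom C L M \<and> (\<forall>i\<in>Obj J. h \<cdot>\<^bsub>C\<^esub> \<kappa> i = \<mu> i)))"

definition is_filtered :: "('i, 'j, 'y) cat_scheme \<Rightarrow> bool" where
  "is_filtered J \<longleftrightarrow> Obj J \<noteq> {} \<and>
     (\<forall>i\<in>Obj J. \<forall>j\<in>Obj J. \<exists>k\<in>Obj J. Hom J i k \<noteq> {} \<and> Hom J j k \<noteq> {}) \<and>
     (\<forall>i\<in>Obj J. \<forall>j\<in>Obj J. \<forall>u\<in>Hom J i j. \<forall>v\<in>Hom J i j.
        \<exists>k\<in>Obj J. \<exists>w\<in>Hom J j k. w \<cdot>\<^bsub>J\<^esub> u = w \<cdot>\<^bsub>J\<^esub> v)"

section \<open>Abelian categories\<close>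

locale preadditive_category = category C
  for C :: "('o, 'm, 'z) addcat_scheme" (structure) +
  assumes zero_hom: "\<lbrakk>X \<in> Obj C; Y \<in> Obj C\<rbrakk> \<Longrightarrow> Zero C X Y \<in> Hom C X Y"
    and plus_hom: "\<lbrakk>X \<in> Obj C; Y \<in> Obj C; f \<in> Hom C X Y; g \<in> Hom C X Y\<rbrakk>
          \<Longrightarrow> f \<boxplus> g \<in> Hom C X Y"
    and plus_assoc: "\<lbrakk>X \<in> Obj C; Y \<in> Obj C; f \<in> Hom C X Y; g \<in> Hom C X Y; h \<in> Hom C X Y\<rbrakk>
          \<Longrightarrow> (f \<boxplus> g) \<boxplus> h = f \<boxplus> (g \<boxplus> h)"
    and plus_commute: "\<lbrakk>X \<in> Obj C; Y \<in> Obj C; f \<in> Hom C X Y; g \<in> Hom C X Y\<rbrakk>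
          \<Longrightarrow> f \<boxplus> g = g \<boxplus> f"
    and plus_zero: "\<lbrakk>X \<in> Obj C; Y \<in> Obj C; f \<in> Hom C X Y\<rbrakk> \<Longrightarrow> f \<boxplus> Zero C X Y = f"
    and plus_inverse: "\<lbrakk>X \<in> Obj C; Y \<in> Obj C; f \<in> Hom C X Y\<rbrakk>
          \<Longrightarrow> \<exists>g\<in>Hom C X Y. f \<boxplus> g = Zero C X Y"
    and comp_plus_left: "\<lbrakk>X \<in> Obj C; Y \<in> Obj C; Z \<in> Obj C; f \<in> Hom C X Y;
          g \<in> Hom C Y Z; h \<in> Hom C Y Z\<rbrakk> \<Longrightarrow> (g \<boxplus> h) \<cdot> f = (g \<cdot> f) \<boxplus> (h \<cdot> f)"
    and comp_plus_right: "\<lbrakk>X \<in> Obj C; Y \<in> Obj C; Z \<in> Obj C; f \<in> Hom C X Y;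
          g \<in> Hom C X Y; h \<in> Hom C Y Z\<rbrakk> \<Longrightarrow> h \<cdot> (f \<boxplus> g) = (h \<cdot> f) \<boxplus> (h \<cdot> g)"

definition is_kernel ::
  "('o, 'm, 'z) addcat_scheme \<Rightarrow> 'o \<Rightarrow> 'o \<Rightarrow> 'm \<Rightarrow> 'o \<Rightarrow> 'm \<Rightarrow> bool" where
  "is_kernel C X Y f K k \<longleftrightarrow> K \<in> Obj C \<and> k \<in> Hom C K X \<and> f \<cdot>\<^bsub>C\<^esub> k = Zero C K Y \<and>
     (\<forall>W\<in>Obj C. \<forall>g\<in>Hom C W X. f \<cdot>\<^bsub>C\<^esub> g = Zero C W Y \<longrightarrow>
        (\<exists>!h. h \<in> Hom C W K \<and> k \<cdot>\<^bsub>C\<^esub> h = g))"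

definition is_cokernel ::
  "('o, 'm, 'z) addcat_scheme \<Rightarrow> 'o \<Rightarrow> 'o \<Rightarrow> 'm \<Rightarrow> 'o \<Rightarrow> 'm \<Rightarrow> bool" where
  "is_cokernel C X Y f Q q \<longleftrightarrow> Q \<in> Obj C \<and> q \<in> Hom C Y Q \<and> q \<cdot>\<^bsub>C\<^esub> f = Zero C X Q \<and>
     (\<forall>W\<in>Obj C. \<forall>g\<in>Hom C Y W. g \<cdot>\<^bsub>C\<^esub> f = Zero C X W \<longrightarrow>
        (\<exists>!h. h \<in> Hom C Q W \<and> h \<cdot>\<^bsub>C\<^esub> q = g))"

definition is_biproduct ::
  "('o, 'm, 'z) addcat_scheme \<Rightarrow> 'o \<Rightarrow> 'o \<Rightarrow> 'o \<Rightarrow> 'm \<Rightarrow> 'm \<Rightarrow> 'm \<Rightarrow> 'm \<Rightarrow> bool" where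
  "is_biproduct C X Y P i j p q \<longleftrightarrow> P \<in> Obj C \<and>
     i \<in> Hom C X P \<and> j \<in> Hom C Y P \<and> p \<in> Hom C P X \<and> q \<in> Hom C P Y \<and>
     p \<cdot>\<^bsub>C\<^esub> i = Ident C X \<and> q \<cdot>\<^bsub>C\<^esub> j = Ident C Y \<and>
     p \<cdot>\<^bsub>C\<^esub> j = Zero C Y X \<and> q \<cdot>\<^bsub>C\<^esub> i = Zero C X Y \<and>
     (i \<cdot>\<^bsub>C\<^esub> p) \<boxplus>\<^bsub>C\<^esub> (j \<cdot>\<^bsub>C\<^esub> q) = Ident C P"

locale abelian_category = preadditive_category C
  for C :: "('o, 'm, 'z) addcat_scheme" (structure) +
  assumes ex_zero_obj: "\<exists>Z. is_zero_obj C Z"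
    and ex_biproduct: "\<lbrakk>X \<in> Obj C; Y \<in> Obj C\<rbrakk> \<Longrightarrow> \<exists>P i j p q. is_biproduct C X Y P i j p q"
    and ex_kernel: "\<lbrakk>X \<in> Obj C; Y \<in> Obj C; f \<in> Hom C X Y\<rbrakk> \<Longrightarrow> \<exists>K k. is_kernel C X Y f K k"
    and ex_cokernel: "\<lbrakk>X \<in> Obj C; Y \<in> Obj C; f \<in> Hom C X Y\<rbrakk> \<Longrightarrow> \<exists>Q q. is_cokernel C X Y f Q q"
    and mono_normal: "\<lbrakk>X \<in> Obj C; Y \<in> Obj C; is_mono C X Y f\<rbrakk>
          \<Longrightarrow> \<exists>Z\<in>Obj C. \<exists>g\<in>Hom C Y Z. is_kernel C Y Z g X f"
    and epi_normal: "\<lbrakk>X \<in> Obj C; Y \<in> Obj C; is_epi C X Y f\<rbrakk>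
          \<Longrightarrow> \<exists>Z\<in>Obj C. \<exists>g\<in>Hom C Z X. is_cokernel C Z X g Y f"

definition is_ses ::
  "('o, 'm, 'z) addcat_scheme \<Rightarrow> 'o \<Rightarrow> 'o \<Rightarrow> 'o \<Rightarrow> 'm \<Rightarrow> 'm \<Rightarrow> bool" where
  "is_ses C X Y Z f g \<longleftrightarrow> X \<in> Obj C \<and> Y \<in> Obj C \<and> Z \<in> Obj C \<and>
     is_kernel C Y Z g X f \<and> is_cokernel C X Y f Z g"

subsection \<open>Grothendieck categories\<close>

text \<open>
  The type \<open>'u\<close> plays the role of the set-theoretic universe: a set is small if its
  cardinality is strictly below that of \<open>'u\<close>.  If \<open>'u\<close> has strongly inaccessible
  cardinality, these are the sets that belong up to bijection to the corresponding Grothendieck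
  universe.  Since HOL does not prove that types of inaccessible cardinality exist,
  \<open>'u\<close> is left arbitrary.  Hom-sets and classes of extensions are HOL sets, and
  no separate local smallness condition is imposed.
\<close>

definition small :: "'u itself \<Rightarrow> 'a set \<Rightarrow> bool" where
  "small _ S \<longleftrightarrow> (card_of S, card_of (UNIV :: 'u set)) \<in> ordLess"

text \<open>If \<open>'u\<close> is infinite, every small category is isomorphic to one whose objects and
  morphisms have type \<open>'u\<close>.\<close>

definition small_category :: "'u itself \<Rightarrow> ('u, 'u) cat \<Rightarrow> bool" where
  "small_category U J \<longleftrightarrow> category J \<and> small U (Obj J) \<and>
     small U {(i, j, u). i \<in> Obj J \<and> j \<in> Obj J \<and> u \<in> Hom J i j}"

definition cocomplete :: "'u itself \<Rightarrow> ('o, 'm, 'z) cat_scheme \<Rightarrow> bool" where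
  "cocomplete U C \<longleftrightarrow>
     (\<forall>J K. small_category U J \<and> is_functor J C K \<longrightarrow> (\<exists>L \<kappa>. is_colimit J C K L \<kappa>))"

definition exact_filtered_colimits :: "'u itself \<Rightarrow> ('o, 'm, 'z) addcat_scheme \<Rightarrow> bool" where
  "exact_filtered_colimits U C \<longleftrightarrow>
     (\<forall>J K L M \<alpha> \<beta> cK cL cM \<kappa> \<nu> \<mu> a b.
        small_category U J \<and> is_filtered J \<and>
        is_functor J C K \<and> is_functor J C L \<and> is_functor J C M \<and>
        is_nat_trans J C K L \<alpha> \<and> is_nat_trans J C L M \<beta> \<and>
        (\<forall>j\<in>Obj J. is_ses C (omap K j) (omap L j) (omap M j) (\<alpha> j) (\<beta> j)) \<and>
        is_colimit J C K cK \<kappa> \<and> is_colimit J C L cL \<nu> \<and> is_colimit J C M cM \<mu> \<and>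
        a \<in> Hom C cK cL \<and> (\<forall>j\<in>Obj J. a \<cdot>\<^bsub>C\<^esub> \<kappa> j = \<nu> j \<cdot>\<^bsub>C\<^esub> \<alpha> j) \<and>
        b \<in> Hom C cL cM \<and> (\<forall>j\<in>Obj J. b \<cdot>\<^bsub>C\<^esub> \<nu> j = \<mu> j \<cdot>\<^bsub>C\<^esub> \<beta> j)
        \<longrightarrow> is_ses C cK cL cM a b)"

definition is_generator :: "('o, 'm, 'z) cat_scheme \<Rightarrow> 'o \<Rightarrow> bool" where
  "is_generator C U \<longleftrightarrow> U \<in> Obj C \<and>
     (\<forall>X\<in>Obj C. \<forall>Y\<in>Obj C. \<forall>f\<in>Hom C X Y. \<forall>g\<in>Hom C X Y.
        f \<noteq> g \<longrightarrow> (\<exists>h\<in>Hom C U X. f \<cdot>\<^bsub>C\<^esub> h \<noteq> g \<cdot>\<^bsub>C\<^esub> h))"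

definition grothendieck_category :: "'u itself \<Rightarrow> ('o, 'm, 'z) addcat_scheme \<Rightarrow> bool" where
  "grothendieck_category U C \<longleftrightarrow>
     abelian_category C \<and> cocomplete U C \<and> exact_filtered_colimits U C \<and> (\<exists>G. is_generator C G)"

subsection \<open>Right split and left split classes\<close>

definition right_split ::
  "('o, 'm, 'z) addcat_scheme \<Rightarrow> ('p, 'n, 'y) addcat_scheme \<Rightarrow> ('o, 'm, 'p, 'n) func
     \<Rightarrow> 'o set \<Rightarrow> bool" where
  "right_split A B F S \<longleftrightarrow>
     (\<forall>X Y Z f g. Z \<in> S \<and> is_ses A X Y Z f g \<longrightarrow>
        is_ses B (omap F X) (omap F Y) (omap F Z) (mmap F f) (mmap F g))"

definition left_split ::
  "('p, 'n, 'y) addcat_scheme \<Rightarrow> ('o, 'm, 'z) addcat_scheme \<Rightarrow> ('p, 'n, 'o, 'm) func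
     \<Rightarrow> 'p set \<Rightarrow> bool" where
  "left_split B A G S \<longleftrightarrow>
     (\<forall>X Y Z f g. X \<in> S \<and> is_ses B X Y Z f g \<longrightarrow>
        is_ses A (omap G X) (omap G Y) (omap G Z) (mmap G f) (mmap G g))"

section \<open>Cotorsion pairs\<close>

text \<open>Yoneda extensions: \<open>(X, i, p)\<close> is an extension of \<open>D\<close> by \<open>E\<close>
  if \<open>E \<rightarrow> X \<rightarrow> D\<close> is short exact, and the class of the split extensions is the zero of
  the group \<open>Ext1\<close>.\<close>

definition extensions :: "('o, 'm, 'z) addcat_scheme \<Rightarrow> 'o \<Rightarrow> 'o \<Rightarrow> ('o \<times> 'm \<times> 'm) set" where
  "extensions C D E = {(X, i, p). is_ses C E X D i p}"

definition ext_equiv ::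
  "('o, 'm, 'z) addcat_scheme \<Rightarrow> 'o \<Rightarrow> 'o \<Rightarrow> (('o \<times> 'm \<times> 'm) \<times> ('o \<times> 'm \<times> 'm)) set" where
  "ext_equiv C D E = {((X, i, p), (X', i', p')).
     (X, i, p) \<in> extensions C D E \<and> (X', i', p') \<in> extensions C D E \<and>
     (\<exists>t. is_iso C X X' t \<and> t \<cdot>\<^bsub>C\<^esub> i = i' \<and> p' \<cdot>\<^bsub>C\<^esub> t = p)}"

definition Ext1 :: "('o, 'm, 'z) addcat_scheme \<Rightarrow> 'o \<Rightarrow> 'o \<Rightarrow> ('o \<times> 'm \<times> 'm) set set" where
  "Ext1 C D E = extensions C D E // ext_equiv C D E"

definition Ext1_zero :: "('o, 'm, 'z) addcat_scheme \<Rightarrow> 'o \<Rightarrow> 'o \<Rightarrow> ('o \<times> 'm \<times> 'm) set" where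
  "Ext1_zero C D E =
     {(X, i, p). (X, i, p) \<in> extensions C D E \<and> (\<exists>s\<in>Hom C D X. p \<cdot>\<^bsub>C\<^esub> s = Ident C D)}"

definition cotorsion_pair :: "('o, 'm, 'z) addcat_scheme \<Rightarrow> 'o set \<Rightarrow> 'o set \<Rightarrow> bool" where
  "cotorsion_pair C \<D> \<E> \<longleftrightarrow> \<D> \<subseteq> Obj C \<and> \<E> \<subseteq> Obj C \<and>
     (\<forall>D\<in>Obj C. D \<in> \<D> \<longleftrightarrow> (\<forall>E\<in>\<E>. Ext1 C D E = {Ext1_zero C D E})) \<and>
     (\<forall>E\<in>Obj C. E \<in> \<E> \<longleftrightarrow> (\<forall>D\<in>\<D>. Ext1 C D E = {Ext1_zero C D E}))"

definition complete_cotorsion_pair ::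
  "('o, 'm, 'z) addcat_scheme \<Rightarrow> 'o set \<Rightarrow> 'o set \<Rightarrow> bool" where
  "complete_cotorsion_pair C \<D> \<E> \<longleftrightarrow> cotorsion_pair C \<D> \<E> \<and>
     (\<forall>X\<in>Obj C. (\<exists>E\<in>\<E>. \<exists>D\<in>\<D>. \<exists>f g. is_ses C X E D f g) \<and>
                (\<exists>E\<in>\<E>. \<exists>D\<in>\<D>. \<exists>f g. is_ses C E D X f g))"

section \<open>Cochain complexes\<close>

datatype ('o, 'm) cochain = Cochain (cob: "int \<Rightarrow> 'o") (cdiff: "int \<Rightarrow> 'm")

definition Ch :: "('o, 'm, 'z) addcat_scheme \<Rightarrow> (('o, 'm) cochain, int \<Rightarrow> 'm) addcat" where
  "Ch C = \<lparr>
     Obj = {X. \<forall>n. cob X n \<in> Obj C \<and> cdiff X n \<in> Hom C (cob X n) (cob X (n + 1)) \<and>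
                 cdiff X (n + 1) \<cdot>\<^bsub>C\<^esub> cdiff X n = Zero C (cob X n) (cob X (n + 1 + 1))},
     Hom = (\<lambda>X Y. {f. \<forall>n. f n \<in> Hom C (cob X n) (cob Y n) \<and>
                 f (n + 1) \<cdot>\<^bsub>C\<^esub> cdiff X n = cdiff Y n \<cdot>\<^bsub>C\<^esub> f n}),
     Ident = (\<lambda>X n. Ident C (cob X n)),
     Comp = (\<lambda>g f n. g n \<cdot>\<^bsub>C\<^esub> f n),
     Plus = (\<lambda>f g n. f n \<boxplus>\<^bsub>C\<^esub> g n),
     Zero = (\<lambda>X Y n. Zero C (cob X n) (cob Y n)) \<rparr>"

definition is_cycles ::
  "('o, 'm, 'z) addcat_scheme \<Rightarrow> ('o, 'm) cochain \<Rightarrow> int \<Rightarrow> 'o \<Rightarrow> 'm \<Rightarrow> bool" where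
  "is_cycles C X n Z i \<longleftrightarrow> is_kernel C (cob X n) (cob X (n + 1)) (cdiff X n) Z i"

text \<open>\<open>H\<close> is the cohomology in degree \<open>n\<close>: the cokernel, with projection
  \<open>p\<close>, of the map into the cycles \<open>i: Z \<rightarrow> X\<^sup>n\<close> induced by the differential.\<close>

definition is_cohomology ::
  "('o, 'm, 'z) addcat_scheme \<Rightarrow> ('o, 'm) cochain \<Rightarrow> int \<Rightarrow> 'o \<Rightarrow> 'm \<Rightarrow> 'o \<Rightarrow> 'm \<Rightarrow> bool" where
  "is_cohomology C X n Z i H p \<longleftrightarrow> is_cycles C X n Z i \<and>
     (\<exists>e\<in>Hom C (cob X (n - 1)) Z.
        i \<cdot>\<^bsub>C\<^esub> e = cdiff X (n - 1) \<and> is_cokernel C (cob X (n - 1)) Z e H p)"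

definition Ac :: "('o, 'm, 'z) addcat_scheme \<Rightarrow> ('o, 'm) cochain set" where
  "Ac C = {X \<in> Obj (Ch C). \<forall>n Z i H p. is_cohomology C X n Z i H p \<longrightarrow> is_zero_obj C H}"

definition quasi_isos ::
  "('o, 'm, 'z) addcat_scheme \<Rightarrow> ('o, 'm) cochain \<Rightarrow> ('o, 'm) cochain \<Rightarrow> (int \<Rightarrow> 'm) set" where
  "quasi_isos C X Y = {f \<in> Hom (Ch C) X Y.
     \<forall>n Z i H p Z' i' H' p' z h.
       is_cohomology C X n Z i H p \<and> is_cohomology C Y n Z' i' H' p' \<and>
       z \<in> Hom C Z Z' \<and> i' \<cdot>\<^bsub>C\<^esub> z = f n \<cdot>\<^bsub>C\<^esub> i \<and>
       h \<in> Hom C H H' \<and> h \<cdot>\<^bsub>C\<^esub> p = p' \<cdot>\<^bsub>C\<^esub> z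
       \<longrightarrow> is_iso C H H' h}"

definition null_homotopic ::
  "('o, 'm, 'z) addcat_scheme \<Rightarrow> ('o, 'm) cochain \<Rightarrow> ('o, 'm) cochain \<Rightarrow> (int \<Rightarrow> 'm) \<Rightarrow> bool" where
  "null_homotopic C X Y f \<longleftrightarrow>
     (\<exists>s. (\<forall>n. s n \<in> Hom C (cob X n) (cob Y (n - 1))) \<and>
          (\<forall>n. f n = (cdiff Y (n - 1) \<cdot>\<^bsub>C\<^esub> s n) \<boxplus>\<^bsub>C\<^esub> (s (n + 1) \<cdot>\<^bsub>C\<^esub> cdiff X n)))"

text \<open>Both classes of a cotorsion pair are closed under isomorphism, so in \<open>tilde\<close> the
  choice of the kernel is immaterial.\<close>

definition tilde :: "('o, 'm, 'z) addcat_scheme \<Rightarrow> 'o set \<Rightarrow> ('o, 'm) cochain set" where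
  "tilde C \<S> = {X \<in> Ac C. \<forall>n Z i. is_cycles C X n Z i \<longrightarrow> Z \<in> \<S>}"

definition dg_left ::
  "('o, 'm, 'z) addcat_scheme \<Rightarrow> 'o set \<Rightarrow> 'o set \<Rightarrow> ('o, 'm) cochain set" where
  "dg_left C \<D> \<E> = {X \<in> Obj (Ch C). (\<forall>n. cob X n \<in> \<D>) \<and>
     (\<forall>E\<in>tilde C \<E>. \<forall>f\<in>Hom (Ch C) X E. null_homotopic C X E f)}"

definition dg_right ::
  "('o, 'm, 'z) addcat_scheme \<Rightarrow> 'o set \<Rightarrow> 'o set \<Rightarrow> ('o, 'm) cochain set" where
  "dg_right C \<D> \<E> = {X \<in> Obj (Ch C). (\<forall>n. cob X n \<in> \<E>) \<and>
     (\<forall>D\<in>tilde C \<D>. \<forall>f\<in>Hom (Ch C) D X. null_homotopic C D X f)}"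

subsection \<open>Induced model structures and Quillen adjunctions\<close>

definition induces_model_structure ::
  "('o, 'm, 'z) addcat_scheme \<Rightarrow> 'o set \<Rightarrow> 'o set \<Rightarrow> bool" where
  "induces_model_structure C \<D> \<E> \<longleftrightarrow>
     complete_cotorsion_pair (Ch C) (dg_left C \<D> \<E>) (tilde C \<E>) \<and>
     complete_cotorsion_pair (Ch C) (tilde C \<D>) (dg_right C \<D> \<E>) \<and>
     tilde C \<D> = dg_left C \<D> \<E> \<inter> Ac C \<and>
     tilde C \<E> = dg_right C \<D> \<E> \<inter> Ac C"

record ('o, 'm) model =
  Weq :: "'o \<Rightarrow> 'o \<Rightarrow> 'm set"
  Cof :: "'o \<Rightarrow> 'o \<Rightarrow> 'm set"
  Fib :: "'o \<Rightarrow> 'o \<Rightarrow> 'm set"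

definition induced_model ::
  "('o, 'm, 'z) addcat_scheme \<Rightarrow> 'o set \<Rightarrow> 'o set \<Rightarrow> (('o, 'm) cochain, int \<Rightarrow> 'm) model" where
  "induced_model C \<D> \<E> = \<lparr>
     Weq = quasi_isos C,
     Cof = (\<lambda>X Y. {f. is_mono (Ch C) X Y f \<and>
              (\<exists>Q\<in>dg_left C \<D> \<E>. \<exists>q. is_cokernel (Ch C) X Y f Q q)}),
     Fib = (\<lambda>X Y. {f. is_epi (Ch C) X Y f \<and>
              (\<exists>K\<in>dg_right C \<D> \<E>. \<exists>k. is_kernel (Ch C) X Y f K k)}) \<rparr>"

text \<open>A Quillen adjunction is an adjunction whose left adjoint preserves cofibrations and trivial
  cofibrations and whose right adjoint preserves fibrations and trivial fibrations.  For model
  categories either half implies the other.\<close>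

definition quillen_adjunction ::
  "('o, 'm, 'z) cat_scheme \<Rightarrow> ('o, 'm) model \<Rightarrow> ('p, 'n, 'y) cat_scheme \<Rightarrow> ('p, 'n) model
     \<Rightarrow> ('o, 'm, 'p, 'n) func \<Rightarrow> ('p, 'n, 'o, 'm) func \<Rightarrow> ('o \<Rightarrow> 'p \<Rightarrow> 'n \<Rightarrow> 'm) \<Rightarrow> bool" where
  "quillen_adjunction C M D N F G \<phi> \<longleftrightarrow> is_adjunction C D F G \<phi> \<and>
     (\<forall>X\<in>Obj C. \<forall>Y\<in>Obj C.
        mmap F ` Cof M X Y \<subseteq> Cof N (omap F X) (omap F Y) \<and>
        mmap F ` (Cof M X Y \<inter> Weq M X Y)
          \<subseteq> Cof N (omap F X) (omap F Y) \<inter> Weq N (omap F X) (omap F Y)) \<and>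
     (\<forall>X\<in>Obj D. \<forall>Y\<in>Obj D.
        mmap G ` Fib N X Y \<subseteq> Fib M (omap G X) (omap G Y) \<and>
        mmap G ` (Fib N X Y \<inter> Weq N X Y)
          \<subseteq> Fib M (omap G X) (omap G Y) \<inter> Weq M (omap G X) (omap G Y))"

definition Ch_func ::
  "('o, 'm, 'p, 'n) func \<Rightarrow> (('o, 'm) cochain, int \<Rightarrow> 'm, ('p, 'n) cochain, int \<Rightarrow> 'n) func" where
  "Ch_func F = \<lparr>
     omap = (\<lambda>X. Cochain (\<lambda>n. omap F (cob X n)) (\<lambda>n. mmap F (cdiff X n))),
     mmap = (\<lambda>f n. mmap F (f n)) \<rparr>"

definition Ch_transpose ::
  "('o \<Rightarrow> 'p \<Rightarrow> 'n \<Rightarrow> 'm)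
     \<Rightarrow> ('o, 'm) cochain \<Rightarrow> ('p, 'n) cochain \<Rightarrow> (int \<Rightarrow> 'n) \<Rightarrow> (int \<Rightarrow> 'm)" where
  "Ch_transpose \<phi> X Y f n = \<phi> (cob X n) (cob Y n) (f n)"

end

theory Submission
  imports Defs
begin

text \<open>
  Every extension of \<open>D\<close> by \<open>G E'\<close> splits as soon as \<open>F\<close> keeps it exact, because the counit
  \<open>F (G E') \<rightarrow> E'\<close> then extends along it; and \<open>G\<close> keeps a sequence with kernel \<open>E'\<close> exact because
  a cover of \<open>G Z\<close> by an object of \<open>\<D>\<close> corresponds to a map from an object of \<open>\<D>'\<close> to \<open>Z\<close>,
  which lifts.  The objects of \<open>\<D>\<close> and \<open>\<E>'\<close> needed for this come from completeness of the
  pairs of complexes.  The converse is the same argument in the opposite categories.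

  An exact complex with cycles in \<open>\<D>\<close> is spliced from short exact sequences between objects of
  \<open>\<D>\<close>, so \<open>F\<close> maps it to one with cycles in \<open>\<D>'\<close>, and dually for \<open>G\<close>.  Since homotopies
  correspond under the adjunction, the dg-classes are preserved too.  For the trivial cofibrations
  and fibrations one needs that a monomorphism (epimorphism) of complexes is a quasi-isomorphism
  exactly if its cokernel (kernel) is acyclic.

  Diagram chases use generalised elements \<open>x: W \<rightarrow> X\<close>, where surjectivity means that an element
  lifts after precomposition with some epimorphism \<open>V \<rightarrow> W\<close>.
\<close>

section \<open>Arrows in preadditive categories\<close>

text \<open>Hom-sets may overlap and composition outside them is unconstrained, so no equation can
  be rewritten without knowing the endpoints of each arrow; \<open>arr\<close> carries them through
  every chase. Three things have to be produced rather than quoted. Completeness concerns complexes,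
  so an object of \<open>A\<close> or \<open>B\<close> is placed into a complex, approximated there,
  and the result is evaluated in one degree. The functors are not assumed additive; preservation of
  zero maps and of sums is derived from the adjunction, and sums matter because a homotopy is a sum
  of two composites. Cohomology is defined through all choices of kernels and cokernels, so it is
  replaced by conditions on generalised elements that mention no choice; these take the place of the
  long exact cohomology sequence.\<close>

definition arr :: "('o, 'm, 'z) cat_scheme \<Rightarrow> 'm \<Rightarrow> 'o \<Rightarrow> 'o \<Rightarrow> bool" where
  "arr C f X Y \<longleftrightarrow> X \<in> Obj C \<and> Y \<in> Obj C \<and> f \<in> Hom C X Y"

text \<open>Epimorphisms in the role of refinements: a generalised element may be replaced by its
  composite with a cover, and an equation of arrows can be checked after one.\<close>

definition cover :: "('o, 'm, 'z) cat_scheme \<Rightarrow> 'm \<Rightarrow> 'o \<Rightarrow> 'o \<Rightarrow> bool" where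
  "cover C f X Y \<longleftrightarrow> arr C f X Y \<and> is_epi C X Y f"

lemma arrI: "X \<in> Obj C \<Longrightarrow> Y \<in> Obj C \<Longrightarrow> f \<in> Hom C X Y \<Longrightarrow> arr C f X Y"
  by (simp add: arr_def)

lemma arrD:
  assumes "arr C f X Y"
  shows "X \<in> Obj C" "Y \<in> Obj C" "f \<in> Hom C X Y"
  using assms by (simp_all add: arr_def)

lemma cover_arr: "cover C f X Y \<Longrightarrow> arr C f X Y"
  by (simp add: cover_def)

lemma cover_cancel:
  assumes "cover C e X Y" "arr C g Y Z" "arr C h Y Z" "g \<cdot>\<^bsub>C\<^esub> e = h \<cdot>\<^bsub>C\<^esub> e"
  shows "g = h"
  using assms by (auto simp: cover_def arr_def is_epi_def)

context category
begin

lemma arr_id: "X \<in> Obj C \<Longrightarrow> arr C (Ident C X) X X"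
  by (simp add: arr_def ident_hom)

lemma arr_comp: "arr C g Y Z \<Longrightarrow> arr C f X Y \<Longrightarrow> arr C (g \<cdot> f) X Z"
  by (auto simp: arr_def intro: comp_hom)

lemma assoc: "arr C h Y Z \<Longrightarrow> arr C g X Y \<Longrightarrow> arr C f W X \<Longrightarrow> (h \<cdot> g) \<cdot> f = h \<cdot> (g \<cdot> f)"
  by (auto simp: arr_def intro: comp_assoc)

lemma id_left: "arr C f X Y \<Longrightarrow> Ident C Y \<cdot> f = f"
  by (auto simp: arr_def intro: ident_left)

lemma id_right: "arr C f X Y \<Longrightarrow> f \<cdot> Ident C X = f"
  by (auto simp: arr_def intro: ident_right)

lemma cover_comp:
  assumes "cover C e X Y" "cover C e' W X"
  shows "cover C (e \<cdot> e') W Y"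
proof -
  note a = assms[THEN cover_arr]
  have "g = h" if "arr C g Y V" "arr C h Y V" "g \<cdot> (e \<cdot> e') = h \<cdot> (e \<cdot> e')" for g h V
  proof -
    have "(g \<cdot> e) \<cdot> e' = (h \<cdot> e) \<cdot> e'" using that a by (metis assoc)
    then have "g \<cdot> e = h \<cdot> e" using assms(2) that a by (metis cover_cancel arr_comp)
    then show ?thesis using assms(1) that cover_cancel by metis
  qed
  moreover have "arr C (e \<cdot> e') W Y" using a arr_comp by metis
  ultimately show ?thesis by (auto simp: cover_def is_epi_def arr_def)
qed

lemma cover_id: "X \<in> Obj C \<Longrightarrow> cover C (Ident C X) X X"
  using arr_id[of X] by (auto simp: cover_def is_epi_def arr_def ident_right)

text \<open>The usual way to prove surjectivity of \<open>f\<close>: a generalised element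
  \<open>g\<close> lifts some cover of the target through \<open>f\<close>.\<close>

lemma cover_factor:
  assumes "cover C (f \<cdot> g) W Y" "arr C f X Y" "arr C g W X"
  shows "cover C f X Y"
proof -
  have "h = k" if "arr C h Y V" "arr C k Y V" "h \<cdot> f = k \<cdot> f" for h k V
  proof -
    have "h \<cdot> (f \<cdot> g) = k \<cdot> (f \<cdot> g)"
      using assoc[OF that(1) assms(2,3)] assoc[OF that(2) assms(2,3)] that(3) by simp
    then show ?thesis using assms(1) that cover_cancel by metis
  qed
  then show ?thesis using assms(2) by (auto simp: cover_def is_epi_def arr_def)
qed

end

context preadditive_category
begin

lemma arr_zero: "X \<in> Obj C \<Longrightarrow> Y \<in> Obj C \<Longrightarrow> arr C (Zero C X Y) X Y"
  by (simp add: arr_def zero_hom)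

lemma arr_plus: "arr C f X Y \<Longrightarrow> arr C g X Y \<Longrightarrow> arr C (f \<boxplus> g) X Y"
  by (simp add: arr_def plus_hom)

lemma add_assoc: "arr C f X Y \<Longrightarrow> arr C g X Y \<Longrightarrow> arr C h X Y \<Longrightarrow> (f \<boxplus> g) \<boxplus> h = f \<boxplus> (g \<boxplus> h)"
  by (auto simp: arr_def intro: plus_assoc)

lemma add_commute: "arr C f X Y \<Longrightarrow> arr C g X Y \<Longrightarrow> f \<boxplus> g = g \<boxplus> f"
  by (auto simp: arr_def intro: plus_commute)

lemma add_zero: "arr C f X Y \<Longrightarrow> f \<boxplus> Zero C X Y = f"
  by (auto simp: arr_def intro: plus_zero)

lemma zero_add: "arr C f X Y \<Longrightarrow> Zero C X Y \<boxplus> f = f"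
  by (metis add_commute add_zero arr_def arr_zero)

lemma add_comp: "arr C g Y Z \<Longrightarrow> arr C h Y Z \<Longrightarrow> arr C f X Y \<Longrightarrow> (g \<boxplus> h) \<cdot> f = (g \<cdot> f) \<boxplus> (h \<cdot> f)"
  by (rule comp_plus_left[of X Y Z]) (simp_all only: arr_def)

lemma comp_add: "arr C h Y Z \<Longrightarrow> arr C f X Y \<Longrightarrow> arr C g X Y \<Longrightarrow> h \<cdot> (f \<boxplus> g) = (h \<cdot> f) \<boxplus> (h \<cdot> g)"
  by (rule comp_plus_right[of X Y Z]) (simp_all only: arr_def)

lemma ex_neg: "arr C f X Y \<Longrightarrow> \<exists>g. arr C g X Y \<and> f \<boxplus> g = Zero C X Y"
  by (metis arr_def plus_inverse)

lemma add_cancel: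
  assumes "arr C f X Y" "arr C g X Y" "arr C h X Y" "f \<boxplus> h = g \<boxplus> h"
  shows "f = g"
proof -
  obtain k where k: "arr C k X Y" "h \<boxplus> k = Zero C X Y" using ex_neg assms(3) by blast
  have "f = (f \<boxplus> h) \<boxplus> k" using add_assoc[OF assms(1,3) k(1)] add_zero[OF assms(1)] k(2) by simp
  also have "\<dots> = g" using add_assoc[OF assms(2,3) k(1)] add_zero[OF assms(2)] k(2) assms(4) by simp
  finally show ?thesis .
qed

lemma add_eq_self:
  assumes "arr C f X Y" "arr C g X Y" "f \<boxplus> g = g"
  shows "f = Zero C X Y"
  using assms add_cancel[of f X Y "Zero C X Y" g] by (metis arr_def zero_hom zero_add)

text \<open>The structure has addition but no subtraction; a difference is named by the equation it
  solves.\<close>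

lemma ex_diff:
  assumes "arr C f X Y" "arr C g X Y"
  shows "\<exists>h. arr C h X Y \<and> f = h \<boxplus> g"
proof -
  obtain k where k: "arr C k X Y" "g \<boxplus> k = Zero C X Y" using ex_neg assms(2) by blast
  have "(f \<boxplus> k) \<boxplus> g = f"
    using add_assoc[OF assms(1) k(1) assms(2)] add_commute[OF assms(2) k(1)] add_zero[OF assms(1)] k(2)
    by simp
  then show ?thesis using arr_plus[OF assms(1) k(1)] by metis
qed

lemma zero_comp:
  assumes "arr C f X Y" "Z \<in> Obj C"
  shows "Zero C Y Z \<cdot> f = Zero C X Z"
proof -
  have z: "arr C (Zero C Y Z) Y Z" using assms arr_zero arrD by metis
  have "(Zero C Y Z \<cdot> f) \<boxplus> (Zero C Y Z \<cdot> f) = Zero C Y Z \<cdot> f"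
    using z assms by (metis add_zero add_comp)
  then show ?thesis using z assms(1) add_eq_self arr_comp by metis
qed

lemma comp_zero:
  assumes "arr C f Y Z" "X \<in> Obj C"
  shows "f \<cdot> Zero C X Y = Zero C X Z"
proof -
  have z: "arr C (Zero C X Y) X Y" using assms arr_zero arrD by metis
  have "(f \<cdot> Zero C X Y) \<boxplus> (f \<cdot> Zero C X Y) = f \<cdot> Zero C X Y"
    using z assms by (metis add_zero comp_add)
  then show ?thesis using z assms(1) add_eq_self arr_comp by metis
qed

text \<open>Two competitors for cancellation differ by an arrow \<open>k\<close> that
  \<open>f\<close> kills, so only arrows with zero composite need testing.\<close>

lemma coverI:
  assumes "arr C f X Y" "\<And>Z g. arr C g Y Z \<Longrightarrow> g \<cdot> f = Zero C X Z \<Longrightarrow> g = Zero C Y Z"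
  shows "cover C f X Y"
proof -
  have "g = h" if gh: "arr C g Y Z" "arr C h Y Z" "g \<cdot> f = h \<cdot> f" for g h Z
  proof -
    obtain k where k: "arr C k Y Z" "g = k \<boxplus> h" using ex_diff gh by blast
    then have "(k \<cdot> f) \<boxplus> (h \<cdot> f) = h \<cdot> f" using gh assms(1) by (metis add_comp)
    then have "k \<cdot> f = Zero C X Z" using k gh assms(1) add_eq_self arr_comp by metis
    then show ?thesis using assms(2) k gh zero_add by metis
  qed
  then show ?thesis using assms(1) by (auto simp: cover_def is_epi_def arr_def)
qed

text \<open>The fourth rule asks nothing of \<open>g\<close> and \<open>h\<close>, although
  uniqueness in \<open>is_kernel\<close> concerns arrows killed by \<open>f\<close>: any composite
  \<open>k \<cdot> g\<close> is killed automatically.\<close>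

lemma kernelD:
  assumes "is_kernel C X Y f K k" "arr C f X Y"
  shows "arr C k K X" "f \<cdot> k = Zero C K Y"
    "\<And>W g. arr C g W X \<Longrightarrow> f \<cdot> g = Zero C W Y \<Longrightarrow> \<exists>h. arr C h W K \<and> k \<cdot> h = g"
    "\<And>W g h. arr C g W K \<Longrightarrow> arr C h W K \<Longrightarrow> k \<cdot> g = k \<cdot> h \<Longrightarrow> g = h"
proof -
  show k: "arr C k K X" and fk: "f \<cdot> k = Zero C K Y" using assms by (auto simp: is_kernel_def arr_def)
  show "\<exists>h. arr C h W K \<and> k \<cdot> h = g" if "arr C g W X" "f \<cdot> g = Zero C W Y" for W g
  proof -
    have "\<exists>!h. h \<in> Hom C W K \<and> k \<cdot> h = g" using assms(1) that by (simp add: is_kernel_def arr_def)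
    then show ?thesis using k that by (auto simp: arr_def)
  qed
  show "g = h" if "arr C g W K" "arr C h W K" "k \<cdot> g = k \<cdot> h" for W g h
  proof -
    have "f \<cdot> (k \<cdot> g) = Zero C W Y"
      using assoc[OF assms(2) k that(1)] fk zero_comp[OF that(1), of Y] arrD(2)[OF assms(2)] by simp
    moreover have "arr C (k \<cdot> g) W X" using k that arr_comp by metis
    ultimately have "\<exists>!h. h \<in> Hom C W K \<and> k \<cdot> h = k \<cdot> g"
      using assms(1) by (simp add: is_kernel_def arr_def)
    then show ?thesis using that by (auto simp: arr_def)
  qed
qed

lemma kernelI:
  assumes "arr C f X Y" "arr C k K X" "f \<cdot> k = Zero C K Y"
    "\<And>W g. arr C g W X \<Longrightarrow> f \<cdot> g = Zero C W Y \<Longrightarrow> \<exists>h. arr C h W K \<and> k \<cdot> h = g"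
    "\<And>W g. arr C g W K \<Longrightarrow> k \<cdot> g = Zero C W X \<Longrightarrow> g = Zero C W K"
  shows "is_kernel C X Y f K k"
proof -
  have u: "g = h" if gh: "arr C g W K" "arr C h W K" "k \<cdot> g = k \<cdot> h" for W g h
  proof -
    obtain r where r: "arr C r W K" "g = r \<boxplus> h" using ex_diff gh by blast
    then have "(k \<cdot> r) \<boxplus> (k \<cdot> h) = k \<cdot> h" using gh assms(2) by (metis comp_add)
    then have "k \<cdot> r = Zero C W X" using r gh assms(2) add_eq_self arr_comp by metis
    then show ?thesis using assms(5) r gh zero_add by metis
  qed
  have "\<exists>!h. h \<in> Hom C W K \<and> k \<cdot> h = g" if *: "W \<in> Obj C" "g \<in> Hom C W X" "f \<cdot> g = Zero C W Y" for W g
  proof -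
    have "arr C g W X" using * assms(1) by (simp add: arr_def)
    then obtain h where "arr C h W K" "k \<cdot> h = g" using assms(4) *(3) by blast
    then show ?thesis using u by (metis arr_def)
  qed
  then show ?thesis using assms(1-3) by (simp add: is_kernel_def arr_def)
qed

text \<open>What \<open>m \<cdot> f\<close> kills is already killed by \<open>f\<close>. This
  identifies the cycles of a differential with the kernel of its corestriction, and lets an
  extension be composed with an isomorphism.\<close>

lemma kernel_comp_mono:
  assumes "is_kernel C X Y f K k" "arr C f X Y" "arr C m Y Z"
    "\<And>W g. arr C g W Y \<Longrightarrow> m \<cdot> g = Zero C W Z \<Longrightarrow> g = Zero C W Y"
  shows "is_kernel C X Z (m \<cdot> f) K k"
proof (rule kernelI)
  note K = kernelD[OF assms(1,2)]
  show mf: "arr C (m \<cdot> f) X Z" using assms arr_comp by metis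
  show "arr C k K X" by (rule K)
  show "(m \<cdot> f) \<cdot> k = Zero C K Z" using K(1,2) assms by (metis assoc comp_zero arrD(1))
  show "\<exists>h. arr C h W K \<and> k \<cdot> h = g" if "arr C g W X" "(m \<cdot> f) \<cdot> g = Zero C W Z" for W g
  proof -
    have fg: "arr C (f \<cdot> g) W Y" using assms(2) that(1) by (rule arr_comp)
    have "m \<cdot> (f \<cdot> g) = Zero C W Z" using assoc[OF assms(3,2) that(1)] that(2) by simp
    then show ?thesis using assms(4)[OF fg] K(3)[OF that(1)] by blast
  qed
  show "g = Zero C W K" if "arr C g W K" "k \<cdot> g = Zero C W X" for W g
    using that K(1,4) by (metis comp_zero arr_zero arrD(1,2))
qed

end

section \<open>Opposite categories and the duality dictionary\<close>

definition op :: "('o, 'm, 'z) addcat_scheme \<Rightarrow> ('o, 'm) addcat" where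
  "op C = \<lparr>Obj = Obj C, Hom = (\<lambda>X Y. Hom C Y X), Ident = Ident C, Comp = (\<lambda>g f. f \<cdot>\<^bsub>C\<^esub> g),
     Plus = Plus C, Zero = (\<lambda>X Y. Zero C Y X)\<rparr>"

lemma op_simps [simp]:
  "Obj (op C) = Obj C" "Hom (op C) X Y = Hom C Y X" "Ident (op C) = Ident C"
  "g \<cdot>\<^bsub>op C\<^esub> f = f \<cdot>\<^bsub>C\<^esub> g" "Plus (op C) = Plus C" "Zero (op C) X Y = Zero C Y X"
  by (simp_all add: op_def)

lemma op_iff:
  "arr (op C) f X Y \<longleftrightarrow> arr C f Y X"
  "is_mono (op C) X Y f \<longleftrightarrow> is_epi C Y X f"
  "is_epi (op C) X Y f \<longleftrightarrow> is_mono C Y X f"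
  "is_zero_obj (op C) X \<longleftrightarrow> is_zero_obj C X"
  "is_kernel (op C) X Y f Z g \<longleftrightarrow> is_cokernel C Y X f Z g"
  "is_cokernel (op C) X Y f Z g \<longleftrightarrow> is_kernel C Y X f Z g"
  "is_ses (op C) X Y Z f g \<longleftrightarrow> is_ses C Z Y X g f"
  by (auto simp: arr_def is_mono_def is_epi_def is_zero_obj_def is_kernel_def is_cokernel_def is_ses_def)

lemma op_biproduct: "is_biproduct C X Y P i j p q \<Longrightarrow> is_biproduct (op C) X Y P p q i j"
  by (simp add: is_biproduct_def)

lemma (in preadditive_category) preadditive_op: "preadditive_category (op C)"
  by (unfold_locales, simp_all only: op_simps)
    (rule ident_hom comp_hom ident_left ident_right comp_assoc[symmetric] zero_hom plus_hom plus_assoc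
      plus_commute plus_zero plus_inverse comp_plus_left comp_plus_right; assumption)+

lemma (in abelian_category) abelian_op: "abelian_category (op C)"
proof (intro abelian_category.intro preadditive_op abelian_category_axioms.intro, simp_all only: op_simps op_iff)
  show "\<exists>P i j p q. is_biproduct (op C) X Y P i j p q" if "X \<in> Obj C" "Y \<in> Obj C" for X Y
    using that ex_biproduct[of X Y] by (metis op_biproduct)
  show "\<And>X Y f. X \<in> Obj C \<Longrightarrow> Y \<in> Obj C \<Longrightarrow> is_epi C Y X f \<Longrightarrow>
      \<exists>Z\<in>Obj C. \<exists>g\<in>Hom C Z Y. is_cokernel C Z Y g X f"
    by (rule epi_normal)
  show "\<And>X Y f. X \<in> Obj C \<Longrightarrow> Y \<in> Obj C \<Longrightarrow> is_mono C Y X f \<Longrightarrow>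
      \<exists>Z\<in>Obj C. \<exists>g\<in>Hom C X Z. is_kernel C X Z g Y f"
    by (rule mono_normal)
qed (rule ex_zero_obj ex_kernel ex_cokernel; assumption)+

section \<open>Pullbacks and exactness in abelian categories\<close>

context preadditive_category
begin

lemmas comp_simps = assoc add_comp comp_add zero_comp comp_zero add_zero zero_add id_left id_right

lemmas cokernelD = preadditive_category.kernelD[OF preadditive_op, unfolded op_iff op_simps]
lemmas cokernelI = preadditive_category.kernelI[OF preadditive_op, unfolded op_iff op_simps]

lemma cover_zero:
  assumes "cover C e X Y" "arr C g Y Z" "g \<cdot> e = Zero C X Z"
  shows "g = Zero C Y Z"
proof -
  note e = cover_arr[OF assms(1)]
  have "arr C (Zero C Y Z) Y Z" using assms(2) arr_zero arrD by metis
  moreover have "Zero C Y Z \<cdot> e = Zero C X Z" using zero_comp[OF e] assms(2) arrD(2) by metis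
  ultimately show ?thesis using cover_cancel[OF assms(1,2)] assms(3) by metis
qed

end

context abelian_category
begin

text \<open>\<open>m\<close> is the image of \<open>f\<close>, being the kernel of its cokernel. If
  \<open>c\<close> kills \<open>f'\<close>, then \<open>f\<close> factors through the subobject
  \<open>N\<close> of \<open>K\<close> on which \<open>c\<close> vanishes; normality shows that
  \<open>N\<close> is all of \<open>K\<close>, whence \<open>c\<close> is zero.\<close>

lemma coimage_cover:
  assumes q: "is_cokernel C X Y f Q q" "arr C f X Y"
    and m: "is_kernel C Y Q q K m" and f': "arr C f' X K" "m \<cdot> f' = f"
  shows "cover C f' X K"
proof (rule coverI[OF f'(1)])
  note Q = cokernelD[OF q]
  note M = kernelD[OF m Q(1)]
  fix V c assume c: "arr C c K V" "c \<cdot> f' = Zero C X V"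
  obtain N n where n: "is_kernel C K V c N n" using ex_kernel[of K V c] arrD[OF c(1)] by blast
  note N = kernelD[OF n c(1)]
  obtain f'' where f'': "arr C f'' X N" "n \<cdot> f'' = f'" using N(3)[OF f'(1) c(2)] by blast
  have mn: "arr C (m \<cdot> n) N Y" using M(1) N(1) arr_comp by blast
  have "is_mono C N Y (m \<cdot> n)"
  proof -
    have "g = h" if "arr C g W N" "arr C h W N" "(m \<cdot> n) \<cdot> g = (m \<cdot> n) \<cdot> h" for g h W
    proof -
      have "m \<cdot> (n \<cdot> g) = m \<cdot> (n \<cdot> h)" using that assoc[OF M(1) N(1)] by metis
      then show ?thesis using M(4) N(4) N(1) that(1,2) arr_comp by metis
    qed
    then show ?thesis using mn by (auto simp: is_mono_def arr_def)
  qed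
  \<comment> \<open>Writing \<open>m \<cdot> n\<close> as the kernel of some \<open>g\<close> turns
    the factorisation of \<open>f\<close> through \<open>N\<close> into the equation
    \<open>g \<cdot> f = 0\<close>. Then \<open>g\<close> factors through the cokernel
    \<open>q\<close>, so it kills \<open>m\<close> as well, and \<open>m\<close> factors through
    \<open>m \<cdot> n\<close>.\<close>
  then obtain Z g where "Z \<in> Obj C" "g \<in> Hom C Y Z" and k: "is_kernel C Y Z g N (m \<cdot> n)"
    using mono_normal[of N Y "m \<cdot> n"] arrD[OF mn] by blast
  then have g: "arr C g Y Z" using arrD[OF mn] arrI by metis
  note k = kernelD[OF k g]
  have "g \<cdot> f = (g \<cdot> (m \<cdot> n)) \<cdot> f''"
    unfolding f'(2)[symmetric] f''(2)[symmetric] using g M(1) N(1) f''(1) mn by (simp add: assoc)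
  then have "g \<cdot> f = Zero C X Z" using k(2) zero_comp[OF f''(1) arrD(2)[OF g]] by simp
  then obtain g' where g': "arr C g' Q Z" "g' \<cdot> q = g" using Q(3)[OF g] by blast
  have "g \<cdot> m = Zero C K Z"
    using assoc[OF g'(1) Q(1) M(1)] g'(2) M(2) comp_zero[OF g'(1) arrD(1)[OF M(1)]] by simp
  then obtain t where t: "arr C t K N" "(m \<cdot> n) \<cdot> t = m" using k(3)[OF M(1)] by blast
  have Kobj: "K \<in> Obj C" using arrD(1)[OF c(1)] .
  have "m \<cdot> (n \<cdot> t) = m \<cdot> Ident C K" using t M(1) N(1) by (simp add: assoc[OF M(1) N(1) t(1)] id_right)
  then have nt: "n \<cdot> t = Ident C K" using M(4) arr_comp[OF N(1) t(1)] arr_id[OF Kobj] by metis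
  have "c = (c \<cdot> n) \<cdot> t" using nt c(1) N(1) t(1) by (simp add: assoc id_right)
  then show "c = Zero C K V" using N(2) zero_comp[OF t(1) arrD(2)[OF c(1)]] by simp
qed

text \<open>By normality \<open>f\<close> is the cokernel of some \<open>g\<close>, and
  \<open>g\<close> factors through \<open>k\<close>, so whatever kills \<open>k\<close> kills
  \<open>g\<close> and descends along \<open>f\<close>.\<close>

lemma cokernel_of_kernel:
  assumes f: "cover C f X Z" and k: "is_kernel C X Z f K k"
  shows "is_cokernel C K X k Z f"
proof -
  note fa = cover_arr[OF f]
  note K = kernelD[OF k fa]
  obtain V g where "V \<in> Obj C" "g \<in> Hom C V X" and c: "is_cokernel C V X g Z f"
    using epi_normal[of X Z f] f arrD[OF fa] by (auto simp: cover_def)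
  then have g: "arr C g V X" using arrD[OF fa] arrI by metis
  note c = cokernelD[OF c g]
  obtain g' where g': "arr C g' V K" "k \<cdot> g' = g" using K(3)[OF g c(2)] by blast
  show ?thesis
  proof (rule cokernelI[OF K(1) fa K(2)])
    fix W h assume h: "arr C h X W" "h \<cdot> k = Zero C K W"
    have "h \<cdot> g = (h \<cdot> k) \<cdot> g'" unfolding g'(2)[symmetric] using h(1) K(1) g'(1) by (simp add: assoc)
    then have "h \<cdot> g = Zero C V W" using h(2) zero_comp[OF g'(1) arrD(2)[OF h(1)]] by simp
    then show "\<exists>t. arr C t Z W \<and> t \<cdot> f = h" using c(3)[OF h(1)] by blast
  next
    fix W h assume "arr C h Z W" "h \<cdot> f = Zero C X W"
    then show "h = Zero C Z W" using cover_zero[OF f] by blast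
  qed
qed

lemma cover_cokernel:
  assumes "is_cokernel C X Y f Q q" "arr C f X Y"
  shows "cover C q Y Q"
proof -
  note c = cokernelD[OF assms]
  show ?thesis using c(1,4) by (auto simp: cover_def is_epi_def arr_def)
qed

text \<open>Working form of short exactness: the cokernel condition reduces to \<open>g\<close>
  being epic, by \<open>cokernel_of_kernel\<close>.\<close>

lemma ses_iff: "is_ses C X Y Z f g \<longleftrightarrow> cover C g Y Z \<and> is_kernel C Y Z g X f"
proof
  assume s: "is_ses C X Y Z f g"
  then have "arr C f X Y" by (auto simp: is_ses_def is_kernel_def arr_def)
  then show "cover C g Y Z \<and> is_kernel C Y Z g X f" using s cover_cokernel by (auto simp: is_ses_def)
next
  assume a: "cover C g Y Z \<and> is_kernel C Y Z g X f"
  then show "is_ses C X Y Z f g" using cokernel_of_kernel[of g Y Z X f]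
    by (auto simp: is_ses_def cover_def arr_def is_kernel_def)
qed

text \<open>A vanishing kernel makes \<open>f\<close> the cokernel of a zero map, so the identity of
  \<open>X\<close> descends along \<open>f\<close>. This inverts \<open>f\<close> on one side, and
  cancelling the epimorphism gives the other.\<close>

lemma iso_if_mono_cover:
  assumes "cover C f X Y" "\<And>W g. arr C g W X \<Longrightarrow> f \<cdot> g = Zero C W Y \<Longrightarrow> g = Zero C W X"
  shows "\<exists>g. arr C g Y X \<and> g \<cdot> f = Ident C X \<and> f \<cdot> g = Ident C Y"
proof -
  note fa = cover_arr[OF assms(1)]
  note X = arrD(1)[OF fa] and Y = arrD(2)[OF fa]
  obtain K k where k: "is_kernel C X Y f K k" using ex_kernel[OF arrD[OF fa]] by blast
  note K = kernelD[OF k fa]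
  have k0: "k = Zero C K X" using assms(2)[OF K(1,2)] .
  note c = cokernelD[OF cokernel_of_kernel[OF assms(1) k] K(1)]
  have "Ident C X \<cdot> k = Zero C K X" using k0 id_left[OF K(1)] by simp
  then obtain g where g: "arr C g Y X" "g \<cdot> f = Ident C X" using c(3)[OF arr_id[OF X]] by blast
  have "(f \<cdot> g) \<cdot> f = Ident C Y \<cdot> f" using g fa by (simp add: assoc id_left id_right)
  then have "f \<cdot> g = Ident C Y" using cover_cancel[OF assms(1)] arr_comp[OF fa g(1)] arr_id[OF Y] by blast
  then show ?thesis using g by blast
qed

text \<open>\<open>N\<close> is the kernel of the difference of the two maps from the biproduct of
  \<open>X\<close> and \<open>Y\<close> to \<open>Z\<close>, with \<open>x\<close> and
  \<open>e\<close> the restricted projections. In place of the universal property the lemma records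
  what extensions and chases need: \<open>e\<close> is epic and has the same kernel object as
  \<open>f\<close>.\<close>

lemma pullback:
  assumes f: "cover C f X Z" and g: "arr C g Y Z"
  shows "\<exists>N e x. cover C e N Y \<and> arr C x N X \<and> f \<cdot> x = g \<cdot> e \<and>
    (\<forall>K k. is_kernel C X Z f K k \<longrightarrow> (\<exists>k'. is_kernel C N Y e K k' \<and> x \<cdot> k' = k))"
proof -
  note fa = cover_arr[OF f]
  note X = arrD(1)[OF fa] and Z = arrD(2)[OF fa] and Y = arrD(1)[OF g]
  obtain P i j p q where bp: "is_biproduct C X Y P i j p q" using ex_biproduct[OF X Y] by blast
  then have P: "P \<in> Obj C" and i: "arr C i X P" and j: "arr C j Y P" and p: "arr C p P X" and q: "arr C q P Y"
    using X Y by (auto simp: is_biproduct_def arr_def)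
  have b: "p \<cdot> i = Ident C X" "q \<cdot> j = Ident C Y" "p \<cdot> j = Zero C Y X" "q \<cdot> i = Zero C X Y"
    "(i \<cdot> p) \<boxplus> (j \<cdot> q) = Ident C P"
    using bp by (auto simp: is_biproduct_def)
  \<comment> \<open>\<open>h\<close> is the negative of \<open>g\<close>, so \<open>m\<close> below
    is \<open>f \<cdot> p - g \<cdot> q\<close>.\<close>
  obtain h where h: "arr C h Y Z" "g \<boxplus> h = Zero C Y Z" using ex_neg[OF g] by blast
  define m where "m = (f \<cdot> p) \<boxplus> (h \<cdot> q)"
  have m: "arr C m P Z" unfolding m_def using fa p h(1) q arr_comp arr_plus by blast
  have fp: "arr C (f \<cdot> p) P Z" and hq: "arr C (h \<cdot> q) P Z" using fa p h(1) q arr_comp by blast+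
  have mi: "m \<cdot> i = f" unfolding m_def add_comp[OF fp hq i] assoc[OF fa p i] assoc[OF h(1) q i] b
    using fa comp_zero[OF h(1) X] by (simp add: id_right add_zero)
  have mc: "cover C m P Z" using cover_factor[of m i X Z P] mi f m i by simp
  obtain N k where k: "is_kernel C P Z m N k" using ex_kernel[OF arrD[OF m]] by blast
  note K = kernelD[OF k m]
  have N: "N \<in> Obj C" using arrD(1)[OF K(1)] .
  note c = cokernelD[OF cokernel_of_kernel[OF mc k] K(1)]
  define x e where "x = p \<cdot> k" and "e = q \<cdot> k"
  have x: "arr C x N X" and e: "arr C e N Y" unfolding x_def e_def using p q K(1) arr_comp by blast+
  have fx: "f \<cdot> x = g \<cdot> e"
  proof -
    have 1: "(f \<cdot> x) \<boxplus> (h \<cdot> e) = Zero C N Z"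
      using K(2) unfolding m_def x_def e_def using fa p h(1) q K(1) fp hq by (simp add: comp_simps)
    have 2: "(g \<cdot> e) \<boxplus> (h \<cdot> e) = Zero C N Z"
      using add_comp[OF g h(1) e] h(2) zero_comp[OF e Z] by simp
    show ?thesis using add_cancel 1 2 arr_comp[OF fa x] arr_comp[OF g e] arr_comp[OF h(1) e] by metis
  qed
  \<comment> \<open>If \<open>u\<close> kills \<open>e\<close>, then \<open>u \<cdot> q\<close>
    kills the kernel of the epimorphism \<open>m\<close>, so
    \<open>u \<cdot> q = t \<cdot> m\<close>. Along \<open>i\<close> the left side vanishes and the
    right side is \<open>t \<cdot> f\<close>, which forces \<open>t = 0\<close>.\<close>
  have ec: "cover C e N Y"
  proof (rule coverI[OF e])
    fix W u assume u: "arr C u Y W" "u \<cdot> e = Zero C N W"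
    have W: "W \<in> Obj C" using u(1) by (simp add: arr_def)
    have uq: "arr C (u \<cdot> q) P W" using u q arr_comp by blast
    have "(u \<cdot> q) \<cdot> k = Zero C N W" using u(2) unfolding e_def by (simp add: assoc[OF u(1) q K(1)])
    then obtain t where t: "arr C t Z W" "t \<cdot> m = u \<cdot> q" using c(3)[OF uq] by blast
    have "t \<cdot> f = (u \<cdot> q) \<cdot> i" using assoc[OF t(1) m i] t(2) mi by simp
    also have "\<dots> = Zero C X W" using assoc[OF u(1) q i] b comp_zero[OF u(1) X] by simp
    finally have "t = Zero C Z W" using cover_zero[OF f t(1)] by simp
    then have "u \<cdot> q = Zero C P W" using t(2) zero_comp[OF m W] by simp
    then have "(u \<cdot> q) \<cdot> j = Zero C Y W" using zero_comp[OF j W] by simp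
    then show "u = Zero C Y W" using assoc[OF u(1) q j] b id_right[OF u(1)] by simp
  qed
  have "\<exists>k'. is_kernel C N Y e L k' \<and> x \<cdot> k' = l" if l: "is_kernel C X Z f L l" for L l
  proof -
    note L = kernelD[OF l fa]
    have Lo: "L \<in> Obj C" using arrD(1)[OF L(1)] .
    have "m \<cdot> (i \<cdot> l) = Zero C L Z" using assoc[OF m i L(1)] mi L(2) by simp
    then obtain k' where k': "arr C k' L N" "k \<cdot> k' = i \<cdot> l" using K(3)[OF arr_comp[OF i L(1)]] by blast
    have xk: "x \<cdot> k' = l" unfolding x_def
      using assoc[OF p K(1) k'(1)] k'(2) assoc[OF p i L(1)] b id_left[OF L(1)] by simp
    have ek: "e \<cdot> k' = Zero C L Y" unfolding e_def
      using assoc[OF q K(1) k'(1)] k'(2) assoc[OF q i L(1)] b zero_comp[OF L(1) Y] by simp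
    have "is_kernel C N Y e L k'"
    proof (rule kernelI[OF e k'(1) ek])
      fix W u assume u: "arr C u W N" "e \<cdot> u = Zero C W Y"
      have W: "W \<in> Obj C" using u(1) by (simp add: arr_def)
      have "f \<cdot> (x \<cdot> u) = g \<cdot> (e \<cdot> u)" using assoc[OF fa x u(1)] assoc[OF g e u(1)] fx by simp
      then have "f \<cdot> (x \<cdot> u) = Zero C W Z" using u(2) comp_zero[OF g W] by simp
      then obtain v where v: "arr C v W L" "l \<cdot> v = x \<cdot> u" using L(3)[OF arr_comp[OF x u(1)]] by blast
      have ku: "arr C (k \<cdot> u) W P" using K(1) u(1) arr_comp by blast
      have "k \<cdot> u = ((i \<cdot> p) \<boxplus> (j \<cdot> q)) \<cdot> (k \<cdot> u)" using b ku by (simp add: id_left)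
      also have "\<dots> = (i \<cdot> (x \<cdot> u)) \<boxplus> (j \<cdot> (e \<cdot> u))"
        unfolding x_def e_def using i j p q K(1) u(1) ku arr_comp[OF i p] arr_comp[OF j q] by (simp add: comp_simps)
      also have "\<dots> = i \<cdot> (l \<cdot> v)"
        using u(2) v comp_zero[OF j W] add_zero[OF arr_comp[OF i arr_comp[OF x u(1)]]] by simp
      also have "\<dots> = k \<cdot> (k' \<cdot> v)" using assoc[OF i L(1) v(1)] assoc[OF K(1) k'(1) v(1)] k'(2) by simp
      finally have "k' \<cdot> v = u" using K(4)[OF u(1) arr_comp[OF k'(1) v(1)]] by simp
      then show "\<exists>v. arr C v W L \<and> k' \<cdot> v = u" using v by blast
    next
      fix W w assume w: "arr C w W L" "k' \<cdot> w = Zero C W N"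
      have W: "W \<in> Obj C" using w(1) by (simp add: arr_def)
      have "l \<cdot> w = l \<cdot> Zero C W L"
        using assoc[OF x k'(1) w(1)] xk w(2) comp_zero[OF x W] comp_zero[OF L(1) W] by simp
      then show "w = Zero C W L" using L(4)[OF w(1) arr_zero[OF W Lo]] by simp
    qed
    then show ?thesis using xk by blast
  qed
  then show ?thesis using ec x fx by blast
qed

lemma cover_lift:
  assumes "cover C f X Z" "arr C g Y Z"
  obtains N e x where "cover C e N Y" "arr C x N X" "f \<cdot> x = g \<cdot> e"
  using pullback[OF assms] by blast

text \<open>Exactness at \<open>Y\<close> on generalised elements: \<open>z\<close> lies in the
  kernel of the cokernel, which is the image of \<open>f\<close>, and elements of the image lift
  after a cover by \<open>coimage_cover\<close>.\<close>

lemma cokernel_exact: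
  assumes q: "is_cokernel C X Y f Q q" "arr C f X Y" and z: "arr C z W Y" "q \<cdot> z = Zero C W Q"
  obtains N e x where "cover C e N W" "arr C x N X" "f \<cdot> x = z \<cdot> e"
proof -
  note Q = cokernelD[OF q]
  obtain K m where m: "is_kernel C Y Q q K m" using ex_kernel[OF arrD[OF Q(1)]] by blast
  note M = kernelD[OF m Q(1)]
  obtain f' where f': "arr C f' X K" "m \<cdot> f' = f" using M(3)[OF q(2) Q(2)] by blast
  obtain z' where z': "arr C z' W K" "m \<cdot> z' = z" using M(3)[OF z] by blast
  obtain N e x where e: "cover C e N W" "arr C x N X" "f' \<cdot> x = z' \<cdot> e"
    using cover_lift[OF coimage_cover[OF q m f'] z'(1)] .
  have "f \<cdot> x = z \<cdot> e"
    using assoc[OF M(1) f'(1) e(2)] assoc[OF M(1) z'(1) cover_arr[OF e(1)]] f'(2) z'(2) e(3) by simp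
  then show thesis using that e by blast
qed

end

section \<open>Extensions and cotorsion pairs\<close>

text \<open>Vanishing of \<open>Ext1\<close> phrased as splitting of every extension, without
  equivalence classes; \<open>Ext1_trivial_iff\<close> connects it with the quotient.\<close>

definition ext_vanishes :: "('o, 'm, 'z) addcat_scheme \<Rightarrow> 'o \<Rightarrow> 'o \<Rightarrow> bool" where
  "ext_vanishes C D E \<longleftrightarrow>
     (\<forall>X i p. is_ses C E X D i p \<longrightarrow> (\<exists>s. arr C s D X \<and> p \<cdot>\<^bsub>C\<^esub> s = Ident C D))"

lemma ext_vanishesE:
  assumes "ext_vanishes C D E" "is_ses C E X D i p"
  obtains s where "arr C s D X" "p \<cdot>\<^bsub>C\<^esub> s = Ident C D"
  using assms unfolding ext_vanishes_def by blast

lemma sesD: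
  assumes "is_ses C X Y Z f g"
  shows "arr C f X Y" "arr C g Y Z" "is_kernel C Y Z g X f" "is_cokernel C X Y f Z g"
  using assms by (auto simp: is_ses_def is_kernel_def is_cokernel_def arr_def)

context abelian_category
begin

text \<open>The difference \<open>w\<close> of the identity and \<open>s \<cdot> p\<close> is killed
  by \<open>p\<close>, so it factors through \<open>i\<close>, and the factor is the
  retraction.\<close>

lemma split_data:
  assumes ses: "is_ses C E X D i p" and s: "arr C s D X" "p \<cdot> s = Ident C D"
  obtains r where "arr C r X E" "r \<cdot> i = Ident C E" "r \<cdot> s = Zero C D E"
    "(i \<cdot> r) \<boxplus> (s \<cdot> p) = Ident C X"
proof -
  note i = sesD(1)[OF ses] and p = sesD(2)[OF ses]
  note K = kernelD[OF sesD(3)[OF ses] p]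
  have obj: "E \<in> Obj C" "X \<in> Obj C" "D \<in> Obj C" using i p by (auto simp: arr_def)
  have sp: "arr C (s \<cdot> p) X X" using s p arr_comp by blast
  obtain w where w: "arr C w X X" "Ident C X = w \<boxplus> (s \<cdot> p)" using ex_diff[OF arr_id[OF obj(2)] sp] by blast
  have dist: "(w \<cdot> x) \<boxplus> (s \<cdot> (p \<cdot> x)) = x" if x: "arr C x W X" for x W
    using add_comp[OF w(1) sp x] w(2) id_left[OF x] assoc[OF s(1) p x] by simp
  have "p \<cdot> w \<boxplus> p = p"
  proof -
    have "p = p \<cdot> (w \<boxplus> (s \<cdot> p))" using w(2) id_right[OF p] by simp
    also have "\<dots> = (p \<cdot> w) \<boxplus> ((p \<cdot> s) \<cdot> p)" using comp_add[OF p w(1) sp] assoc[OF p s(1) p] by simp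
    finally show ?thesis using s(2) id_left[OF p] by simp
  qed
  then have pw: "p \<cdot> w = Zero C X D" using add_eq_self[OF arr_comp[OF p w(1)] p] by simp
  obtain r where r: "arr C r X E" "i \<cdot> r = w" using K(3)[OF w(1) pw] by blast
  have "w \<cdot> i = i"
    using dist[OF i] K(2) comp_zero[OF s(1) obj(1)] add_zero[OF arr_comp[OF w(1) i]] by simp
  then have "i \<cdot> (r \<cdot> i) = i \<cdot> Ident C E" using assoc[OF i r(1) i] r(2) id_right[OF i] by simp
  then have ri: "r \<cdot> i = Ident C E" using K(4)[OF arr_comp[OF r(1) i] arr_id[OF obj(1)]] by simp
  have "(w \<cdot> s) \<boxplus> s = s" using dist[OF s(1)] s(2) id_right[OF s(1)] by simp
  then have "w \<cdot> s = Zero C D X" using add_eq_self[OF arr_comp[OF w(1) s(1)] s(1)] by simp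
  then have "i \<cdot> (r \<cdot> s) = i \<cdot> Zero C D E" using assoc[OF i r(1) s(1)] r(2) comp_zero[OF i obj(3)] by simp
  then have "r \<cdot> s = Zero C D E" using K(4)[OF arr_comp[OF r(1) s(1)] arr_zero[OF obj(3,1)]] by simp
  then show thesis using that[of r] r ri w(2) by simp
qed

text \<open>Provides at least one extension. Without it the set \<open>Ext1\<close> could be empty
  instead of consisting of the zero class.\<close>

lemma biproduct_ses:
  assumes bp: "is_biproduct C X Y P i j p q" and "X \<in> Obj C" "Y \<in> Obj C"
  shows "is_ses C X P Y i q"
proof -
  have i: "arr C i X P" and j: "arr C j Y P" and p: "arr C p P X" and q: "arr C q P Y"
    using bp assms(2,3) by (auto simp: is_biproduct_def arr_def)
  have b: "p \<cdot> i = Ident C X" "q \<cdot> j = Ident C Y" "q \<cdot> i = Zero C X Y" "(i \<cdot> p) \<boxplus> (j \<cdot> q) = Ident C P"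
    using bp by (auto simp: is_biproduct_def)
  have "cover C q P Y" using cover_factor[OF _ q j] cover_id[OF assms(3)] b by simp
  moreover have "is_kernel C P Y q X i"
  proof (rule kernelI[OF q i b(3)])
    fix W u assume u: "arr C u W P" "q \<cdot> u = Zero C W Y"
    have W: "W \<in> Obj C" using u(1) by (simp add: arr_def)
    have "u = (i \<cdot> (p \<cdot> u)) \<boxplus> (j \<cdot> (q \<cdot> u))"
      using add_comp[OF arr_comp[OF i p] arr_comp[OF j q] u(1)] b(4) id_left[OF u(1)]
        assoc[OF i p u(1)] assoc[OF j q u(1)] by simp
    then have "i \<cdot> (p \<cdot> u) = u"
      using u(2) comp_zero[OF j W] add_zero[OF arr_comp[OF i arr_comp[OF p u(1)]]] by simp
    then show "\<exists>h. arr C h W X \<and> i \<cdot> h = u" using arr_comp[OF p u(1)] by blast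
  next
    fix W u assume u: "arr C u W X" "i \<cdot> u = Zero C W P"
    have W: "W \<in> Obj C" using u(1) by (simp add: arr_def)
    show "u = Zero C W X" using assoc[OF p i u(1)] b(1) id_left[OF u(1)] u(2) comp_zero[OF p W] by simp
  qed
  ultimately show ?thesis by (simp add: ses_iff)
qed

text \<open>With a retraction \<open>r\<close> of \<open>i\<close>, the map
  \<open>(i' \<cdot> r) \<boxplus> (s' \<cdot> p)\<close> matches the two direct sum
  decompositions.\<close>

lemma split_iso:
  assumes "is_ses C E X D i p" "arr C s D X" "p \<cdot> s = Ident C D"
    and "is_ses C E X' D i' p'" "arr C s' D X'" "p' \<cdot> s' = Ident C D"
  obtains t where "is_iso C X X' t" "t \<cdot> i = i'" "p' \<cdot> t = p"
proof -
  \<comment> \<open>Proved for arbitrary data, so that it can be applied a second time with the two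
    extensions exchanged; the two applications give the two inverse laws.\<close>
  have main: "arr C ((i' \<cdot> r) \<boxplus> (s' \<cdot> p)) X X'"
      "((i' \<cdot> r) \<boxplus> (s' \<cdot> p)) \<cdot> i = i'" "p' \<cdot> ((i' \<cdot> r) \<boxplus> (s' \<cdot> p)) = p"
      "((i \<cdot> r') \<boxplus> (s \<cdot> p')) \<cdot> ((i' \<cdot> r) \<boxplus> (s' \<cdot> p)) = Ident C X"
    if 1: "is_ses C E X D i p" "arr C s D X"
      and 2: "is_ses C E X' D i' p'" "arr C s' D X'" "p' \<cdot> s' = Ident C D"
      and r: "arr C r X E" "r \<cdot> i = Ident C E" "(i \<cdot> r) \<boxplus> (s \<cdot> p) = Ident C X"
      and r': "arr C r' X' E" "r' \<cdot> i' = Ident C E" "r' \<cdot> s' = Zero C D E"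
    for X i p s X' i' p' s' r r'
  proof -
    note i = sesD(1)[OF 1(1)] and p = sesD(2)[OF 1(1)]
    note i' = sesD(1)[OF 2(1)] and p' = sesD(2)[OF 2(1)]
    have obj: "E \<in> Obj C" "X \<in> Obj C" "D \<in> Obj C" "X' \<in> Obj C" using i p i' by (auto simp: arr_def)
    have pi: "p \<cdot> i = Zero C E D" "p' \<cdot> i' = Zero C E D"
      using kernelD(2)[OF sesD(3)[OF 1(1)] p] kernelD(2)[OF sesD(3)[OF 2(1)] p'] .
    let ?t = "(i' \<cdot> r) \<boxplus> (s' \<cdot> p)"
    have ir: "arr C (i' \<cdot> r) X X'" and sp: "arr C (s' \<cdot> p) X X'" using i' r(1) 2(2) p arr_comp by blast+
    have ir': "arr C (i \<cdot> r') X' X" and sp': "arr C (s \<cdot> p') X' X" using i r'(1) 1(2) p' arr_comp by blast+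
    show tX: "arr C ?t X X'" using ir sp by (rule arr_plus)
    show "?t \<cdot> i = i'" unfolding add_comp[OF ir sp i] assoc[OF i' r(1) i] assoc[OF 2(2) p i] r(2) pi
      using comp_zero[OF 2(2) obj(1)] id_right[OF i'] add_zero[OF i'] by simp
    show pt: "p' \<cdot> ?t = p" unfolding comp_add[OF p' ir sp]
      using assoc[OF p' i' r(1)] pi zero_comp[OF r(1) obj(3)] assoc[OF p' 2(2) p] 2(3) id_left[OF p] zero_add[OF p]
      by simp
    have "r' \<cdot> ?t = r" unfolding comp_add[OF r'(1) ir sp]
      using assoc[OF r'(1) i' r(1)] r'(2,3) zero_comp[OF p obj(1)] assoc[OF r'(1) 2(2) p] id_left[OF r(1)]
        add_zero[OF r(1)] by simp
    then show "((i \<cdot> r') \<boxplus> (s \<cdot> p')) \<cdot> ?t = Ident C X" unfolding add_comp[OF ir' sp' tX]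
      using assoc[OF i r'(1) tX] assoc[OF 1(2) p' tX] pt r(3) by simp
  qed
  obtain r where r: "arr C r X E" "r \<cdot> i = Ident C E" "r \<cdot> s = Zero C D E"
    "(i \<cdot> r) \<boxplus> (s \<cdot> p) = Ident C X" using split_data[OF assms(1-3)] .
  obtain r' where r': "arr C r' X' E" "r' \<cdot> i' = Ident C E" "r' \<cdot> s' = Zero C D E"
    "(i' \<cdot> r') \<boxplus> (s' \<cdot> p') = Ident C X'" using split_data[OF assms(4-6)] .
  note 1 = main[OF assms(1,2,4-6) r(1,2,4) r'(1-3)]
  note 2 = main[OF assms(4,5,1-3) r'(1,2,4) r(1-3)]
  have "is_iso C X X' ((i' \<cdot> r) \<boxplus> (s' \<cdot> p))"
    using 1(1,4) 2(1,4) by (auto simp: is_iso_def arr_def)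
  then show thesis using that 1(2,3) by blast
qed

text \<open>Any two split extensions are isomorphic as extensions, so once every extension splits
  there is a single class, the set of all split ones.\<close>

lemma ext_class_subset:
  assumes "\<And>x. x \<in> extensions C D E \<Longrightarrow> x \<in> Ext1_zero C D E" "x \<in> extensions C D E"
  shows "ext_equiv C D E `` {x} = Ext1_zero C D E"
proof
  show "ext_equiv C D E `` {x} \<subseteq> Ext1_zero C D E" using assms by (auto simp: ext_equiv_def)
  show "Ext1_zero C D E \<subseteq> ext_equiv C D E `` {x}"
  proof
    fix y assume y: "y \<in> Ext1_zero C D E"
    obtain X i p where x': "x = (X, i, p)" by (cases x)
    obtain X' i' p' where y': "y = (X', i', p')" by (cases y)
    note xy = x' y'
    have x: "x \<in> Ext1_zero C D E" using assms by blast
    obtain s where s: "is_ses C E X D i p" "s \<in> Hom C D X" "p \<cdot> s = Ident C D"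
      using x xy by (auto simp: Ext1_zero_def extensions_def)
    obtain s' where s': "is_ses C E X' D i' p'" "s' \<in> Hom C D X'" "p' \<cdot> s' = Ident C D"
      using y xy by (auto simp: Ext1_zero_def extensions_def)
    have "arr C s D X" "arr C s' D X'" using s s' by (auto simp: arr_def is_ses_def)
    then obtain t where "is_iso C X X' t" "t \<cdot> i = i'" "p' \<cdot> t = p"
      using split_iso[OF s(1) _ s(3) s'(1) _ s'(3)] by blast
    then show "y \<in> ext_equiv C D E `` {x}" using s(1) s'(1) xy by (auto simp: ext_equiv_def extensions_def)
  qed
qed

lemma Ext1_trivial_iff:
  assumes obj: "D \<in> Obj C" "E \<in> Obj C"
  shows "Ext1 C D E = {Ext1_zero C D E} \<longleftrightarrow> ext_vanishes C D E"
proof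
  assume triv: "Ext1 C D E = {Ext1_zero C D E}"
  show "ext_vanishes C D E" unfolding ext_vanishes_def
  proof (intro allI impI)
    fix X i p assume s: "is_ses C E X D i p"
    note i = sesD(1)[OF s] and p = sesD(2)[OF s]
    have X: "X \<in> Obj C" using i by (simp add: arr_def)
    have x: "(X, i, p) \<in> extensions C D E" using s by (simp add: extensions_def)
    then have "ext_equiv C D E `` {(X, i, p)} \<in> Ext1 C D E" unfolding Ext1_def by (rule quotientI)
    then have "ext_equiv C D E `` {(X, i, p)} = Ext1_zero C D E" using triv by simp
    \<comment> \<open>Reflexivity puts the extension into its own class, which is the zero class;
      membership in \<open>Ext1_zero\<close> then provides the section.\<close>
    moreover have "is_iso C X X (Ident C X)" using X by (auto simp: is_iso_def ident_hom ident_left)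
    then have "(X, i, p) \<in> ext_equiv C D E `` {(X, i, p)}"
      using x id_left[OF i] id_right[OF p] by (auto simp: ext_equiv_def)
    ultimately show "\<exists>s. arr C s D X \<and> p \<cdot> s = Ident C D" using X obj by (auto simp: Ext1_zero_def arr_def)
  qed
next
  assume v: "ext_vanishes C D E"
  have all: "x \<in> Ext1_zero C D E" if "x \<in> extensions C D E" for x
    using v that by (fastforce simp: ext_vanishes_def extensions_def Ext1_zero_def arr_def)
  obtain P i j p q where "is_biproduct C E D P i j p q" using ex_biproduct obj by blast
  then have "(P, i, q) \<in> extensions C D E" using biproduct_ses obj by (auto simp: extensions_def)
  moreover have "\<forall>x\<in>extensions C D E. ext_equiv C D E `` {x} = Ext1_zero C D E"
    using ext_class_subset[OF all] by simp
  ultimately show "Ext1 C D E = {Ext1_zero C D E}" unfolding Ext1_def quotient_def by auto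
qed

text \<open>Splitting is self-dual: \<open>split_data\<close> turns a section of the epimorphism
  into a retraction of the monomorphism, which is a section in \<open>op C\<close>.\<close>

lemma ext_vanishes_opI:
  assumes "ext_vanishes C D E"
  shows "ext_vanishes (op C) E D"
  unfolding ext_vanishes_def
proof (intro allI impI)
  fix X i p assume "is_ses (op C) D X E i p"
  then have s: "is_ses C E X D p i" by (simp add: op_iff)
  obtain s where s': "arr C s D X" "i \<cdot> s = Ident C D" using ext_vanishesE[OF assms s] .
  obtain r where "arr C r X E" "r \<cdot> p = Ident C E" using split_data[OF s s'] .
  then show "\<exists>s. arr (op C) s E X \<and> p \<cdot>\<^bsub>op C\<^esub> s = Ident (op C) E" by (auto simp: op_iff)
qed

text \<open>One implication is the other applied to \<open>op C\<close>. Since \<open>op\<close>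
  forgets extra record fields, \<open>op (op C)\<close> is in general not literally
  \<open>C\<close>; it is removed through the predicates in \<open>op_iff\<close>.\<close>

lemma ext_vanishes_op: "ext_vanishes (op C) E D \<longleftrightarrow> ext_vanishes C D E"
proof
  assume "ext_vanishes (op C) E D"
  then have "ext_vanishes (op (op C)) D E" by (rule abelian_category.ext_vanishes_opI[OF abelian_op])
  then show "ext_vanishes C D E" by (simp add: ext_vanishes_def op_iff)
qed (rule ext_vanishes_opI)

text \<open>Pull the sequence back along \<open>t\<close>. The pullback is an extension of
  \<open>D\<close> by the same kernel \<open>K\<close>, and its section followed by \<open>x\<close>
  is the lift.\<close>

lemma ext_lift:
  assumes s: "is_ses C K X Z k f" and v: "ext_vanishes C D K" and t: "arr C t D Z"
  obtains l where "arr C l D X" "f \<cdot> l = t"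
proof -
  have f: "cover C f X Z" "is_kernel C X Z f K k" using s by (simp_all add: ses_iff)
  obtain N e x k' where e: "cover C e N D" "is_kernel C N D e K k'" and x: "arr C x N X" "f \<cdot> x = t \<cdot> e"
    using pullback[OF f(1) t] f(2) by blast
  then have "is_ses C K N D k' e" by (simp add: ses_iff)
  then obtain s where s: "arr C s D N" "e \<cdot> s = Ident C D" using ext_vanishesE[OF v] by blast
  have "f \<cdot> (x \<cdot> s) = t"
    using assoc[OF cover_arr[OF f(1)] x(1) s(1)] x(2) assoc[OF t cover_arr[OF e(1)] s(1)] s(2) id_right[OF t] by simp
  then show thesis using that arr_comp[OF x(1) s(1)] by blast
qed

lemma ext_extend:
  assumes s: "is_ses C K X D k f" and v: "ext_vanishes C D E" and t: "arr C t K E"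
  obtains l where "arr C l X E" "l \<cdot> k = t"
  using abelian_category.ext_lift[OF abelian_op, of D X K f k E t] assms
  by (auto simp: op_iff ext_vanishes_op)

lemma cotorsion_pair_iff:
  "cotorsion_pair C \<D> \<E> \<longleftrightarrow> \<D> \<subseteq> Obj C \<and> \<E> \<subseteq> Obj C \<and>
     (\<forall>D\<in>Obj C. D \<in> \<D> \<longleftrightarrow> (\<forall>E\<in>\<E>. ext_vanishes C D E)) \<and>
     (\<forall>E\<in>Obj C. E \<in> \<E> \<longleftrightarrow> (\<forall>D\<in>\<D>. ext_vanishes C D E))"
proof (cases "\<D> \<subseteq> Obj C \<and> \<E> \<subseteq> Obj C")
  case True
  then have "\<forall>D\<in>Obj C. \<forall>E\<in>\<E>. Ext1 C D E = {Ext1_zero C D E} \<longleftrightarrow> ext_vanishes C D E"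
    "\<forall>E\<in>Obj C. \<forall>D\<in>\<D>. Ext1 C D E = {Ext1_zero C D E} \<longleftrightarrow> ext_vanishes C D E"
    using Ext1_trivial_iff by blast+
  then show ?thesis unfolding cotorsion_pair_def by (meson True)
qed (auto simp: cotorsion_pair_def)

lemma cotorsion_pair_op: "cotorsion_pair (op C) \<E> \<D> \<longleftrightarrow> cotorsion_pair C \<D> \<E>"
  unfolding cotorsion_pair_iff abelian_category.cotorsion_pair_iff[OF abelian_op]
  by (auto simp: ext_vanishes_op)

text \<open>An extension of \<open>D'\<close> becomes one of \<open>D\<close> by composing its
  epimorphism with the isomorphism \<open>u\<close>; a section \<open>s\<close> obtained there gives
  the section \<open>s \<cdot> u\<close>.\<close>

lemma left_class_iso_closed:
  assumes cp: "cotorsion_pair C \<D> \<E>" and D: "D \<in> \<D>"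
    and u: "arr C u D' D" and v: "arr C v D D'" and uv: "u \<cdot> v = Ident C D" "v \<cdot> u = Ident C D'"
  shows "D' \<in> \<D>"
proof -
  have uc: "cover C u D' D" using cover_factor[OF _ u v] cover_id uv(1) arrD(2)[OF u] by simp
  have um: "g = Zero C W D'" if g: "arr C g W D'" "u \<cdot> g = Zero C W D" for g W
    using assoc[OF v u g(1)] uv(2) g(2) id_left[OF g(1)] comp_zero[OF v arrD(1)[OF g(1)]] by simp
  have "ext_vanishes C D' E" if E: "E \<in> \<E>" for E
    unfolding ext_vanishes_def
  proof (intro allI impI)
    fix X i p assume s: "is_ses C E X D' i p"
    then have p: "cover C p X D'" "is_kernel C X D' p E i" by (simp_all add: ses_iff)
    note pa = cover_arr[OF p(1)]
    have "is_ses C E X D i (u \<cdot> p)"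
      using cover_comp[OF uc p(1)] kernel_comp_mono[OF p(2) pa u um] by (simp add: ses_iff)
    moreover have "ext_vanishes C D E" using cp D E by (auto simp: cotorsion_pair_iff)
    ultimately obtain s where s: "arr C s D X" "(u \<cdot> p) \<cdot> s = Ident C D"
      by (metis ext_vanishesE)
    have ups: "u \<cdot> (p \<cdot> s) = Ident C D" using s(2) assoc[OF u pa s(1)] by simp
    have "p \<cdot> s = (v \<cdot> u) \<cdot> (p \<cdot> s)" using uv(2) id_left[OF arr_comp[OF pa s(1)]] by simp
    also have "\<dots> = v" using assoc[OF v u arr_comp[OF pa s(1)]] ups id_right[OF v] by simp
    finally have ps: "p \<cdot> s = v" .
    have "p \<cdot> (s \<cdot> u) = Ident C D'" using assoc[OF pa s(1) u] ps uv(2) by simp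
    then show "\<exists>s. arr C s D' X \<and> p \<cdot> s = Ident C D'" using arr_comp[OF s(1) u] by blast
  qed
  then show ?thesis using cp arrD(1)[OF u] by (auto simp: cotorsion_pair_iff)
qed

lemma right_class_iso_closed:
  assumes cp: "cotorsion_pair C \<D> \<E>" and D: "D \<in> \<E>"
    and u: "arr C u D' D" and v: "arr C v D D'" and uv: "u \<cdot> v = Ident C D" "v \<cdot> u = Ident C D'"
  shows "D' \<in> \<E>"
  using abelian_category.left_class_iso_closed[OF abelian_op, of \<E> \<D> D v D' u] assms
  by (simp add: cotorsion_pair_op op_iff)

lemma kernel_unique:
  assumes "is_kernel C X Y f K k" "is_kernel C X Y f K' k'" "arr C f X Y"
  obtains u v where "arr C u K' K" "arr C v K K'" "u \<cdot> v = Ident C K" "v \<cdot> u = Ident C K'" "k \<cdot> u = k'"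
proof -
  note K = kernelD[OF assms(1,3)] and K' = kernelD[OF assms(2,3)]
  obtain u where u: "arr C u K' K" "k \<cdot> u = k'" using K(3)[OF K'(1,2)] by blast
  obtain v where v: "arr C v K K'" "k' \<cdot> v = k" using K'(3)[OF K(1,2)] by blast
  have "k \<cdot> (u \<cdot> v) = k \<cdot> Ident C K" using assoc[OF K(1) u(1) v(1)] u v id_right[OF K(1)] by simp
  then have "u \<cdot> v = Ident C K" using K(4)[OF arr_comp[OF u(1) v(1)]] arr_id arrD(2)[OF u(1)] by blast
  moreover have "k' \<cdot> (v \<cdot> u) = k' \<cdot> Ident C K'" using assoc[OF K'(1) v(1) u(1)] u v id_right[OF K'(1)] by simp
  then have "v \<cdot> u = Ident C K'" using K'(4)[OF arr_comp[OF v(1) u(1)]] arr_id arrD(2)[OF v(1)] by blast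
  ultimately show thesis using that u v by blast
qed

end

section \<open>Adjunctions between abelian categories\<close>

lemma functor_obj: "is_functor C D F \<Longrightarrow> X \<in> Obj C \<Longrightarrow> omap F X \<in> Obj D"
  by (simp add: is_functor_def)

lemma functor_arr: "is_functor C D F \<Longrightarrow> arr C f X Y \<Longrightarrow> arr D (mmap F f) (omap F X) (omap F Y)"
  by (simp add: is_functor_def arr_def)

lemma functor_id: "is_functor C D F \<Longrightarrow> X \<in> Obj C \<Longrightarrow> mmap F (Ident C X) = Ident D (omap F X)"
  by (simp add: is_functor_def)

lemma functor_comp:
  assumes "is_functor C D F" "arr C g Y Z" "arr C f X Y"
  shows "mmap F (g \<cdot>\<^bsub>C\<^esub> f) = mmap F g \<cdot>\<^bsub>D\<^esub> mmap F f"
  using assms unfolding is_functor_def arr_def by blast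

lemma functor_comp_eq:
  assumes "is_functor C D F" "arr C g Y Z" "arr C f X Y" "g \<cdot>\<^bsub>C\<^esub> f = h"
  shows "mmap F g \<cdot>\<^bsub>D\<^esub> mmap F f = mmap F h"
  using functor_comp[OF assms(1-3)] assms(4) by simp

lemma is_functor_op: "is_functor (op C) (op D) F \<longleftrightarrow> is_functor C D F"
  unfolding is_functor_def op_simps by blast

locale abelian_adjunction = A: abelian_category A + B: abelian_category B
  for A :: "('o, 'm, 'z) addcat_scheme" and B :: "('p, 'n, 'y) addcat_scheme" +
  fixes F :: "('o, 'm, 'p, 'n) func" and G :: "('p, 'n, 'o, 'm) func"
    and \<phi> :: "'o \<Rightarrow> 'p \<Rightarrow> 'n \<Rightarrow> 'm"
  assumes adj: "is_adjunction A B F G \<phi>"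
begin

lemma F: "is_functor A B F" and G: "is_functor B A G"
  using adj by (simp_all add: is_adjunction_def)

lemma phi_bij: "X \<in> Obj A \<Longrightarrow> Y \<in> Obj B \<Longrightarrow> bij_betw (\<phi> X Y) (Hom B (omap F X) Y) (Hom A X (omap G Y))"
  using adj by (simp add: is_adjunction_def)

lemma phi_arr:
  assumes "X \<in> Obj A" "arr B f (omap F X) Y"
  shows "arr A (\<phi> X Y f) X (omap G Y)"
  using bij_betwE[OF phi_bij[OF assms(1) arrD(2)[OF assms(2)]]] assms functor_obj[OF G] by (simp add: arr_def)

lemma phi_inj:
  assumes "X \<in> Obj A" "arr B f (omap F X) Y" "arr B g (omap F X) Y" "\<phi> X Y f = \<phi> X Y g"
  shows "f = g"
  using bij_betw_imp_inj_on[OF phi_bij[OF assms(1) arrD(2)[OF assms(2)]]] assms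
  by (simp add: arr_def inj_on_def)

lemma phi_surj:
  assumes "Y \<in> Obj B" "arr A g X (omap G Y)"
  obtains f where "arr B f (omap F X) Y" "\<phi> X Y f = g"
proof -
  have X: "X \<in> Obj A" "g \<in> Hom A X (omap G Y)" using assms(2) by (simp_all add: arr_def)
  have "g \<in> \<phi> X Y ` Hom B (omap F X) Y"
    using bij_betw_imp_surj_on[OF phi_bij[OF X(1) assms(1)]] X(2) by simp
  then show thesis using that assms(1) functor_obj[OF F X(1)] by (auto simp: arr_def)
qed

lemma phi_natural:
  assumes "arr A u X' X" "arr B f (omap F X) Y" "arr B v Y Y'"
  shows "\<phi> X' Y' (v \<cdot>\<^bsub>B\<^esub> f \<cdot>\<^bsub>B\<^esub> mmap F u) = mmap G v \<cdot>\<^bsub>A\<^esub> \<phi> X Y f \<cdot>\<^bsub>A\<^esub> u"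
  using adj assms unfolding is_adjunction_def arr_def by blast

lemma phi_comp_right:
  assumes u: "arr A u X' X" and f: "arr B f (omap F X) Y"
  shows "\<phi> X' Y (f \<cdot>\<^bsub>B\<^esub> mmap F u) = \<phi> X Y f \<cdot>\<^bsub>A\<^esub> u"
proof -
  note Y = arrD(2)[OF f]
  have fu: "arr B (f \<cdot>\<^bsub>B\<^esub> mmap F u) (omap F X') Y" using f functor_arr[OF F u] B.arr_comp by blast
  have "arr A (\<phi> X Y f \<cdot>\<^bsub>A\<^esub> u) X' (omap G Y)" using phi_arr[OF arrD(2)[OF u] f] u A.arr_comp by blast
  then show ?thesis
    using phi_natural[OF u f B.arr_id[OF Y]] functor_id[OF G Y] B.id_left[OF fu] A.id_left by simp
qed

lemma phi_comp_left:
  assumes X: "X \<in> Obj A" and f: "arr B f (omap F X) Y" and v: "arr B v Y Y'"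
  shows "\<phi> X Y' (v \<cdot>\<^bsub>B\<^esub> f) = mmap G v \<cdot>\<^bsub>A\<^esub> \<phi> X Y f"
  using phi_natural[OF A.arr_id[OF X] f v] functor_id[OF F X] B.id_right[OF f] A.id_right[OF phi_arr[OF X f]] by simp

text \<open>Additivity of \<open>F\<close> is not part of the data. Arrows out of a zero object
  \<open>Z\<close> are unique, so transposition shows that the identity of \<open>F Z\<close> is
  zero, and zero maps factor through \<open>Z\<close>.\<close>

lemma F_zero:
  assumes "X \<in> Obj A" "Y \<in> Obj A"
  shows "mmap F (Zero A X Y) = Zero B (omap F X) (omap F Y)"
proof -
  obtain Z where Z: "Z \<in> Obj A" "\<And>W f g. W \<in> Obj A \<Longrightarrow> f \<in> Hom A Z W \<Longrightarrow> g \<in> Hom A Z W \<Longrightarrow> f = g"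
    using A.ex_zero_obj unfolding is_zero_obj_def by blast
  note FX = functor_obj[OF F assms(1)] and FY = functor_obj[OF F assms(2)] and FZ = functor_obj[OF F Z(1)]
  have "\<phi> Z (omap F Z) (Ident B (omap F Z)) = \<phi> Z (omap F Z) (Zero B (omap F Z) (omap F Z))"
    using Z(2)[OF functor_obj[OF G FZ] arrD(3)[OF phi_arr[OF Z(1) B.arr_id[OF FZ]]]
      arrD(3)[OF phi_arr[OF Z(1) B.arr_zero[OF FZ FZ]]]] .
  then have id0: "Ident B (omap F Z) = Zero B (omap F Z) (omap F Z)"
    using phi_inj[OF Z(1) B.arr_id[OF FZ] B.arr_zero[OF FZ FZ]] by simp
  note z1 = A.arr_zero[OF assms(1) Z(1)] and z2 = A.arr_zero[OF Z(1) assms(2)]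
  note f1 = functor_arr[OF F z1] and f2 = functor_arr[OF F z2]
  have "mmap F (Zero A X Y) = mmap F (Zero A Z Y) \<cdot>\<^bsub>B\<^esub> mmap F (Zero A X Z)"
    using functor_comp[OF F z2 z1] A.zero_comp[OF z1 assms(2)] by simp
  also have "mmap F (Zero A X Z) = Zero B (omap F X) (omap F Z)"
    using B.id_left[OF f1] id0 B.zero_comp[OF f1 FZ] by simp
  finally show ?thesis using B.comp_zero[OF f2 FX] by simp
qed

text \<open>A zero map out of \<open>F X\<close> is unchanged by composing it with the image of a
  zero map, and naturality moves that factor to the side of \<open>A\<close>.\<close>

lemma phi_zero:
  assumes "X \<in> Obj A" "Y \<in> Obj B"
  shows "\<phi> X Y (Zero B (omap F X) Y) = Zero A X (omap G Y)"
proof -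
  note FX = functor_obj[OF F assms(1)] and GY = functor_obj[OF G assms(2)]
  note z = B.arr_zero[OF FX assms(2)] and zz = B.arr_zero[OF FX FX]
  have "Zero B (omap F X) Y = Zero B (omap F X) Y \<cdot>\<^bsub>B\<^esub> mmap F (Zero A X X)"
    using F_zero[OF assms(1,1)] B.zero_comp[OF zz assms(2)] by simp
  then show ?thesis
    using phi_comp_right[OF A.arr_zero[OF assms(1,1)] z] A.comp_zero[OF phi_arr[OF assms(1) z] assms(1)] by simp
qed

text \<open>The counit \<open>e\<close> transposes to an identity, so the image of a zero map under
  \<open>G\<close> is the transpose of its composite with \<open>e\<close>, which is zero.\<close>

lemma G_zero:
  assumes "X \<in> Obj B" "Y \<in> Obj B"
  shows "mmap G (Zero B X Y) = Zero A (omap G X) (omap G Y)"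
proof -
  note GX = functor_obj[OF G assms(1)] and z = B.arr_zero[OF assms]
  obtain e where e: "arr B e (omap F (omap G X)) X" "\<phi> (omap G X) X e = Ident A (omap G X)"
    using phi_surj[OF assms(1) A.arr_id[OF GX]] .
  show ?thesis
    using phi_comp_left[OF GX e(1) z] e(2) B.zero_comp[OF e(1) assms(2)] phi_zero[OF GX assms(2)]
      A.id_right[OF functor_arr[OF G z]] by simp
qed

text \<open>Between the opposite categories \<open>G\<close> is the left adjoint, with the inverse
  transposition. A result on one adjoint thereby yields the dual result on the other.\<close>

lemma abelian_adjunction_op:
  "abelian_adjunction (op B) (op A) G F (\<lambda>Y X. inv_into (Hom B (omap F X) Y) (\<phi> X Y))"
proof (intro abelian_adjunction.intro abelian_adjunction_axioms.intro A.abelian_op B.abelian_op)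
  let ?\<psi> = "\<lambda>X Y. inv_into (Hom B (omap F X) Y) (\<phi> X Y)"
  have psi: "?\<psi> X Y (\<phi> X Y f) = f" if "X \<in> Obj A" "arr B f (omap F X) Y" for X Y f
    using that phi_bij[of X Y] bij_betw_inv_into_left by (fastforce simp: arr_def)
  have bij: "bij_betw (?\<psi> X Y) (Hom (op A) (omap G Y) X) (Hom (op B) Y (omap F X))"
    if "X \<in> Obj A" "Y \<in> Obj B" for X Y
    using bij_betw_inv_into[OF phi_bij[OF that]] by simp
  have nat: "?\<psi> X' Y' (mmap G v \<cdot>\<^bsub>A\<^esub> f \<cdot>\<^bsub>A\<^esub> u) = v \<cdot>\<^bsub>B\<^esub> ?\<psi> X Y f \<cdot>\<^bsub>B\<^esub> mmap F u"
    if u: "arr A u X' X" and f: "arr A f X (omap G Y)" and v: "arr B v Y Y'" for X X' Y Y' u f v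
  proof -
    obtain g where g: "arr B g (omap F X) Y" "\<phi> X Y g = f" using phi_surj[OF arrD(1)[OF v] f] .
    have "arr B (v \<cdot>\<^bsub>B\<^esub> g \<cdot>\<^bsub>B\<^esub> mmap F u) (omap F X') Y'"
      using v g(1) functor_arr[OF F u] B.arr_comp by blast
    then show ?thesis
      using phi_natural[OF u g(1) v] g psi[OF arrD(2)[OF u] g(1)] psi[OF arrD(1)[OF u]] by metis
  qed
  show "is_adjunction (op B) (op A) G F (\<lambda>Y X. ?\<psi> X Y)"
    unfolding is_adjunction_def
  proof (intro conjI ballI)
    show "is_functor (op B) (op A) G" "is_functor (op A) (op B) F" using F G by (simp_all add: is_functor_op)
    show "bij_betw (?\<psi> X Y) (Hom (op A) (omap G Y) X) (Hom (op B) Y (omap F X))"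
      if "Y \<in> Obj (op B)" "X \<in> Obj (op A)" for X Y using that bij by simp
    fix Y Y' X X' u f v
    assume a: "Y \<in> Obj (op B)" "Y' \<in> Obj (op B)" "X \<in> Obj (op A)" "X' \<in> Obj (op A)"
      "u \<in> Hom (op B) Y' Y" "f \<in> Hom (op A) (omap G Y) X" "v \<in> Hom (op A) X X'"
    then have arrs: "arr A v X' X" "arr A f X (omap G Y)" "arr B u Y Y'"
      using functor_obj[OF G] by (auto simp: arr_def)
    have "arr B (?\<psi> X Y f) (omap F X) Y"
    proof -
      obtain g where "arr B g (omap F X) Y" "\<phi> X Y g = f" using phi_surj[OF arrD(1)[OF arrs(3)] arrs(2)] .
      then show ?thesis using psi[OF arrD(2)[OF arrs(1)]] by metis
    qed
    then show "?\<psi> X' Y' (v \<cdot>\<^bsub>op A\<^esub> f \<cdot>\<^bsub>op A\<^esub> mmap G u) = mmap F v \<cdot>\<^bsub>op B\<^esub> ?\<psi> X Y f \<cdot>\<^bsub>op B\<^esub> u"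
      using nat[OF arrs] A.assoc[OF functor_arr[OF G arrs(3)] arrs(2,1)]
        B.assoc[OF arrs(3) _ functor_arr[OF F arrs(1)]] by simp
  qed
qed

text \<open>Test arrows from \<open>W\<close> into \<open>G X\<close> are transposed to arrows from
  \<open>F W\<close> into \<open>X\<close>, where the universal property of \<open>k\<close>
  applies; zero conditions transpose by \<open>phi_zero\<close>.\<close>

lemma G_kernel:
  assumes k: "is_kernel B X Y f K k" and f: "arr B f X Y"
  shows "is_kernel A (omap G X) (omap G Y) (mmap G f) (omap G K) (mmap G k)"
proof -
  note K = B.kernelD[OF k f]
  note Gf = functor_arr[OF G f] and Gk = functor_arr[OF G K(1)]
  have obj: "X \<in> Obj B" "Y \<in> Obj B" "K \<in> Obj B" using f K(1) by (auto simp: arr_def)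
  show ?thesis
  proof (rule A.kernelI[OF Gf Gk])
    show "mmap G f \<cdot>\<^bsub>A\<^esub> mmap G k = Zero A (omap G K) (omap G Y)"
      using functor_comp_eq[OF G f K(1,2)] G_zero obj by simp
  next
    fix W u assume u: "arr A u W (omap G X)" "mmap G f \<cdot>\<^bsub>A\<^esub> u = Zero A W (omap G Y)"
    have W: "W \<in> Obj A" using u(1) by (simp add: arr_def)
    obtain v where v: "arr B v (omap F W) X" "\<phi> W X v = u" using phi_surj[OF obj(1) u(1)] .
    note FW = functor_obj[OF F W]
    have "\<phi> W Y (f \<cdot>\<^bsub>B\<^esub> v) = \<phi> W Y (Zero B (omap F W) Y)"
      using phi_comp_left[OF W v(1) f] v(2) u(2) phi_zero[OF W obj(2)] by simp
    then have "f \<cdot>\<^bsub>B\<^esub> v = Zero B (omap F W) Y"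
      using phi_inj[OF W B.arr_comp[OF f v(1)] B.arr_zero[OF FW obj(2)]] by simp
    then obtain h where h: "arr B h (omap F W) K" "k \<cdot>\<^bsub>B\<^esub> h = v" using K(3)[OF v(1)] by blast
    have "mmap G k \<cdot>\<^bsub>A\<^esub> \<phi> W K h = u" using phi_comp_left[OF W h(1) K(1)] h(2) v(2) by simp
    then show "\<exists>h. arr A h W (omap G K) \<and> mmap G k \<cdot>\<^bsub>A\<^esub> h = u" using phi_arr[OF W h(1)] by blast
  next
    fix W u assume u: "arr A u W (omap G K)" "mmap G k \<cdot>\<^bsub>A\<^esub> u = Zero A W (omap G X)"
    have W: "W \<in> Obj A" using u(1) by (simp add: arr_def)
    note FW = functor_obj[OF F W]
    obtain v where v: "arr B v (omap F W) K" "\<phi> W K v = u" using phi_surj[OF obj(3) u(1)] .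
    have "\<phi> W X (k \<cdot>\<^bsub>B\<^esub> v) = \<phi> W X (Zero B (omap F W) X)"
      using phi_comp_left[OF W v(1) K(1)] v(2) u(2) phi_zero[OF W obj(1)] by simp
    then have "k \<cdot>\<^bsub>B\<^esub> v = Zero B (omap F W) X"
      using phi_inj[OF W B.arr_comp[OF K(1) v(1)] B.arr_zero[OF FW obj(1)]] by simp
    then have "v = Zero B (omap F W) K"
      using K(4)[OF v(1) B.arr_zero[OF FW obj(3)]] B.comp_zero[OF K(1) FW] by simp
    then show "u = Zero A W (omap G K)" using v(2) phi_zero[OF W obj(3)] by simp
  qed
qed

text \<open>The hypothesis \<open>enough\<close> isolates what is taken from completeness, in a form
  that makes sense in the opposite categories, so that the converse can be deduced from this
  lemma.\<close>

lemma left_split_of_right_split: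
  assumes cpA: "cotorsion_pair A \<D> \<E>" and cpB: "cotorsion_pair B \<D>' \<E>'"
    and enough: "\<And>X. X \<in> Obj A \<Longrightarrow> \<exists>P\<in>\<D>. \<exists>g. cover A g P X"
    and split: "right_split A B F \<D>" and FD: "omap F ` \<D> \<subseteq> \<D>'"
  shows "left_split B A G \<E>' \<and> omap G ` \<E>' \<subseteq> \<E>"
proof
  have van: "ext_vanishes B (omap F D) E" if "D \<in> \<D>" "E \<in> \<E>'" for D E
    using that FD cpB unfolding B.cotorsion_pair_iff by blast
  show "left_split B A G \<E>'" unfolding left_split_def
  proof (intro allI impI)
    fix X Y Z f g assume a: "X \<in> \<E>' \<and> is_ses B X Y Z f g"
    then have s: "is_ses B X Y Z f g" and X: "X \<in> \<E>'" by auto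
    note g = sesD(2)[OF s] and Gg = functor_arr[OF G sesD(2)[OF s]]
    obtain P e where e: "P \<in> \<D>" "cover A e P (omap G Z)" using enough arrD(2)[OF Gg] by blast
    have P: "P \<in> Obj A" and ea: "arr A e P (omap G Z)" using cover_arr[OF e(2)] by (simp_all add: arr_def)
    obtain t where t: "arr B t (omap F P) Z" "\<phi> P Z t = e" using phi_surj[OF arrD(2)[OF g] ea] .
    obtain l where l: "arr B l (omap F P) Y" "g \<cdot>\<^bsub>B\<^esub> l = t" using B.ext_lift[OF s van[OF e(1) X] t(1)] .
    have "mmap G g \<cdot>\<^bsub>A\<^esub> \<phi> P Y l = e" using phi_comp_left[OF P l(1) g] l(2) t(2) by simp
    then have "cover A (mmap G g) (omap G Y) (omap G Z)"
      using A.cover_factor[of "mmap G g" "\<phi> P Y l"] e(2) Gg phi_arr[OF P l(1)] by simp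
    then show "is_ses A (omap G X) (omap G Y) (omap G Z) (mmap G f) (mmap G g)"
      using G_kernel[OF sesD(3)[OF s] g] by (simp add: A.ses_iff)
  qed
  show "omap G ` \<E>' \<subseteq> \<E>"
  proof
    fix GE assume "GE \<in> omap G ` \<E>'"
    then obtain E where E: "E \<in> \<E>'" "GE = omap G E" by blast
    have Eo: "E \<in> Obj B" using E(1) cpB by (auto simp: cotorsion_pair_def)
    note GEo = functor_obj[OF G Eo]
    have "ext_vanishes A D (omap G E)" if D: "D \<in> \<D>" for D
      unfolding ext_vanishes_def
    proof (intro allI impI)
      fix X i p assume s: "is_ses A (omap G E) X D i p"
      note i = sesD(1)[OF s]
      have X: "X \<in> Obj A" using i by (simp add: arr_def)
      have Fs: "is_ses B (omap F (omap G E)) (omap F X) (omap F D) (mmap F i) (mmap F p)"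
        using split s D unfolding right_split_def by blast
      obtain \<epsilon> where \<epsilon>: "arr B \<epsilon> (omap F (omap G E)) E" "\<phi> (omap G E) E \<epsilon> = Ident A (omap G E)"
        using phi_surj[OF Eo A.arr_id[OF GEo]] .
      obtain l where l: "arr B l (omap F X) E" "l \<cdot>\<^bsub>B\<^esub> mmap F i = \<epsilon>"
        using B.ext_extend[OF Fs van[OF D E(1)] \<epsilon>(1)] .
      have r: "arr A (\<phi> X E l) X (omap G E)" "\<phi> X E l \<cdot>\<^bsub>A\<^esub> i = Ident A (omap G E)"
        using phi_arr[OF X l(1)] phi_comp_right[OF i l(1)] l(2) \<epsilon>(2) by simp_all
      \<comment> \<open>\<open>\<phi> X E l\<close> is a retraction of \<open>i\<close>. Read in
        \<open>op A\<close> it is a section, and \<open>split_data\<close> there returns a section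
        of \<open>p\<close>.\<close>
      have "is_ses (op A) D X (omap G E) p i" "arr (op A) (\<phi> X E l) (omap G E) X"
        "i \<cdot>\<^bsub>op A\<^esub> \<phi> X E l = Ident (op A) (omap G E)"
        using s r by (simp_all add: op_iff)
      then obtain s' where "arr (op A) s' X D" "s' \<cdot>\<^bsub>op A\<^esub> p = Ident (op A) D"
        by (rule abelian_category.split_data[OF A.abelian_op])
      then show "\<exists>s. arr A s D X \<and> p \<cdot>\<^bsub>A\<^esub> s = Ident A D" by (auto simp: op_iff)
    qed
    then show "GE \<in> \<E>" using cpA E(2) GEo unfolding A.cotorsion_pair_iff by blast
  qed
qed

text \<open>A cover in \<open>op B\<close> from \<open>E\<close> to \<open>Y\<close> is a
  monomorphism from \<open>Y\<close> into \<open>E\<close> in \<open>B\<close>, so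
  \<open>enough\<close> here is the hypothesis of the preceding lemma for the opposite
  adjunction.\<close>

lemma right_split_of_left_split:
  assumes cpA: "cotorsion_pair A \<D> \<E>" and cpB: "cotorsion_pair B \<D>' \<E>'"
    and enough: "\<And>Y. Y \<in> Obj B \<Longrightarrow> \<exists>E\<in>\<E>'. \<exists>g. cover (op B) g E Y"
    and split: "left_split B A G \<E>'" and GE: "omap G ` \<E>' \<subseteq> \<E>"
  shows "right_split A B F \<D> \<and> omap F ` \<D> \<subseteq> \<D>'"
proof -
  interpret O: abelian_adjunction "op B" "op A" G F "\<lambda>Y X. inv_into (Hom B (omap F X) Y) (\<phi> X Y)"
    by (rule abelian_adjunction_op)
  have "right_split (op B) (op A) G \<E>'" using split by (auto simp: left_split_def right_split_def op_iff)
  moreover have "cotorsion_pair (op B) \<E>' \<D>'" "cotorsion_pair (op A) \<E> \<D>"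
    using cpA cpB by (simp_all add: A.cotorsion_pair_op B.cotorsion_pair_op)
  moreover have "\<And>Y. Y \<in> Obj (op B) \<Longrightarrow> \<exists>E\<in>\<E>'. \<exists>g. cover (op B) g E Y" using enough by simp
  ultimately have "left_split (op A) (op B) F \<D> \<and> omap F ` \<D> \<subseteq> \<D>'"
    using O.left_split_of_right_split[of \<E>' \<D>' \<E> \<D>] GE by blast
  then show ?thesis by (auto simp: left_split_def right_split_def op_iff)
qed

end

section \<open>Cochain complexes\<close>

lemma Ch_simps:
  "Ident (Ch C) X = (\<lambda>n. Ident C (cob X n))"
  "g \<cdot>\<^bsub>Ch C\<^esub> f = (\<lambda>n. g n \<cdot>\<^bsub>C\<^esub> f n)"
  "f \<boxplus>\<^bsub>Ch C\<^esub> h = (\<lambda>n. f n \<boxplus>\<^bsub>C\<^esub> h n)"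
  "Zero (Ch C) X Y = (\<lambda>n. Zero C (cob X n) (cob Y n))"
  by (simp_all add: Ch_def)

lemma Ch_obj_iff:
  "X \<in> Obj (Ch C) \<longleftrightarrow> (\<forall>n. arr C (cdiff X n) (cob X n) (cob X (n + 1)) \<and>
     cdiff X (n + 1) \<cdot>\<^bsub>C\<^esub> cdiff X n = Zero C (cob X n) (cob X (n + 1 + 1)))"
  by (auto simp: Ch_def arr_def)

lemma Ch_arr_iff:
  "arr (Ch C) f X Y \<longleftrightarrow> X \<in> Obj (Ch C) \<and> Y \<in> Obj (Ch C) \<and>
     (\<forall>n. arr C (f n) (cob X n) (cob Y n) \<and> f (n + 1) \<cdot>\<^bsub>C\<^esub> cdiff X n = cdiff Y n \<cdot>\<^bsub>C\<^esub> f n)"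
  by (auto simp: Ch_def arr_def)

lemma Ch_objD:
  assumes "X \<in> Obj (Ch C)"
  shows "cob X n \<in> Obj C" "arr C (cdiff X n) (cob X n) (cob X (n + 1))"
    "cdiff X (n + 1) \<cdot>\<^bsub>C\<^esub> cdiff X n = Zero C (cob X n) (cob X (n + 1 + 1))"
  using assms by (auto simp: Ch_def arr_def)

lemma Ch_arrD:
  assumes "arr (Ch C) f X Y"
  shows "X \<in> Obj (Ch C)" "Y \<in> Obj (Ch C)" "arr C (f n) (cob X n) (cob Y n)"
    "f (n + 1) \<cdot>\<^bsub>C\<^esub> cdiff X n = cdiff Y n \<cdot>\<^bsub>C\<^esub> f n"
  using assms by (auto simp: Ch_arr_iff)

lemma Ch_arrI:
  assumes "X \<in> Obj (Ch C)" "Y \<in> Obj (Ch C)" "\<And>n. arr C (f n) (cob X n) (cob Y n)"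
    "\<And>n. f (n + 1) \<cdot>\<^bsub>C\<^esub> cdiff X n = cdiff Y n \<cdot>\<^bsub>C\<^esub> f n"
  shows "arr (Ch C) f X Y"
  using assms by (simp add: Ch_arr_iff)

lemma Hom_Ch_arr: "X \<in> Obj (Ch C) \<Longrightarrow> Y \<in> Obj (Ch C) \<Longrightarrow> f \<in> Hom (Ch C) X Y \<longleftrightarrow> arr (Ch C) f X Y"
  by (simp add: arr_def)

context preadditive_category
begin

text \<open>Complexes are treated as a preadditive category; their kernels, cokernels and exact
  sequences are handled through the single degrees.\<close>

lemma Ch_preadditive: "preadditive_category (Ch C)"
proof
  fix X assume X: "X \<in> Obj (Ch C)"
  note XD = Ch_objD[OF X]
  show "Ident (Ch C) X \<in> Hom (Ch C) X X"
    unfolding Hom_Ch_arr[OF X X] by (rule Ch_arrI[OF X X])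
      (simp_all add: Ch_simps arr_id XD(1) id_left[OF XD(2)] id_right[OF XD(2)])
  fix Y assume Y: "Y \<in> Obj (Ch C)"
  note YD = Ch_objD[OF Y]
  show z: "Zero (Ch C) X Y \<in> Hom (Ch C) X Y"
    unfolding Hom_Ch_arr[OF X Y]
    by (rule Ch_arrI[OF X Y])
      (simp_all add: Ch_simps arr_zero XD(1) YD(1) zero_comp[OF XD(2) YD(1)] comp_zero[OF YD(2) XD(1)])
  fix f assume f: "f \<in> Hom (Ch C) X Y"
  then have fa: "arr (Ch C) f X Y" using X Y by (simp add: arr_def)
  note fD = Ch_arrD(3)[OF fa]
  show "Ident (Ch C) Y \<cdot>\<^bsub>Ch C\<^esub> f = f" "f \<cdot>\<^bsub>Ch C\<^esub> Ident (Ch C) X = f"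
    "f \<boxplus>\<^bsub>Ch C\<^esub> Zero (Ch C) X Y = f"
    by (simp_all add: Ch_simps id_left[OF fD] id_right[OF fD] add_zero[OF fD])
  show "\<exists>g\<in>Hom (Ch C) X Y. f \<boxplus>\<^bsub>Ch C\<^esub> g = Zero (Ch C) X Y"
  proof -
    have "\<forall>n. \<exists>g. arr C g (cob X n) (cob Y n) \<and> f n \<boxplus> g = Zero C (cob X n) (cob Y n)"
      using ex_neg[OF fD] by blast
    then obtain g where g: "\<And>n. arr C (g n) (cob X n) (cob Y n)"
      "\<And>n. f n \<boxplus> g n = Zero C (cob X n) (cob Y n)" by metis
    have "arr (Ch C) g X Y"
    proof (rule Ch_arrI[OF X Y g(1)])
      fix n
      note d = Ch_arrD(4)[OF fa, of n]
      have fg: "arr C (cdiff Y n \<cdot> f n) (cob X n) (cob Y (n + 1))" "arr C (cdiff Y n \<cdot> g n) (cob X n) (cob Y (n + 1))"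
        "arr C (g (n + 1) \<cdot> cdiff X n) (cob X n) (cob Y (n + 1))"
        using arr_comp YD(2) XD(2) fD g(1) by blast+
      \<comment> \<open>Both \<open>g (n + 1) \<cdot> cdiff X n\<close> and
        \<open>cdiff Y n \<cdot> g n\<close> are negatives of \<open>cdiff Y n \<cdot> f n\<close>;
        cancelling that term shows that the degreewise negatives form a chain map.\<close>
      have "(g (n + 1) \<cdot> cdiff X n) \<boxplus> (cdiff Y n \<cdot> f n) = (f (n + 1) \<boxplus> g (n + 1)) \<cdot> cdiff X n"
        using add_comp[OF fD g(1) XD(2)] d add_commute[OF fg(1,3)] by simp
      also have "\<dots> = cdiff Y n \<cdot> (f n \<boxplus> g n)"
        using g(2) zero_comp[OF XD(2) YD(1)] comp_zero[OF YD(2) XD(1)] by simp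
      also have "\<dots> = (cdiff Y n \<cdot> g n) \<boxplus> (cdiff Y n \<cdot> f n)"
        using comp_add[OF YD(2) fD g(1)] add_commute[OF fg(1,2)] by simp
      finally show "g (n + 1) \<cdot> cdiff X n = cdiff Y n \<cdot> g n" using add_cancel[OF fg(3,2,1)] by simp
    qed
    then show ?thesis using g(2) by (auto simp: Ch_simps arr_def)
  qed
  fix g assume g: "g \<in> Hom (Ch C) X Y"
  then have ga: "arr (Ch C) g X Y" using X Y by (simp add: arr_def)
  note gD = Ch_arrD(3)[OF ga]
  show "f \<boxplus>\<^bsub>Ch C\<^esub> g \<in> Hom (Ch C) X Y"
    unfolding Hom_Ch_arr[OF X Y]
    by (rule Ch_arrI[OF X Y]) (simp_all add: Ch_simps arr_plus fD gD add_comp[OF fD gD XD(2)]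
        comp_add[OF YD(2) fD gD] Ch_arrD(4)[OF fa] Ch_arrD(4)[OF ga])
  show "f \<boxplus>\<^bsub>Ch C\<^esub> g = g \<boxplus>\<^bsub>Ch C\<^esub> f" by (simp add: Ch_simps add_commute[OF fD gD])
  fix h assume h: "h \<in> Hom (Ch C) X Y"
  then have ha: "arr (Ch C) h X Y" using X Y by (simp add: arr_def)
  show "(f \<boxplus>\<^bsub>Ch C\<^esub> g) \<boxplus>\<^bsub>Ch C\<^esub> h = f \<boxplus>\<^bsub>Ch C\<^esub> (g \<boxplus>\<^bsub>Ch C\<^esub> h)"
    by (simp add: Ch_simps add_assoc[OF fD gD Ch_arrD(3)[OF ha]])
next
  fix X Y Z f g assume "X \<in> Obj (Ch C)" "Y \<in> Obj (Ch C)" "Z \<in> Obj (Ch C)"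
    "f \<in> Hom (Ch C) X Y" "g \<in> Hom (Ch C) Y Z"
  then have f: "arr (Ch C) f X Y" and g: "arr (Ch C) g Y Z" by (simp_all add: arr_def)
  note fD = Ch_arrD[OF f] and gD = Ch_arrD[OF g]
  note X = Ch_objD[OF fD(1)] and Y = Ch_objD[OF fD(2)] and Z = Ch_objD[OF gD(2)]
  show "g \<cdot>\<^bsub>Ch C\<^esub> f \<in> Hom (Ch C) X Z"
    unfolding Hom_Ch_arr[OF fD(1) gD(2)]
  proof (rule Ch_arrI[OF fD(1) gD(2)]; unfold Ch_simps)
    fix n
    show "arr C (g n \<cdot> f n) (cob X n) (cob Z n)" using arr_comp gD(3) fD(3) by blast
    show "(g (n + 1) \<cdot> f (n + 1)) \<cdot> cdiff X n = cdiff Z n \<cdot> (g n \<cdot> f n)"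
      using assoc[OF gD(3) fD(3) X(2)] fD(4) assoc[OF gD(3) Y(2) fD(3)] gD(4) assoc[OF Z(2) gD(3) fD(3)]
      by simp
  qed
next
  fix W X Y Z f g h assume "W \<in> Obj (Ch C)" "X \<in> Obj (Ch C)" "Y \<in> Obj (Ch C)" "Z \<in> Obj (Ch C)"
    "f \<in> Hom (Ch C) W X" "g \<in> Hom (Ch C) X Y" "h \<in> Hom (Ch C) Y Z"
  then have "arr (Ch C) f W X" "arr (Ch C) g X Y" "arr (Ch C) h Y Z" by (simp_all add: arr_def)
  note D = this[THEN Ch_arrD(3)]
  show "(h \<cdot>\<^bsub>Ch C\<^esub> g) \<cdot>\<^bsub>Ch C\<^esub> f = h \<cdot>\<^bsub>Ch C\<^esub> (g \<cdot>\<^bsub>Ch C\<^esub> f)"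
    by (simp add: Ch_simps assoc[OF D(3,2,1)])
next
  fix X Y Z f g h assume "X \<in> Obj (Ch C)" "Y \<in> Obj (Ch C)" "Z \<in> Obj (Ch C)"
    "f \<in> Hom (Ch C) X Y" "g \<in> Hom (Ch C) Y Z" "h \<in> Hom (Ch C) Y Z"
  then have "arr (Ch C) f X Y" "arr (Ch C) g Y Z" "arr (Ch C) h Y Z" by (simp_all add: arr_def)
  note D = this[THEN Ch_arrD(3)]
  show "(g \<boxplus>\<^bsub>Ch C\<^esub> h) \<cdot>\<^bsub>Ch C\<^esub> f = (g \<cdot>\<^bsub>Ch C\<^esub> f) \<boxplus>\<^bsub>Ch C\<^esub> (h \<cdot>\<^bsub>Ch C\<^esub> f)"
    by (simp add: Ch_simps add_comp[OF D(2,3,1)])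
next
  fix X Y Z f g h assume "X \<in> Obj (Ch C)" "Y \<in> Obj (Ch C)" "Z \<in> Obj (Ch C)"
    "f \<in> Hom (Ch C) X Y" "g \<in> Hom (Ch C) X Y" "h \<in> Hom (Ch C) Y Z"
  then have "arr (Ch C) f X Y" "arr (Ch C) g X Y" "arr (Ch C) h Y Z" by (simp_all add: arr_def)
  note D = this[THEN Ch_arrD(3)]
  show "h \<cdot>\<^bsub>Ch C\<^esub> (f \<boxplus>\<^bsub>Ch C\<^esub> g) = (h \<cdot>\<^bsub>Ch C\<^esub> f) \<boxplus>\<^bsub>Ch C\<^esub> (h \<cdot>\<^bsub>Ch C\<^esub> g)"
    by (simp add: Ch_simps comp_add[OF D(3,1,2)])
qed

lemmas Ch_kernelD = preadditive_category.kernelD[OF Ch_preadditive]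
lemmas Ch_kernelI = preadditive_category.kernelI[OF Ch_preadditive]
lemmas Ch_cokernelD = preadditive_category.cokernelD[OF Ch_preadditive]
lemmas Ch_cokernelI = preadditive_category.cokernelI[OF Ch_preadditive]
lemmas Ch_arr_zero = preadditive_category.arr_zero[OF Ch_preadditive]
lemmas Ch_comp_zero = preadditive_category.comp_zero[OF Ch_preadditive]
lemmas Ch_zero_comp = preadditive_category.zero_comp[OF Ch_preadditive]

end

text \<open>For testing monomorphisms, epimorphisms, kernels and cokernels in a single degree, it does
  not matter what the complex looks like outside the degrees \<open>n\<close> and \<open>n + 1\<close>, so no zero
  object is needed.\<close>

definition disc :: "('o, 'm, 'z) addcat_scheme \<Rightarrow> int \<Rightarrow> 'o \<Rightarrow> ('o, 'm) cochain" where
  "disc C n W = Cochain (\<lambda>m. W) (\<lambda>m. if m = n then Ident C W else Zero C W W)"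

text \<open>Extends an arrow into degree \<open>n\<close> of \<open>X\<close> to a chain map out of
  \<open>disc C n W\<close>. The identity differential forces the value in degree
  \<open>n + 1\<close>; elsewhere zero is compatible.\<close>

definition from_disc ::
  "('o, 'm, 'z) addcat_scheme \<Rightarrow> int \<Rightarrow> 'o \<Rightarrow> ('o, 'm) cochain \<Rightarrow> 'm \<Rightarrow> int \<Rightarrow> 'm" where
  "from_disc C n W X g m =
     (if m = n then g else if m = n + 1 then cdiff X n \<cdot>\<^bsub>C\<^esub> g else Zero C W (cob X m))"

text \<open>Here the free datum sits in degree \<open>n + 1\<close> and the value in degree
  \<open>n\<close> is forced, so a test in degree \<open>n\<close> uses the disc of index
  \<open>n - 1\<close>.\<close>

definition to_disc ::
  "('o, 'm, 'z) addcat_scheme \<Rightarrow> int \<Rightarrow> 'o \<Rightarrow> ('o, 'm) cochain \<Rightarrow> 'm \<Rightarrow> int \<Rightarrow> 'm" where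
  "to_disc C n W X g m =
     (if m = n + 1 then g else if m = n then g \<cdot>\<^bsub>C\<^esub> cdiff X n else Zero C (cob X m) W)"

section \<open>Monomorphisms, epimorphisms, kernels and cokernels of complexes, degree by
  degree\<close>

context preadditive_category
begin

lemma disc_obj:
  assumes "W \<in> Obj C"
  shows "disc C n W \<in> Obj (Ch C)"
  using arr_id[OF assms] arr_zero[OF assms assms] zero_comp[OF arr_id[OF assms] assms]
    comp_zero[OF arr_id[OF assms] assms] zero_comp[OF arr_zero[OF assms assms] assms]
  by (simp add: Ch_obj_iff disc_def)

lemma from_disc_arr:
  assumes X: "X \<in> Obj (Ch C)" and g: "arr C g W (cob X n)"
  shows "arr (Ch C) (from_disc C n W X g) (disc C n W) X"
proof (rule Ch_arrI)
  have W: "W \<in> Obj C" using g by (simp add: arr_def)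
  note D = Ch_objD[OF X]
  show "disc C n W \<in> Obj (Ch C)" "X \<in> Obj (Ch C)" using disc_obj W X by blast+
  fix m
  show "arr C (from_disc C n W X g m) (cob (disc C n W) m) (cob X m)"
    using g arr_comp[OF D(2) g] arr_zero[OF W D(1)] by (simp add: from_disc_def disc_def)
  have "(cdiff X (n + 1) \<cdot> cdiff X n) \<cdot> g = Zero C W (cob X (n + 1 + 1))"
    using D(3) zero_comp[OF g D(1)] by simp
  then have "cdiff X (n + 1) \<cdot> (cdiff X n \<cdot> g) = Zero C W (cob X (n + 1 + 1))"
    using assoc[OF D(2)[of "n + 1"] D(2)[of n] g] by simp
  then show "from_disc C n W X g (m + 1) \<cdot> cdiff (disc C n W) m = cdiff X m \<cdot> from_disc C n W X g m"
    using id_right[OF arr_comp[OF D(2) g]] comp_zero[OF g W] comp_zero[OF arr_zero[OF W D(1)] W]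
      comp_zero[OF D(2) W]
    by (auto simp: from_disc_def disc_def)
qed

lemma to_disc_arr:
  assumes X: "X \<in> Obj (Ch C)" and g: "arr C g (cob X (n + 1)) W"
  shows "arr (Ch C) (to_disc C n W X g) X (disc C n W)"
proof (rule Ch_arrI)
  have W: "W \<in> Obj C" using g by (simp add: arr_def)
  note D = Ch_objD[OF X]
  show "disc C n W \<in> Obj (Ch C)" "X \<in> Obj (Ch C)" using disc_obj W X by blast+
  fix m
  show "arr C (to_disc C n W X g m) (cob X m) (cob (disc C n W) m)"
    using g arr_comp[OF g D(2)] arr_zero[OF D(1) W] by (simp add: to_disc_def disc_def)
  \<comment> \<open>The case just below degree \<open>n\<close>, where the forced value
    \<open>g \<cdot> cdiff X n\<close> meets the preceding differential of \<open>X\<close>.\<close>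
  have gd: "(g \<cdot> cdiff X n) \<cdot> cdiff X m = Zero C (cob X m) W" if "m + 1 = n"
    using that D(3)[of m] assoc[OF g D(2)[of n], of "cdiff X m" "cob X m"] D(2)[of m] comp_zero[OF g D(1)] by auto
  show "to_disc C n W X g (m + 1) \<cdot> cdiff X m = cdiff (disc C n W) m \<cdot> to_disc C n W X g m"
    using id_left[OF arr_comp[OF g D(2)]] zero_comp[OF g W] zero_comp[OF arr_zero[OF D(1) W] W]
      zero_comp[OF D(2) W] zero_comp[OF D(2)[of "n + 1"] W] gd
    by (auto simp: to_disc_def disc_def)
qed

lemma from_disc_comp:
  assumes f: "arr (Ch C) f X Y" and g: "arr C g W (cob X n)"
  shows "f \<cdot>\<^bsub>Ch C\<^esub> from_disc C n W X g = from_disc C n W Y (f n \<cdot> g)"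
proof -
  note fD = Ch_arrD[OF f]
  note D = Ch_objD[OF fD(1)] and E = Ch_objD[OF fD(2)]
  have W: "W \<in> Obj C" using g by (simp add: arr_def)
  show ?thesis
    using assoc[OF fD(3) D(2) g] assoc[OF E(2) fD(3) g] fD(4)[of n] comp_zero[OF fD(3) W]
    by (auto simp: fun_eq_iff from_disc_def Ch_simps)
qed

lemma to_disc_comp:
  assumes f: "arr (Ch C) f X Y" and g: "arr C g (cob Y (n + 1)) W"
  shows "to_disc C n W Y g \<cdot>\<^bsub>Ch C\<^esub> f = to_disc C n W X (g \<cdot> f (n + 1))"
proof -
  note fD = Ch_arrD[OF f]
  note D = Ch_objD[OF fD(1)] and E = Ch_objD[OF fD(2)]
  have W: "W \<in> Obj C" using g by (simp add: arr_def)
  show ?thesis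
    using assoc[OF g E(2) fD(3)] assoc[OF g fD(3) D(2)] fD(4)[of n] zero_comp[OF fD(3) W]
    by (auto simp: fun_eq_iff to_disc_def Ch_simps)
qed

lemma from_disc_zero:
  assumes "X \<in> Obj (Ch C)" "W \<in> Obj C"
  shows "from_disc C n W X (Zero C W (cob X n)) = Zero (Ch C) (disc C n W) X"
  using comp_zero[OF Ch_objD(2)[OF assms(1)] assms(2)]
  by (auto simp: fun_eq_iff from_disc_def Ch_simps disc_def)

lemma to_disc_zero:
  assumes "X \<in> Obj (Ch C)" "W \<in> Obj C"
  shows "to_disc C n W X (Zero C (cob X (n + 1)) W) = Zero (Ch C) X (disc C n W)"
  using zero_comp[OF Ch_objD(2)[OF assms(1)] assms(2)]
  by (auto simp: fun_eq_iff to_disc_def Ch_simps disc_def)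

text \<open>The arrow \<open>g\<close> extends to a chain map from a disc, and the monomorphism can
  be cancelled there; degree \<open>n\<close> of the resulting equation is the claim.\<close>

lemma Ch_monoD:
  assumes m: "is_mono (Ch C) X Y f" and f: "arr (Ch C) f X Y"
    and g: "arr C g W (cob X n)" "f n \<cdot> g = Zero C W (cob Y n)"
  shows "g = Zero C W (cob X n)"
proof -
  have W: "W \<in> Obj C" using g(1) by (simp add: arr_def)
  note X = Ch_arrD(1)[OF f] and Y = Ch_arrD(2)[OF f]
  note z = Ch_arr_zero[OF disc_obj[OF W] X]
  have "f \<cdot>\<^bsub>Ch C\<^esub> from_disc C n W X g = f \<cdot>\<^bsub>Ch C\<^esub> Zero (Ch C) (disc C n W) X"
    using from_disc_comp[OF f g(1)] g(2) from_disc_zero[OF Y W] Ch_comp_zero[OF f disc_obj[OF W]] by simp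
  then have "from_disc C n W X g = Zero (Ch C) (disc C n W) X"
    using m from_disc_arr[OF X g(1)] z disc_obj[OF W] unfolding is_mono_def arr_def by blast
  then have "from_disc C n W X g n = Zero C W (cob X n)" by (simp add: Ch_simps disc_def)
  then show ?thesis by (simp add: from_disc_def)
qed

lemma Ch_epiD:
  assumes m: "is_epi (Ch C) X Y f" and f: "arr (Ch C) f X Y"
  shows "cover C (f n) (cob X n) (cob Y n)"
proof (rule coverI[OF Ch_arrD(3)[OF f]])
  fix W g assume g: "arr C g (cob Y n) W" "g \<cdot> f n = Zero C (cob X n) W"
  define k where "k = n - 1"
  have n: "n = k + 1" by (simp add: k_def)
  have g': "arr C g (cob Y (k + 1)) W" using g(1) n by simp
  have W: "W \<in> Obj C" using g(1) by (simp add: arr_def)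
  note X = Ch_arrD(1)[OF f] and Y = Ch_arrD(2)[OF f]
  note z = Ch_arr_zero[OF Y disc_obj[OF W, of k]]
  have "to_disc C k W Y g \<cdot>\<^bsub>Ch C\<^esub> f = Zero (Ch C) Y (disc C k W) \<cdot>\<^bsub>Ch C\<^esub> f"
    using to_disc_comp[OF f g'] g(2) n to_disc_zero[OF X W] Ch_zero_comp[OF f disc_obj[OF W]] by simp
  then have "to_disc C k W Y g = Zero (Ch C) Y (disc C k W)"
    using m to_disc_arr[OF Y g'] z disc_obj[OF W] unfolding is_epi_def arr_def by blast
  then have "to_disc C k W Y g n = Zero C (cob Y n) W" by (simp add: Ch_simps disc_def)
  then show "g = Zero C (cob Y n) W" by (simp add: to_disc_def n)
qed

text \<open>Discs serve as test complexes: an arrow killed by \<open>f n\<close> extends to a chain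
  map killed by \<open>f\<close>, which factors through \<open>k\<close>, and degree
  \<open>n\<close> of the factor is the one wanted.\<close>

lemma Ch_kernel_degreewise:
  assumes k: "is_kernel (Ch C) X Y f K k" and f: "arr (Ch C) f X Y"
  shows "is_kernel C (cob X n) (cob Y n) (f n) (cob K n) (k n)"
proof -
  note K = Ch_kernelD[OF k f]
  note X = Ch_arrD(1)[OF f] and Y = Ch_arrD(2)[OF f]
  have fk: "f n \<cdot> k n = Zero C (cob K n) (cob Y n)" using fun_cong[OF K(2), of n] by (simp add: Ch_simps)
  have mono: "is_mono (Ch C) K X k" using K(1,4) by (auto simp: is_mono_def arr_def)
  show ?thesis
  proof (rule kernelI[OF Ch_arrD(3)[OF f] Ch_arrD(3)[OF K(1)] fk])
    fix W g assume g: "arr C g W (cob X n)" "f n \<cdot> g = Zero C W (cob Y n)"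
    have W: "W \<in> Obj C" using g(1) by (simp add: arr_def)
    have "f \<cdot>\<^bsub>Ch C\<^esub> from_disc C n W X g = Zero (Ch C) (disc C n W) Y"
      using from_disc_comp[OF f g(1)] g(2) from_disc_zero[OF Y W] by simp
    then obtain h where h: "arr (Ch C) h (disc C n W) K" "k \<cdot>\<^bsub>Ch C\<^esub> h = from_disc C n W X g"
      using K(3)[OF from_disc_arr[OF X g(1)]] by blast
    have "arr C (h n) W (cob K n)" using Ch_arrD(3)[OF h(1), of n] by (simp add: disc_def)
    moreover have "k n \<cdot> h n = g" using fun_cong[OF h(2), of n] by (simp add: Ch_simps from_disc_def)
    ultimately show "\<exists>h. arr C h W (cob K n) \<and> k n \<cdot> h = g" by blast
  next
    fix W g assume "arr C g W (cob K n)" "k n \<cdot> g = Zero C W (cob X n)"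
    then show "g = Zero C W (cob K n)" by (rule Ch_monoD[OF mono K(1)])
  qed
qed

lemma Ch_cokernel_degreewise:
  assumes k: "is_cokernel (Ch C) X Y f Q q" and f: "arr (Ch C) f X Y"
  shows "is_cokernel C (cob X n) (cob Y n) (f n) (cob Q n) (q n)"
proof -
  note K = Ch_cokernelD[OF k f]
  note X = Ch_arrD(1)[OF f] and Y = Ch_arrD(2)[OF f]
  have fk: "q n \<cdot> f n = Zero C (cob X n) (cob Q n)" using fun_cong[OF K(2), of n] by (simp add: Ch_simps)
  have epi: "is_epi (Ch C) Y Q q" using K(1,4) by (auto simp: is_epi_def arr_def)
  show ?thesis
  proof (rule cokernelI[OF Ch_arrD(3)[OF f] Ch_arrD(3)[OF K(1)] fk])
    fix W g assume g: "arr C g (cob Y n) W" "g \<cdot> f n = Zero C (cob X n) W"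
    define k where "k = n - 1"
    have n: "n = k + 1" by (simp add: k_def)
    have g': "arr C g (cob Y (k + 1)) W" using g(1) n by simp
    have W: "W \<in> Obj C" using g(1) by (simp add: arr_def)
    have "to_disc C k W Y g \<cdot>\<^bsub>Ch C\<^esub> f = Zero (Ch C) X (disc C k W)"
      using to_disc_comp[OF f g'] g(2) n to_disc_zero[OF X W] by simp
    then obtain h where h: "arr (Ch C) h Q (disc C k W)" "h \<cdot>\<^bsub>Ch C\<^esub> q = to_disc C k W Y g"
      using K(3)[OF to_disc_arr[OF Y g']] by blast
    have "arr C (h n) (cob Q n) W" using Ch_arrD(3)[OF h(1), of n] by (simp add: disc_def)
    moreover have "h n \<cdot> q n = g" using fun_cong[OF h(2), of n] by (simp add: Ch_simps to_disc_def n)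
    ultimately show "\<exists>h. arr C h (cob Q n) W \<and> h \<cdot> q n = g" by blast
  next
    fix W g assume "arr C g (cob Q n) W" "g \<cdot> q n = Zero C (cob Y n) W"
    then show "g = Zero C (cob Q n) W" using cover_zero[OF Ch_epiD[OF epi K(1)]] by blast
  qed
qed

text \<open>Factorisations are chosen in each degree separately; since every \<open>k n\<close> is
  monic, they automatically commute with the differentials.\<close>

lemma Ch_kernel_from_degreewise:
  assumes f: "arr (Ch C) f X Y" and k: "arr (Ch C) k K X"
    and ker: "\<And>n. is_kernel C (cob X n) (cob Y n) (f n) (cob K n) (k n)"
  shows "is_kernel (Ch C) X Y f K k"
proof (rule Ch_kernelI[OF f k])
  note N = kernelD[OF ker Ch_arrD(3)[OF f]]
  note X = Ch_objD[OF Ch_arrD(1)[OF f]] and K = Ch_objD[OF Ch_arrD(1)[OF k]]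
  show "f \<cdot>\<^bsub>Ch C\<^esub> k = Zero (Ch C) K Y" using N(2) by (simp add: Ch_simps)
  fix W g
  show "\<exists>h. arr (Ch C) h W K \<and> k \<cdot>\<^bsub>Ch C\<^esub> h = g"
    if g: "arr (Ch C) g W X" "f \<cdot>\<^bsub>Ch C\<^esub> g = Zero (Ch C) W Y"
  proof -
    note gD = Ch_arrD[OF g(1)]
    note W = Ch_objD[OF gD(1)]
    have "f n \<cdot> g n = Zero C (cob W n) (cob Y n)" for n using fun_cong[OF g(2), of n] by (simp add: Ch_simps)
    then have "\<forall>n. \<exists>h. arr C h (cob W n) (cob K n) \<and> k n \<cdot> h = g n" using N(3)[OF gD(3)] by blast
    then obtain h where h: "\<And>n. arr C (h n) (cob W n) (cob K n)" "\<And>n. k n \<cdot> h n = g n" by metis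
    have "arr (Ch C) h W K"
    proof (rule Ch_arrI[OF gD(1) Ch_arrD(1)[OF k] h(1)])
      fix n
      have "k (n + 1) \<cdot> (h (n + 1) \<cdot> cdiff W n) = cdiff X n \<cdot> (k n \<cdot> h n)"
        using assoc[OF N(1) h(1) W(2)] h(2) gD(4) by simp
      also have "\<dots> = k (n + 1) \<cdot> (cdiff K n \<cdot> h n)"
        using assoc[OF X(2) N(1) h(1)] assoc[OF N(1) K(2) h(1)] Ch_arrD(4)[OF k] by simp
      finally show "h (n + 1) \<cdot> cdiff W n = cdiff K n \<cdot> h n"
        using N(4)[OF arr_comp[OF h(1) W(2)] arr_comp[OF K(2) h(1)]] by simp
    qed
    then show ?thesis using h(2) by (auto simp: Ch_simps)
  qed
  show "g = Zero (Ch C) W K" if g: "arr (Ch C) g W K" "k \<cdot>\<^bsub>Ch C\<^esub> g = Zero (Ch C) W X"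
  proof
    fix n
    note W = Ch_objD(1)[OF Ch_arrD(1)[OF g(1)], of n]
    have "k n \<cdot> g n = k n \<cdot> Zero C (cob W n) (cob K n)"
      using fun_cong[OF g(2), of n] comp_zero[OF N(1) W] by (simp add: Ch_simps)
    then show "g n = Zero (Ch C) W K n"
      using N(4)[OF Ch_arrD(3)[OF g(1)] arr_zero[OF W K(1)]] by (simp add: Ch_simps)
  qed
qed

lemma Ch_cokernel_from_degreewise:
  assumes f: "arr (Ch C) f X Y" and q: "arr (Ch C) q Y Q"
    and coker: "\<And>n. is_cokernel C (cob X n) (cob Y n) (f n) (cob Q n) (q n)"
  shows "is_cokernel (Ch C) X Y f Q q"
proof (rule Ch_cokernelI[OF f q])
  note N = cokernelD[OF coker Ch_arrD(3)[OF f]]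
  note Y = Ch_objD[OF Ch_arrD(2)[OF f]] and Q = Ch_objD[OF Ch_arrD(2)[OF q]]
  show "q \<cdot>\<^bsub>Ch C\<^esub> f = Zero (Ch C) X Q" using N(2) by (simp add: Ch_simps)
  fix W g
  show "\<exists>h. arr (Ch C) h Q W \<and> h \<cdot>\<^bsub>Ch C\<^esub> q = g"
    if g: "arr (Ch C) g Y W" "g \<cdot>\<^bsub>Ch C\<^esub> f = Zero (Ch C) X W"
  proof -
    note gD = Ch_arrD[OF g(1)]
    note W = Ch_objD[OF gD(2)]
    have "g n \<cdot> f n = Zero C (cob X n) (cob W n)" for n using fun_cong[OF g(2), of n] by (simp add: Ch_simps)
    then have "\<forall>n. \<exists>h. arr C h (cob Q n) (cob W n) \<and> h \<cdot> q n = g n" using N(3)[OF gD(3)] by blast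
    then obtain h where h: "\<And>n. arr C (h n) (cob Q n) (cob W n)" "\<And>n. h n \<cdot> q n = g n" by metis
    have "arr (Ch C) h Q W"
    proof (rule Ch_arrI[OF Ch_arrD(2)[OF q] gD(2) h(1)])
      fix n
      have "(h (n + 1) \<cdot> cdiff Q n) \<cdot> q n = (h (n + 1) \<cdot> q (n + 1)) \<cdot> cdiff Y n"
        using assoc[OF h(1) Q(2) N(1)] assoc[OF h(1) N(1) Y(2)] Ch_arrD(4)[OF q] by simp
      also have "\<dots> = (cdiff W n \<cdot> h n) \<cdot> q n"
        using h(2) gD(4) assoc[OF W(2) h(1) N(1)] by simp
      finally show "h (n + 1) \<cdot> cdiff Q n = cdiff W n \<cdot> h n"
        using N(4)[OF arr_comp[OF h(1) Q(2)] arr_comp[OF W(2) h(1)]] by simp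
    qed
    then show ?thesis using h(2) by (auto simp: Ch_simps)
  qed
  show "g = Zero (Ch C) Q W" if g: "arr (Ch C) g Q W" "g \<cdot>\<^bsub>Ch C\<^esub> q = Zero (Ch C) Y W"
  proof
    fix n
    note W = Ch_objD(1)[OF Ch_arrD(2)[OF g(1)], of n]
    have "g n \<cdot> q n = Zero C (cob Q n) (cob W n) \<cdot> q n"
      using fun_cong[OF g(2), of n] zero_comp[OF N(1) W] by (simp add: Ch_simps)
    then show "g n = Zero (Ch C) Q W n"
      using N(4)[OF Ch_arrD(3)[OF g(1)] arr_zero[OF Q(1) W]] by (simp add: Ch_simps)
  qed
qed

lemma Ch_epi_from_degreewise:
  assumes f: "arr (Ch C) f X Y" and c: "\<And>n. cover C (f n) (cob X n) (cob Y n)"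
  shows "is_epi (Ch C) X Y f"
proof -
  have "g = h" if g: "arr (Ch C) g Y W" and h: "arr (Ch C) h Y W" and e: "g \<cdot>\<^bsub>Ch C\<^esub> f = h \<cdot>\<^bsub>Ch C\<^esub> f" for W g h
  proof
    fix n
    show "g n = h n" using cover_cancel[OF c Ch_arrD(3)[OF g] Ch_arrD(3)[OF h]] fun_cong[OF e, of n]
      by (simp add: Ch_simps)
  qed
  then show ?thesis using f by (auto simp: is_epi_def arr_def)
qed

lemma Ch_kernel_mono:
  assumes "is_kernel (Ch C) X Y f K k" "arr (Ch C) f X Y"
  shows "is_mono (Ch C) K X k"
  using Ch_kernelD(1,4)[OF assms] by (auto simp: is_mono_def arr_def)

end

lemma (in abelian_category) Ch_ses_degreewise:
  assumes "is_ses (Ch C) X Y Z f g"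
  shows "is_ses C (cob X n) (cob Y n) (cob Z n) (f n) (g n)"
  using Ch_kernel_degreewise[OF sesD(3)[OF assms] sesD(2)[OF assms]]
    Ch_cokernel_degreewise[OF sesD(4)[OF assms] sesD(1)[OF assms]]
  by (auto simp: is_ses_def is_kernel_def is_cokernel_def sesD(1,2)[OF assms, THEN Ch_arrD(3)] arr_def
      intro: arrD(1)[OF Ch_arrD(3)[OF sesD(1)[OF assms]]] arrD(2)[OF Ch_arrD(3)[OF sesD(1)[OF assms]]])

section \<open>Short exact sequences of complexes\<close>

text \<open>Exactness in degree \<open>n + 1\<close>, with boundaries taken up to a cover. Every
  integer has the form \<open>n + 1\<close>, and this indexing avoids subtraction in the incoming
  differential.\<close>

definition loc_exact :: "('o, 'm, 'z) addcat_scheme \<Rightarrow> ('o, 'm) cochain \<Rightarrow> bool" where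
  "loc_exact C X \<longleftrightarrow> (\<forall>n W x. arr C x W (cob X (n + 1)) \<and> cdiff X (n + 1) \<cdot>\<^bsub>C\<^esub> x = Zero C W (cob X (n + 1 + 1)) \<longrightarrow>
     (\<exists>V e y. cover C e V W \<and> arr C y V (cob X n) \<and> cdiff X n \<cdot>\<^bsub>C\<^esub> y = x \<cdot>\<^bsub>C\<^esub> e))"

text \<open>Injectivity of the induced map on cohomology in degree \<open>n + 1\<close>, without
  naming cohomology objects.\<close>

definition cohomology_inj ::
  "('o, 'm, 'z) addcat_scheme \<Rightarrow> ('o, 'm) cochain \<Rightarrow> ('o, 'm) cochain \<Rightarrow> (int \<Rightarrow> 'm) \<Rightarrow> bool" where
  "cohomology_inj C X Y f \<longleftrightarrow> (\<forall>n W x y. arr C x W (cob X (n + 1)) \<and>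
     cdiff X (n + 1) \<cdot>\<^bsub>C\<^esub> x = Zero C W (cob X (n + 1 + 1)) \<and>
     arr C y W (cob Y n) \<and> f (n + 1) \<cdot>\<^bsub>C\<^esub> x = cdiff Y n \<cdot>\<^bsub>C\<^esub> y \<longrightarrow>
     (\<exists>V e x'. cover C e V W \<and> arr C x' V (cob X n) \<and> cdiff X n \<cdot>\<^bsub>C\<^esub> x' = x \<cdot>\<^bsub>C\<^esub> e))"

text \<open>Surjectivity of the induced map on cohomology in degree \<open>n + 1\<close>:
  \<open>y'\<close> is the boundary correction between a cycle and the image of a cycle.\<close>

definition cohomology_surj ::
  "('o, 'm, 'z) addcat_scheme \<Rightarrow> ('o, 'm) cochain \<Rightarrow> ('o, 'm) cochain \<Rightarrow> (int \<Rightarrow> 'm) \<Rightarrow> bool" where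
  "cohomology_surj C X Y f \<longleftrightarrow> (\<forall>n W y. arr C y W (cob Y (n + 1)) \<and>
     cdiff Y (n + 1) \<cdot>\<^bsub>C\<^esub> y = Zero C W (cob Y (n + 1 + 1)) \<longrightarrow>
     (\<exists>V e x y'. cover C e V W \<and> arr C x V (cob X (n + 1)) \<and>
       cdiff X (n + 1) \<cdot>\<^bsub>C\<^esub> x = Zero C V (cob X (n + 1 + 1)) \<and> arr C y' V (cob Y n) \<and>
       y \<cdot>\<^bsub>C\<^esub> e = (f (n + 1) \<cdot>\<^bsub>C\<^esub> x) \<boxplus>\<^bsub>C\<^esub> (cdiff Y n \<cdot>\<^bsub>C\<^esub> y')))"

lemma loc_exactE:
  assumes "loc_exact C X" "arr C x W (cob X (n + 1))" "cdiff X (n + 1) \<cdot>\<^bsub>C\<^esub> x = Zero C W (cob X (n + 1 + 1))"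
  obtains V e y where "cover C e V W" "arr C y V (cob X n)" "cdiff X n \<cdot>\<^bsub>C\<^esub> y = x \<cdot>\<^bsub>C\<^esub> e"
  using assms unfolding loc_exact_def by blast

lemma cohomology_injE:
  assumes "cohomology_inj C X Y f" "arr C x W (cob X (n + 1))"
    "cdiff X (n + 1) \<cdot>\<^bsub>C\<^esub> x = Zero C W (cob X (n + 1 + 1))"
    "arr C y W (cob Y n)" "f (n + 1) \<cdot>\<^bsub>C\<^esub> x = cdiff Y n \<cdot>\<^bsub>C\<^esub> y"
  obtains V e x' where "cover C e V W" "arr C x' V (cob X n)" "cdiff X n \<cdot>\<^bsub>C\<^esub> x' = x \<cdot>\<^bsub>C\<^esub> e"
  using assms unfolding cohomology_inj_def by blast

lemma cohomology_surjE:
  assumes "cohomology_surj C X Y f" "arr C y W (cob Y (n + 1))"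
    "cdiff Y (n + 1) \<cdot>\<^bsub>C\<^esub> y = Zero C W (cob Y (n + 1 + 1))"
  obtains V e x y' where "cover C e V W" "arr C x V (cob X (n + 1))"
    "cdiff X (n + 1) \<cdot>\<^bsub>C\<^esub> x = Zero C V (cob X (n + 1 + 1))" "arr C y' V (cob Y n)"
    "y \<cdot>\<^bsub>C\<^esub> e = (f (n + 1) \<cdot>\<^bsub>C\<^esub> x) \<boxplus>\<^bsub>C\<^esub> (cdiff Y n \<cdot>\<^bsub>C\<^esub> y')"
  using assms unfolding cohomology_surj_def by blast

context preadditive_category
begin

text \<open>Chases apply arrows to elements one after the other, whereas the known equations are
  between composites; this rule and the next do the reassociation.\<close>

lemma square_comp:
  assumes "a \<cdot> b = c \<cdot> d" "arr C a Y Z" "arr C b X Y" "arr C c Y' Z" "arr C d X Y'" "arr C x W X"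
  shows "a \<cdot> (b \<cdot> x) = c \<cdot> (d \<cdot> x)"
  using assms(1) assoc[OF assms(2,3,6)] assoc[OF assms(4,5,6)] by simp

lemma zero_comp_comp:
  assumes "a \<cdot> b = Zero C X Z" "arr C a Y Z" "arr C b X Y" "arr C x W X"
  shows "a \<cdot> (b \<cdot> x) = Zero C W Z"
  using assms(1) assoc[OF assms(2-4)] zero_comp[OF assms(4) arrD(2)[OF assms(2)]] by simp

lemma Ch_comm:
  assumes "arr (Ch C) f X Y" "arr C x W (cob X n)"
  shows "f (n + 1) \<cdot> (cdiff X n \<cdot> x) = cdiff Y n \<cdot> (f n \<cdot> x)"
  using square_comp[OF Ch_arrD(4)[OF assms(1)] Ch_arrD(3)[OF assms(1)] Ch_objD(2)[OF Ch_arrD(1)[OF assms(1)]]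
      Ch_objD(2)[OF Ch_arrD(2)[OF assms(1)]] Ch_arrD(3)[OF assms(1)] assms(2)] .

lemma Ch_dd:
  assumes "X \<in> Obj (Ch C)" "arr C x W (cob X n)"
  shows "cdiff X (n + 1) \<cdot> (cdiff X n \<cdot> x) = Zero C W (cob X (n + 1 + 1))"
  using zero_comp_comp[OF Ch_objD(3)[OF assms(1)] Ch_objD(2)[OF assms(1)] Ch_objD(2)[OF assms(1)] assms(2)] .

end

context abelian_category
begin

lemma ses_mono:
  assumes "is_ses C X Y Q f q" "arr C x W X" "arr C x' W X" "f \<cdot> x = f \<cdot> x'"
  shows "x = x'"
  using kernelD(4)[OF sesD(3)[OF assms(1)] sesD(2)[OF assms(1)]] assms by blast

lemma ses_mono_zero:
  assumes "is_ses C X Y Q f q" "arr C x W X" "f \<cdot> x = Zero C W Y"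
  shows "x = Zero C W X"
  using ses_mono[OF assms(1,2) arr_zero] comp_zero[OF sesD(1)[OF assms(1)]] assms(2,3) arrD by metis

lemma ses_zero:
  assumes "is_ses C X Y Q f q" "arr C x W X"
  shows "q \<cdot> (f \<cdot> x) = Zero C W Q"
  using zero_comp_comp[OF kernelD(2)[OF sesD(3)[OF assms(1)] sesD(2)[OF assms(1)]] sesD(2,1)[OF assms(1)] assms(2)] .

lemma ses_liftE:
  assumes "is_ses C X Y Q f q" "arr C y W Y" "q \<cdot> y = Zero C W Q"
  obtains x where "arr C x W X" "f \<cdot> x = y"
  using kernelD(3)[OF sesD(3)[OF assms(1)] sesD(2)[OF assms(1)] assms(2,3)] by blast

lemma ses_coverE:
  assumes "is_ses C X Y Q f q" "arr C z W Q"
  obtains V e y where "cover C e V W" "arr C y V Y" "q \<cdot> y = z \<cdot> e"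
  using cover_lift[of q Y Q z W] assms by (metis ses_iff)

lemma ses_diffE:
  assumes s: "is_ses C X Y Q f q" and a: "arr C a W Y" and b: "arr C b W Y" and ab: "q \<cdot> a = q \<cdot> b"
  obtains x where "arr C x W X" "a = (f \<cdot> x) \<boxplus> b"
proof -
  obtain r where r: "arr C r W Y" "a = r \<boxplus> b" using ex_diff[OF a b] by blast
  note q = sesD(2)[OF s]
  have "(q \<cdot> r) \<boxplus> (q \<cdot> b) = q \<cdot> b" using ab r(2) comp_add[OF q r(1) b] by simp
  then have "q \<cdot> r = Zero C W Q" using add_eq_self[OF arr_comp[OF q r(1)] arr_comp[OF q b]] by simp
  then obtain x where "arr C x W X" "f \<cdot> x = r" using ses_liftE[OF s r(1)] by blast
  then show thesis using that r(2) by blast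
qed

end

section \<open>Exactness and cohomology in a degreewise short exact sequence of complexes\<close>

locale ses_complexes = abelian_category C
  for C :: "('o, 'm, 'z) addcat_scheme" (structure) +
  fixes X Y Q :: "('o, 'm) cochain" and f q :: "int \<Rightarrow> 'm"
  assumes f: "arr (Ch C) f X Y" and q: "arr (Ch C) q Y Q"
    and ses: "\<And>n. is_ses C (cob X n) (cob Y n) (cob Q n) (f n) (q n)"
begin

lemmas X = Ch_arrD(1)[OF f] and Y = Ch_arrD(2)[OF f] and Q = Ch_arrD(2)[OF q]
lemmas fa = Ch_arrD(3)[OF f] and qa = Ch_arrD(3)[OF q]
lemmas dX = Ch_objD(2)[OF X] and dY = Ch_objD(2)[OF Y] and dQ = Ch_objD(2)[OF Q]
lemmas obY = Ch_objD(1)[OF Y] and obQ = Ch_objD(1)[OF Q]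

text \<open>A cycle of the exact complex \<open>Q\<close> is the differential of some
  \<open>w\<close>, and \<open>w\<close> lifts to \<open>Y\<close>, each after a cover; so cycles of
  \<open>Q\<close> come from boundaries of \<open>Y\<close>.\<close>

lemma exact_quotient_lift:
  assumes ex: "loc_exact C Q" and z: "arr C z W (cob Q (n + 1))"
    and dz: "cdiff Q (n + 1) \<cdot> z = Zero C W (cob Q (n + 1 + 1))"
  obtains V e y where "cover C e V W" "arr C y V (cob Y n)" "q (n + 1) \<cdot> (cdiff Y n \<cdot> y) = z \<cdot> e"
proof -
  obtain V e w where e: "cover C e V W" and w: "arr C w V (cob Q n)" "cdiff Q n \<cdot> w = z \<cdot> e"
    using loc_exactE[OF ex z dz] .
  obtain V' e' y where e': "cover C e' V' V" and y: "arr C y V' (cob Y n)" "q n \<cdot> y = w \<cdot> e'"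
    using ses_coverE[OF ses w(1)] .
  note ea = cover_arr[OF e] cover_arr[OF e']
  have "q (n + 1) \<cdot> (cdiff Y n \<cdot> y) = cdiff Q n \<cdot> (w \<cdot> e')" using Ch_comm[OF q y(1)] y(2) by simp
  also have "\<dots> = z \<cdot> (e \<cdot> e')" using square_comp[OF w(2) dQ w(1) z ea] .
  finally show thesis using that cover_comp[OF e e'] y(1) by blast
qed

text \<open>If \<open>f x = d y\<close>, then \<open>q y\<close> is a cycle of \<open>Q\<close>,
  hence of the form \<open>q (d y')\<close>. So \<open>y - d y'\<close> comes from some
  \<open>x'\<close>, and \<open>d x' = x\<close> because \<open>f\<close> is monic and
  \<open>d d = 0\<close>.\<close>

lemma inj_of_exact_quotient:
  assumes ex: "loc_exact C Q"
  shows "cohomology_inj C X Y f"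
  unfolding cohomology_inj_def
proof (intro allI impI, elim conjE)
  fix n W x y
  assume x: "arr C x W (cob X (n + 1))" "cdiff X (n + 1) \<cdot> x = Zero C W (cob X (n + 1 + 1))"
    and y: "arr C y W (cob Y n)" and fxy: "f (n + 1) \<cdot> x = cdiff Y n \<cdot> y"
  \<comment> \<open>Exactness of \<open>Q\<close> is used in degree \<open>n\<close>, which the
    lifting lemma expects in the form \<open>m + 1\<close>.\<close>
  obtain m where n: "n = m + 1" by (metis diff_add_cancel)
  have qy: "arr C (q n \<cdot> y) W (cob Q n)" using qa y arr_comp by blast
  have "cdiff Q n \<cdot> (q n \<cdot> y) = Zero C W (cob Q (n + 1))"
    using Ch_comm[OF q y] fxy ses_zero[OF ses x(1)] by simp
  then obtain V e y' where e: "cover C e V W" and y': "arr C y' V (cob Y m)"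
    "q (m + 1) \<cdot> (cdiff Y m \<cdot> y') = (q n \<cdot> y) \<cdot> e"
    using exact_quotient_lift[OF ex qy[unfolded n]] n by metis
  note ea = cover_arr[OF e]
  have dy': "arr C (cdiff Y m \<cdot> y') V (cob Y n)" using dY y'(1) arr_comp n by blast
  have ye: "arr C (y \<cdot> e) V (cob Y n)" using y ea arr_comp by blast
  have "q n \<cdot> (y \<cdot> e) = q n \<cdot> (cdiff Y m \<cdot> y')" using y'(2) assoc[OF qa y ea] n by simp
  then obtain x' where x': "arr C x' V (cob X n)" "y \<cdot> e = (f n \<cdot> x') \<boxplus> (cdiff Y m \<cdot> y')"
    using ses_diffE[OF ses ye dy'] by blast
  have fx': "arr C (f n \<cdot> x') V (cob Y n)" using fa x'(1) arr_comp by blast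
  have "f (n + 1) \<cdot> (x \<cdot> e) = cdiff Y n \<cdot> (y \<cdot> e)" using square_comp[OF fxy fa x(1) dY y ea] .
  also have "\<dots> = cdiff Y n \<cdot> (f n \<cdot> x')"
    using comp_add[OF dY fx' dy'] x'(2) Ch_dd[OF Y y'(1)] add_zero[OF arr_comp[OF dY fx']] n by simp
  also have "\<dots> = f (n + 1) \<cdot> (cdiff X n \<cdot> x')" using Ch_comm[OF f x'(1)] by simp
  finally have "cdiff X n \<cdot> x' = x \<cdot> e"
    using ses_mono[OF ses arr_comp[OF x(1) ea] arr_comp[OF dX x'(1)]] by simp
  then show "\<exists>V e x'. cover C e V W \<and> arr C x' V (cob X n) \<and> cdiff X n \<cdot> x' = x \<cdot> e"
    using e x'(1) by blast
qed

text \<open>For a cycle \<open>y\<close> the image \<open>q y\<close> is \<open>q (d y')\<close>, so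
  \<open>y = f x + d y'\<close>; that \<open>x\<close> is a cycle follows since \<open>f\<close> is
  monic.\<close>

lemma surj_of_exact_quotient:
  assumes ex: "loc_exact C Q"
  shows "cohomology_surj C X Y f"
  unfolding cohomology_surj_def
proof (intro allI impI, elim conjE)
  fix n W y
  assume y: "arr C y W (cob Y (n + 1))" and dy: "cdiff Y (n + 1) \<cdot> y = Zero C W (cob Y (n + 1 + 1))"
  have W: "W \<in> Obj C" using y by (simp add: arr_def)
  have qy: "arr C (q (n + 1) \<cdot> y) W (cob Q (n + 1))" using qa y arr_comp by blast
  have "cdiff Q (n + 1) \<cdot> (q (n + 1) \<cdot> y) = Zero C W (cob Q (n + 1 + 1))"
    using Ch_comm[OF q y] dy comp_zero[OF qa W] by simp
  then obtain V e y' where e: "cover C e V W" and y': "arr C y' V (cob Y n)"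
    "q (n + 1) \<cdot> (cdiff Y n \<cdot> y') = (q (n + 1) \<cdot> y) \<cdot> e"
    using exact_quotient_lift[OF ex qy] by metis
  note ea = cover_arr[OF e]
  have dy': "arr C (cdiff Y n \<cdot> y') V (cob Y (n + 1))" using dY y'(1) arr_comp by blast
  have ye: "arr C (y \<cdot> e) V (cob Y (n + 1))" using y ea arr_comp by blast
  have "q (n + 1) \<cdot> (y \<cdot> e) = q (n + 1) \<cdot> (cdiff Y n \<cdot> y')" using y'(2) assoc[OF qa y ea] by simp
  then obtain x where x: "arr C x V (cob X (n + 1))" "y \<cdot> e = (f (n + 1) \<cdot> x) \<boxplus> (cdiff Y n \<cdot> y')"
    using ses_diffE[OF ses ye dy'] by blast
  have fx: "arr C (f (n + 1) \<cdot> x) V (cob Y (n + 1))" using fa x(1) arr_comp by blast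
  have "f (n + 1 + 1) \<cdot> (cdiff X (n + 1) \<cdot> x) = cdiff Y (n + 1) \<cdot> (y \<cdot> e)"
    using comp_add[OF dY fx dy'] x(2) Ch_dd[OF Y y'(1)] add_zero[OF arr_comp[OF dY fx]] Ch_comm[OF f x(1)] by simp
  also have "\<dots> = Zero C V (cob Y (n + 1 + 1))" using zero_comp_comp[OF dy dY y ea] .
  finally have "cdiff X (n + 1) \<cdot> x = Zero C V (cob X (n + 1 + 1))"
    using ses_mono_zero[OF ses arr_comp[OF dX x(1)]] by simp
  then show "\<exists>V e x y'. cover C e V W \<and> arr C x V (cob X (n + 1)) \<and>
       cdiff X (n + 1) \<cdot> x = Zero C V (cob X (n + 1 + 1)) \<and> arr C y' V (cob Y n) \<and>
       y \<cdot> e = (f (n + 1) \<cdot> x) \<boxplus> (cdiff Y n \<cdot> y')"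
    using e x y'(1) by blast
qed

text \<open>Lift a cycle \<open>z\<close> of \<open>Q\<close> to \<open>y\<close>; then
  \<open>d y = f x\<close>, where \<open>x\<close> represents the connecting class of
  \<open>z\<close>. Injectivity gives \<open>x = d x'\<close>, so \<open>w = y - f x'\<close> is a
  cycle over \<open>z\<close>. Surjectivity writes \<open>w\<close> as an image from
  \<open>X\<close> plus a boundary, and \<open>q\<close> kills the former.\<close>

lemma exact_quotient:
  assumes inj: "cohomology_inj C X Y f" and surj: "cohomology_surj C X Y f"
  shows "loc_exact C Q"
  unfolding loc_exact_def
proof (intro allI impI, elim conjE)
  fix n W z
  assume z: "arr C z W (cob Q (n + 1))" and dz: "cdiff Q (n + 1) \<cdot> z = Zero C W (cob Q (n + 1 + 1))"
  obtain V e y where e: "cover C e V W" and y: "arr C y V (cob Y (n + 1))" "q (n + 1) \<cdot> y = z \<cdot> e"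
    using ses_coverE[OF ses z] .
  note ea = cover_arr[OF e]
  have dy: "arr C (cdiff Y (n + 1) \<cdot> y) V (cob Y (n + 1 + 1))" using dY y(1) arr_comp by blast
  have "q (n + 1 + 1) \<cdot> (cdiff Y (n + 1) \<cdot> y) = Zero C V (cob Q (n + 1 + 1))"
    using Ch_comm[OF q y(1)] y(2) zero_comp_comp[OF dz dQ z ea] by simp
  then obtain x where x: "arr C x V (cob X (n + 1 + 1))" "f (n + 1 + 1) \<cdot> x = cdiff Y (n + 1) \<cdot> y"
    using ses_liftE[OF ses dy] by blast
  have "f (n + 1 + 1 + 1) \<cdot> (cdiff X (n + 1 + 1) \<cdot> x) = Zero C V (cob Y (n + 1 + 1 + 1))"
    using Ch_comm[OF f x(1)] x(2) Ch_dd[OF Y y(1)] by simp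
  then have dx: "cdiff X (n + 1 + 1) \<cdot> x = Zero C V (cob X (n + 1 + 1 + 1))"
    using ses_mono_zero[OF ses arr_comp[OF dX x(1)]] by simp
  \<comment> \<open>Injectivity is used one degree above \<open>z\<close>; surjectivity will be used
    in the degree of \<open>z\<close> itself.\<close>
  obtain V' e' x' where e': "cover C e' V' V" and x': "arr C x' V' (cob X (n + 1))" "cdiff X (n + 1) \<cdot> x' = x \<cdot> e'"
    using cohomology_injE[OF inj x(1) dx y(1) x(2)] .
  note ea' = cover_arr[OF e']
  have ye: "arr C (y \<cdot> e') V' (cob Y (n + 1))" and fx': "arr C (f (n + 1) \<cdot> x') V' (cob Y (n + 1))"
    using y(1) ea' fa x'(1) arr_comp by blast+
  obtain w where w: "arr C w V' (cob Y (n + 1))" "y \<cdot> e' = w \<boxplus> (f (n + 1) \<cdot> x')" using ex_diff[OF ye fx'] by blast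
  have "cdiff Y (n + 1) \<cdot> (y \<cdot> e') = cdiff Y (n + 1) \<cdot> (f (n + 1) \<cdot> x')"
    using square_comp[OF x(2) fa x(1) dY y(1) ea'] Ch_comm[OF f x'(1)] x'(2) by simp
  then have "(cdiff Y (n + 1) \<cdot> w) \<boxplus> (cdiff Y (n + 1) \<cdot> (f (n + 1) \<cdot> x')) = cdiff Y (n + 1) \<cdot> (f (n + 1) \<cdot> x')"
    using comp_add[OF dY w(1) fx'] w(2) by simp
  then have dw: "cdiff Y (n + 1) \<cdot> w = Zero C V' (cob Y (n + 1 + 1))"
    using add_eq_self[OF arr_comp[OF dY w(1)] arr_comp[OF dY fx']] by simp
  obtain V'' e'' x'' y'' where e'': "cover C e'' V'' V'" and x'': "arr C x'' V'' (cob X (n + 1))"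
    and y'': "arr C y'' V'' (cob Y n)" and we: "w \<cdot> e'' = (f (n + 1) \<cdot> x'') \<boxplus> (cdiff Y n \<cdot> y'')"
    using cohomology_surjE[OF surj w(1) dw] .
  note ea'' = cover_arr[OF e'']
  have fx'': "arr C (f (n + 1) \<cdot> x'') V'' (cob Y (n + 1))" and dy'': "arr C (cdiff Y n \<cdot> y'') V'' (cob Y (n + 1))"
    using fa x'' dY y'' arr_comp by blast+
  have "q (n + 1) \<cdot> w = q (n + 1) \<cdot> (y \<cdot> e')"
    using comp_add[OF qa w(1) fx'] w(2) ses_zero[OF ses x'(1)] add_zero[OF arr_comp[OF qa w(1)]] by simp
  also have "\<dots> = z \<cdot> (e \<cdot> e')" using square_comp[OF y(2) qa y(1) z ea ea'] .
  finally have qw: "q (n + 1) \<cdot> w = z \<cdot> (e \<cdot> e')" .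
  have "q (n + 1) \<cdot> (w \<cdot> e'') = q (n + 1) \<cdot> (cdiff Y n \<cdot> y'')"
    using comp_add[OF qa fx'' dy''] we ses_zero[OF ses x''] zero_add[OF arr_comp[OF qa dy'']] by simp
  also have "\<dots> = cdiff Q n \<cdot> (q n \<cdot> y'')" using Ch_comm[OF q y''] .
  finally have "cdiff Q n \<cdot> (q n \<cdot> y'') = z \<cdot> ((e \<cdot> e') \<cdot> e'')"
    using square_comp[OF qw qa w(1) z arr_comp[OF ea ea'] ea''] by simp
  then show "\<exists>V e y. cover C e V W \<and> arr C y V (cob Q n) \<and> cdiff Q n \<cdot> y = z \<cdot> e"
    using cover_comp[OF cover_comp[OF e e'] e''] arr_comp[OF qa y''] by blast
qed

text \<open>If \<open>q y = d z\<close>, lift \<open>z\<close> to \<open>y'\<close>. Then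
  \<open>y - d y' = f k\<close> with \<open>k\<close> a cycle of the exact complex \<open>X\<close>,
  and \<open>k = d k'\<close> gives \<open>y = d (f k' + y')\<close>.\<close>

lemma inj_of_exact_kernel:
  assumes ex: "loc_exact C X"
  shows "cohomology_inj C Y Q q"
  unfolding cohomology_inj_def
proof (intro allI impI, elim conjE)
  fix n W y z
  assume y: "arr C y W (cob Y (n + 1))" and dy: "cdiff Y (n + 1) \<cdot> y = Zero C W (cob Y (n + 1 + 1))"
    and z: "arr C z W (cob Q n)" and qyz: "q (n + 1) \<cdot> y = cdiff Q n \<cdot> z"
  obtain V e y' where e: "cover C e V W" and y': "arr C y' V (cob Y n)" "q n \<cdot> y' = z \<cdot> e"
    using ses_coverE[OF ses z] .
  note ea = cover_arr[OF e]
  have ye: "arr C (y \<cdot> e) V (cob Y (n + 1))" and dy': "arr C (cdiff Y n \<cdot> y') V (cob Y (n + 1))"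
    using y ea dY y'(1) arr_comp by blast+
  have "q (n + 1) \<cdot> (y \<cdot> e) = q (n + 1) \<cdot> (cdiff Y n \<cdot> y')"
    using square_comp[OF qyz qa y dQ z ea] Ch_comm[OF q y'(1)] y'(2) by simp
  then obtain k where k: "arr C k V (cob X (n + 1))" "y \<cdot> e = (f (n + 1) \<cdot> k) \<boxplus> (cdiff Y n \<cdot> y')"
    using ses_diffE[OF ses ye dy'] by blast
  have fk: "arr C (f (n + 1) \<cdot> k) V (cob Y (n + 1))" using fa k(1) arr_comp by blast
  have "f (n + 1 + 1) \<cdot> (cdiff X (n + 1) \<cdot> k) = cdiff Y (n + 1) \<cdot> (y \<cdot> e)"
    using comp_add[OF dY fk dy'] k(2) Ch_dd[OF Y y'(1)] add_zero[OF arr_comp[OF dY fk]] Ch_comm[OF f k(1)] by simp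
  also have "\<dots> = Zero C V (cob Y (n + 1 + 1))" using zero_comp_comp[OF dy dY y ea] .
  finally have "cdiff X (n + 1) \<cdot> k = Zero C V (cob X (n + 1 + 1))"
    using ses_mono_zero[OF ses arr_comp[OF dX k(1)]] by simp
  then obtain V' e' k' where e': "cover C e' V' V" and k': "arr C k' V' (cob X n)" "cdiff X n \<cdot> k' = k \<cdot> e'"
    using loc_exactE[OF ex k(1)] by blast
  note ea' = cover_arr[OF e']
  have fk': "arr C (f n \<cdot> k') V' (cob Y n)" and ye': "arr C (y' \<cdot> e') V' (cob Y n)"
    using fa k'(1) y'(1) ea' arr_comp by blast+
  have "y \<cdot> (e \<cdot> e') = ((f (n + 1) \<cdot> k) \<boxplus> (cdiff Y n \<cdot> y')) \<cdot> e'" using assoc[OF y ea ea'] k(2) by simp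
  also have "\<dots> = (f (n + 1) \<cdot> (k \<cdot> e')) \<boxplus> (cdiff Y n \<cdot> (y' \<cdot> e'))"
    using add_comp[OF fk dy' ea'] assoc[OF fa k(1) ea'] assoc[OF dY y'(1) ea'] by simp
  also have "\<dots> = cdiff Y n \<cdot> ((f n \<cdot> k') \<boxplus> (y' \<cdot> e'))"
    using comp_add[OF dY fk' ye'] Ch_comm[OF f k'(1)] k'(2) by simp
  finally show "\<exists>V e x'. cover C e V W \<and> arr C x' V (cob Y n) \<and> cdiff Y n \<cdot> x' = y \<cdot> e"
    using cover_comp[OF e e'] arr_plus[OF fk' ye'] by metis
qed

text \<open>A lift \<open>y\<close> of the cycle \<open>z\<close> has \<open>d y = f k\<close> with
  \<open>k\<close> a cycle, hence \<open>k = d k'\<close>; subtracting \<open>f k'\<close> makes the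
  lift a cycle without changing its image.\<close>

lemma surj_of_exact_kernel:
  assumes ex: "loc_exact C X"
  shows "cohomology_surj C Y Q q"
  unfolding cohomology_surj_def
proof (intro allI impI, elim conjE)
  fix n W z
  assume z: "arr C z W (cob Q (n + 1))" and dz: "cdiff Q (n + 1) \<cdot> z = Zero C W (cob Q (n + 1 + 1))"
  obtain V e y where e: "cover C e V W" and y: "arr C y V (cob Y (n + 1))" "q (n + 1) \<cdot> y = z \<cdot> e"
    using ses_coverE[OF ses z] .
  note ea = cover_arr[OF e]
  have dy: "arr C (cdiff Y (n + 1) \<cdot> y) V (cob Y (n + 1 + 1))" using dY y(1) arr_comp by blast
  have "q (n + 1 + 1) \<cdot> (cdiff Y (n + 1) \<cdot> y) = Zero C V (cob Q (n + 1 + 1))"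
    using Ch_comm[OF q y(1)] y(2) zero_comp_comp[OF dz dQ z ea] by simp
  then obtain k where k: "arr C k V (cob X (n + 1 + 1))" "f (n + 1 + 1) \<cdot> k = cdiff Y (n + 1) \<cdot> y"
    using ses_liftE[OF ses dy] by blast
  have "f (n + 1 + 1 + 1) \<cdot> (cdiff X (n + 1 + 1) \<cdot> k) = Zero C V (cob Y (n + 1 + 1 + 1))"
    using Ch_comm[OF f k(1)] k(2) Ch_dd[OF Y y(1)] by simp
  then have "cdiff X (n + 1 + 1) \<cdot> k = Zero C V (cob X (n + 1 + 1 + 1))"
    using ses_mono_zero[OF ses arr_comp[OF dX k(1)]] by simp
  then obtain V' e' k' where e': "cover C e' V' V" and k': "arr C k' V' (cob X (n + 1))" "cdiff X (n + 1) \<cdot> k' = k \<cdot> e'"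
    using loc_exactE[OF ex k(1)] by blast
  note ea' = cover_arr[OF e']
  have V': "V' \<in> Obj C" using ea' by (simp add: arr_def)
  have ye: "arr C (y \<cdot> e') V' (cob Y (n + 1))" and fk': "arr C (f (n + 1) \<cdot> k') V' (cob Y (n + 1))"
    using y(1) ea' fa k'(1) arr_comp by blast+
  obtain w where w: "arr C w V' (cob Y (n + 1))" "y \<cdot> e' = w \<boxplus> (f (n + 1) \<cdot> k')" using ex_diff[OF ye fk'] by blast
  have "cdiff Y (n + 1) \<cdot> (y \<cdot> e') = cdiff Y (n + 1) \<cdot> (f (n + 1) \<cdot> k')"
    using square_comp[OF k(2) fa k(1) dY y(1) ea'] Ch_comm[OF f k'(1)] k'(2) by simp
  then have "(cdiff Y (n + 1) \<cdot> w) \<boxplus> (cdiff Y (n + 1) \<cdot> (f (n + 1) \<cdot> k')) = cdiff Y (n + 1) \<cdot> (f (n + 1) \<cdot> k')"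
    using comp_add[OF dY w(1) fk'] w(2) by simp
  then have dw: "cdiff Y (n + 1) \<cdot> w = Zero C V' (cob Y (n + 1 + 1))"
    using add_eq_self[OF arr_comp[OF dY w(1)] arr_comp[OF dY fk']] by simp
  have "q (n + 1) \<cdot> w = q (n + 1) \<cdot> (y \<cdot> e')"
    using comp_add[OF qa w(1) fk'] w(2) ses_zero[OF ses k'(1)] add_zero[OF arr_comp[OF qa w(1)]] by simp
  also have "\<dots> = z \<cdot> (e \<cdot> e')" using square_comp[OF y(2) qa y(1) z ea ea'] .
  \<comment> \<open>After the covers the image of \<open>w\<close> equals \<open>z\<close>, so zero
    serves as the boundary correction.\<close>
  finally have "z \<cdot> (e \<cdot> e') = (q (n + 1) \<cdot> w) \<boxplus> (cdiff Q n \<cdot> Zero C V' (cob Q n))"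
    using comp_zero[OF dQ V'] add_zero[OF arr_comp[OF qa w(1)]] by simp
  then show "\<exists>V e x y'. cover C e V W \<and> arr C x V (cob Y (n + 1)) \<and>
       cdiff Y (n + 1) \<cdot> x = Zero C V (cob Y (n + 1 + 1)) \<and> arr C y' V (cob Q n) \<and>
       z \<cdot> e = (q (n + 1) \<cdot> x) \<boxplus> (cdiff Q n \<cdot> y')"
    using cover_comp[OF e e'] w(1) dw arr_zero[OF V' obQ] by blast
qed

text \<open>For a cycle \<open>k\<close> of \<open>X\<close> the element \<open>f k\<close> is
  killed by \<open>q\<close>, so injectivity gives \<open>f k = d y\<close>. Surjectivity, one
  degree lower, writes \<open>q y = q w + d z\<close> with \<open>w\<close> a cycle. If
  \<open>y''\<close> lifts \<open>z\<close>, then \<open>y - w - d y''\<close> comes from some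
  \<open>k'\<close>, and \<open>d k' = k\<close>.\<close>

lemma exact_kernel:
  assumes inj: "cohomology_inj C Y Q q" and surj: "cohomology_surj C Y Q q"
  shows "loc_exact C X"
  unfolding loc_exact_def
proof (intro allI impI, elim conjE)
  fix n W k
  assume k: "arr C k W (cob X (n + 1))" and dk: "cdiff X (n + 1) \<cdot> k = Zero C W (cob X (n + 1 + 1))"
  have W: "W \<in> Obj C" using k by (simp add: arr_def)
  obtain m where n: "n = m + 1" by (metis diff_add_cancel)
  have fk: "arr C (f (n + 1) \<cdot> k) W (cob Y (n + 1))" using fa k arr_comp by blast
  have dfk: "cdiff Y (n + 1) \<cdot> (f (n + 1) \<cdot> k) = Zero C W (cob Y (n + 1 + 1))"
    using Ch_comm[OF f k] dk comp_zero[OF fa W] by simp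
  have "q (n + 1) \<cdot> (f (n + 1) \<cdot> k) = cdiff Q n \<cdot> Zero C W (cob Q n)"
    using ses_zero[OF ses k] comp_zero[OF dQ W] by simp
  then obtain V e y where e: "cover C e V W" and y: "arr C y V (cob Y n)" "cdiff Y n \<cdot> y = (f (n + 1) \<cdot> k) \<cdot> e"
    using cohomology_injE[OF inj fk dfk arr_zero[OF W obQ]] by blast
  note ea = cover_arr[OF e]
  have qy: "arr C (q n \<cdot> y) V (cob Q n)" using qa y(1) arr_comp by blast
  have ke: "arr C (k \<cdot> e) V (cob X (n + 1))" using k ea arr_comp by blast
  have dy: "cdiff Y n \<cdot> y = f (n + 1) \<cdot> (k \<cdot> e)" using y(2) assoc[OF fa k ea] by simp
  have dqy: "cdiff Q n \<cdot> (q n \<cdot> y) = Zero C V (cob Q (n + 1))"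
    using Ch_comm[OF q y(1)] dy ses_zero[OF ses ke] by simp
  obtain V' e' w z where e': "cover C e' V' V" and w: "arr C w V' (cob Y n)"
    and dw: "cdiff Y n \<cdot> w = Zero C V' (cob Y (n + 1))" and z: "arr C z V' (cob Q m)"
    and qye: "(q n \<cdot> y) \<cdot> e' = (q n \<cdot> w) \<boxplus> (cdiff Q m \<cdot> z)"
    unfolding n by (rule cohomology_surjE[OF surj qy[unfolded n] dqy[unfolded n]])
  obtain V'' e'' y'' where e'': "cover C e'' V'' V'" and y'': "arr C y'' V'' (cob Y m)" "q m \<cdot> y'' = z \<cdot> e''"
    using ses_coverE[OF ses z] .
  note ea' = cover_arr[OF e'] and ea'' = cover_arr[OF e'']
  have E: "arr C (e' \<cdot> e'') V'' V" using ea' ea'' arr_comp by blast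
  have yE: "arr C (y \<cdot> (e' \<cdot> e'')) V'' (cob Y n)" using y(1) E arr_comp by blast
  have we: "arr C (w \<cdot> e'') V'' (cob Y n)" using w ea'' arr_comp by blast
  have dy'': "arr C (cdiff Y m \<cdot> y'') V'' (cob Y n)" using dY y''(1) arr_comp n by blast
  have qw: "arr C (q n \<cdot> w) V' (cob Q n)" and dz: "arr C (cdiff Q m \<cdot> z) V' (cob Q n)"
    using qa w dQ z arr_comp n by blast+
  have dQm: "arr C (cdiff Q m) (cob Q m) (cob Q n)" using dQ n by blast
  have "q n \<cdot> (y \<cdot> (e' \<cdot> e'')) = ((q n \<cdot> y) \<cdot> e') \<cdot> e''"
    using assoc[OF qa y(1) E] assoc[OF qy ea' ea''] by simp
  also have "\<dots> = (q n \<cdot> (w \<cdot> e'')) \<boxplus> (cdiff Q m \<cdot> (z \<cdot> e''))"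
    using qye add_comp[OF qw dz ea''] assoc[OF qa w ea''] assoc[OF dQm z ea''] by simp
  also have "\<dots> = q n \<cdot> ((w \<cdot> e'') \<boxplus> (cdiff Y m \<cdot> y''))"
    using comp_add[OF qa we dy''] Ch_comm[OF q y''(1)] y''(2) n by simp
  finally have qeq: "q n \<cdot> (y \<cdot> (e' \<cdot> e'')) = q n \<cdot> ((w \<cdot> e'') \<boxplus> (cdiff Y m \<cdot> y''))" .
  obtain k' where k': "arr C k' V'' (cob X n)"
    "y \<cdot> (e' \<cdot> e'') = (f n \<cdot> k') \<boxplus> ((w \<cdot> e'') \<boxplus> (cdiff Y m \<cdot> y''))"
    using ses_diffE[OF ses yE arr_plus[OF we dy''] qeq] .
  have fk': "arr C (f n \<cdot> k') V'' (cob Y n)" using fa k'(1) arr_comp by blast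
  have "cdiff Y n \<cdot> ((w \<cdot> e'') \<boxplus> (cdiff Y m \<cdot> y'')) = Zero C V'' (cob Y (n + 1))"
    using comp_add[OF dY we dy''] zero_comp_comp[OF dw dY w ea''] Ch_dd[OF Y y''(1)] n
      add_zero[OF arr_zero[OF arrD(1)[OF ea''] obY]] by simp
  then have "cdiff Y n \<cdot> (y \<cdot> (e' \<cdot> e'')) = f (n + 1) \<cdot> (cdiff X n \<cdot> k')"
    using comp_add[OF dY fk' arr_plus[OF we dy'']] k'(2) add_zero[OF arr_comp[OF dY fk']] Ch_comm[OF f k'(1)] by simp
  moreover have "cdiff Y n \<cdot> (y \<cdot> (e' \<cdot> e'')) = f (n + 1) \<cdot> (k \<cdot> (e \<cdot> (e' \<cdot> e'')))"
    using square_comp[OF dy dY y(1) fa ke E] assoc[OF k ea E] by simp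
  ultimately have "cdiff X n \<cdot> k' = k \<cdot> (e \<cdot> (e' \<cdot> e''))"
    using ses_mono[OF ses arr_comp[OF dX k'(1)] arr_comp[OF k arr_comp[OF ea E]]] by simp
  then show "\<exists>V e y. cover C e V W \<and> arr C y V (cob X n) \<and> cdiff X n \<cdot> y = k \<cdot> e"
    using cover_comp[OF e cover_comp[OF e' e'']] k'(1) by blast
qed

end

section \<open>Cohomology in terms of generalised elements\<close>

context abelian_category
begin

lemma zero_obj_iff:
  assumes "H \<in> Obj C"
  shows "is_zero_obj C H \<longleftrightarrow> Ident C H = Zero C H H"
proof
  assume "is_zero_obj C H"
  then show "Ident C H = Zero C H H"
    using ident_hom[OF assms] zero_hom[OF assms assms] assms unfolding is_zero_obj_def by blast
next
  assume id0: "Ident C H = Zero C H H"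
  have "g = Zero C W H" if "arr C g W H" for g W
    using id_left[OF that] zero_comp[OF that assms] id0 by simp
  moreover have "g = Zero C H W" if "arr C g H W" for g W
    using id_right[OF that] comp_zero[OF that assms] id0 by simp
  ultimately show "is_zero_obj C H"
    using assms zero_hom unfolding is_zero_obj_def arr_def by metis
qed

lemma cohomologyE:
  assumes X: "X \<in> Obj (Ch C)" and H: "is_cohomology C X (n + 1) Z i H p"
  obtains e where "arr C i Z (cob X (n + 1))"
    "is_kernel C (cob X (n + 1)) (cob X (n + 1 + 1)) (cdiff X (n + 1)) Z i"
    "arr C e (cob X n) Z" "i \<cdot> e = cdiff X n" "is_cokernel C (cob X n) Z e H p" "cover C p Z H"
proof -
  note D = Ch_objD[OF X]
  have k: "is_kernel C (cob X (n + 1)) (cob X (n + 1 + 1)) (cdiff X (n + 1)) Z i"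
    using H by (simp add: is_cohomology_def is_cycles_def)
  note K = kernelD[OF k D(2)]
  obtain e where e: "e \<in> Hom C (cob X n) Z" "i \<cdot> e = cdiff X n" "is_cokernel C (cob X n) Z e H p"
    using H by (auto simp: is_cohomology_def)
  have ea: "arr C e (cob X n) Z" using e(1) K(1) D(1) by (simp add: arr_def)
  show thesis using that[OF K(1) k ea e(2,3) cover_cokernel[OF e(3) ea]] .
qed

lemma cohomology_exists:
  assumes X: "X \<in> Obj (Ch C)"
  obtains Z i H p where "is_cohomology C X (n + 1) Z i H p"
proof -
  note D = Ch_objD[OF X]
  obtain Z i where k: "is_kernel C (cob X (n + 1)) (cob X (n + 1 + 1)) (cdiff X (n + 1)) Z i"
    using ex_kernel[OF D(1) D(1) arrD(3)[OF D(2)]] by blast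
  note K = kernelD[OF k D(2)]
  obtain e where e: "arr C e (cob X n) Z" "i \<cdot> e = cdiff X n" using K(3)[OF D(2,3)] by blast
  obtain H p where "is_cokernel C (cob X n) Z e H p" using ex_cokernel[OF arrD[OF e(1)]] by blast
  then have "is_cohomology C X (n + 1) Z i H p"
    using k e by (auto simp: is_cohomology_def is_cycles_def arr_def)
  then show thesis by (rule that)
qed

text \<open>\<open>Ac\<close> quantifies over all choices of cycles and cohomology. For local
  exactness one choice is made; conversely an arbitrary choice is shown to vanish.\<close>

lemma Ac_iff: "X \<in> Ac C \<longleftrightarrow> X \<in> Obj (Ch C) \<and> loc_exact C X"
proof (cases "X \<in> Obj (Ch C)")
  case X: True
  note D = Ch_objD[OF X]
  show ?thesis
  proof (intro iffI conjI X)
    assume ac: "X \<in> Ac C"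
    show "loc_exact C X" unfolding loc_exact_def
    proof (intro allI impI, elim conjE)
      fix n W x
      assume x: "arr C x W (cob X (n + 1))" "cdiff X (n + 1) \<cdot> x = Zero C W (cob X (n + 1 + 1))"
      have W: "W \<in> Obj C" using x(1) by (simp add: arr_def)
      obtain Z i H p where H: "is_cohomology C X (n + 1) Z i H p" using cohomology_exists[OF X] .
      obtain e where i: "arr C i Z (cob X (n + 1))"
        "is_kernel C (cob X (n + 1)) (cob X (n + 1 + 1)) (cdiff X (n + 1)) Z i"
        and e: "arr C e (cob X n) Z" "i \<cdot> e = cdiff X n" "is_cokernel C (cob X n) Z e H p" and p: "cover C p Z H"
        using cohomologyE[OF X H] .
      obtain z where z: "arr C z W Z" "i \<cdot> z = x" using kernelD(3)[OF i(2) D(2) x] by blast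
      have pa: "arr C p Z H" using cover_arr[OF p] .
      have Ho: "H \<in> Obj C" using pa by (simp add: arr_def)
      have "is_zero_obj C H" using ac H unfolding Ac_def by blast
      then have "p \<cdot> z = Zero C W H"
        using id_left[OF arr_comp[OF pa z(1)]] zero_comp[OF arr_comp[OF pa z(1)] Ho] zero_obj_iff[OF Ho] by simp
      then obtain V c y where c: "cover C c V W" "arr C y V (cob X n)" "e \<cdot> y = z \<cdot> c"
        using cokernel_exact[OF e(3,1) z(1)] by blast
      have "cdiff X n \<cdot> y = x \<cdot> c"
        using assoc[OF i(1) e(1) c(2)] assoc[OF i(1) z(1) cover_arr[OF c(1)]] e(2) z(2) c(3) by simp
      then show "\<exists>V e y. cover C e V W \<and> arr C y V (cob X n) \<and> cdiff X n \<cdot> y = x \<cdot> e" using c by blast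
    qed
  next
    assume "X \<in> Obj (Ch C) \<and> loc_exact C X"
    then have ex: "loc_exact C X" by simp
    have "is_zero_obj C H" if H: "is_cohomology C X (n + 1) Z i H p" for n Z i H p
    proof -
      obtain e where i: "arr C i Z (cob X (n + 1))"
        "is_kernel C (cob X (n + 1)) (cob X (n + 1 + 1)) (cdiff X (n + 1)) Z i"
        and e: "arr C e (cob X n) Z" "i \<cdot> e = cdiff X n" "is_cokernel C (cob X n) Z e H p" and p: "cover C p Z H"
        using cohomologyE[OF X H] .
      note pa = cover_arr[OF p]
      have Ho: "H \<in> Obj C" using pa by (simp add: arr_def)
      note K = kernelD[OF i(2) D(2)]
      \<comment> \<open>Exactness is applied to the universal cycle \<open>i\<close>. After a cover
        it bounds, so the projection \<open>p\<close> vanishes on a cover of \<open>Z\<close> and is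
        therefore zero.\<close>
      obtain V c y where c: "cover C c V Z" "arr C y V (cob X n)" "cdiff X n \<cdot> y = i \<cdot> c"
        using loc_exactE[OF ex i(1) K(2)] .
      note ca = cover_arr[OF c(1)]
      have "i \<cdot> (e \<cdot> y) = i \<cdot> c" using assoc[OF i(1) e(1) c(2)] e(2) c(3) by simp
      then have "e \<cdot> y = c" using K(4)[OF arr_comp[OF e(1) c(2)] ca] by simp
      then have "p \<cdot> c = Zero C V H" using zero_comp_comp[OF cokernelD(2)[OF e(3,1)] pa e(1) c(2)] by simp
      then have "p = Zero C Z H" using cover_zero[OF c(1) pa] by simp
      then have "Ident C H \<cdot> p = Zero C Z H" using id_left[OF pa] by simp
      then show ?thesis using cover_zero[OF p arr_id[OF Ho]] zero_obj_iff[OF Ho] by simp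
    qed
    then have "is_zero_obj C H" if "is_cohomology C X n Z i H p" for n Z i H p
      using that by (metis diff_add_cancel)
    then show "X \<in> Ac C" using X by (auto simp: Ac_def)
  qed
qed (simp add: Ac_def)

lemma quasi_iso_exact:
  assumes f: "arr (Ch C) f X Y" and qi: "f \<in> quasi_isos C X Y"
  shows "cohomology_inj C X Y f" "cohomology_surj C X Y f"
proof -
  note X = Ch_arrD(1)[OF f] and Y = Ch_arrD(2)[OF f]
  note D = Ch_objD[OF X] and E = Ch_objD[OF Y] and fa = Ch_arrD(3)[OF f]
  \<comment> \<open>\<open>quasi_isos\<close> only says that every induced map is invertible.
    Cohomology is chosen for both complexes and the induced maps \<open>z\<close> and
    \<open>h\<close> are constructed; \<open>g\<close> is the inverse of \<open>h\<close>.\<close>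
  have data: "\<exists>Z i e H p Z' i' e' H' p' z h g.
      arr C i Z (cob X (n + 1)) \<and> is_kernel C (cob X (n + 1)) (cob X (n + 1 + 1)) (cdiff X (n + 1)) Z i \<and>
      arr C e (cob X n) Z \<and> i \<cdot> e = cdiff X n \<and> is_cokernel C (cob X n) Z e H p \<and> cover C p Z H \<and>
      arr C i' Z' (cob Y (n + 1)) \<and> is_kernel C (cob Y (n + 1)) (cob Y (n + 1 + 1)) (cdiff Y (n + 1)) Z' i' \<and>
      arr C e' (cob Y n) Z' \<and> i' \<cdot> e' = cdiff Y n \<and> is_cokernel C (cob Y n) Z' e' H' p' \<and> cover C p' Z' H' \<and>
      arr C z Z Z' \<and> i' \<cdot> z = f (n + 1) \<cdot> i \<and> arr C h H H' \<and> h \<cdot> p = p' \<cdot> z \<and>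
      arr C g H' H \<and> g \<cdot> h = Ident C H \<and> h \<cdot> g = Ident C H'" for n
  proof -
    obtain Z i H p where H: "is_cohomology C X (n + 1) Z i H p" using cohomology_exists[OF X] .
    obtain e where i: "arr C i Z (cob X (n + 1))"
      "is_kernel C (cob X (n + 1)) (cob X (n + 1 + 1)) (cdiff X (n + 1)) Z i"
      and e: "arr C e (cob X n) Z" "i \<cdot> e = cdiff X n" "is_cokernel C (cob X n) Z e H p" and p: "cover C p Z H"
      using cohomologyE[OF X H] .
    obtain Z' i' H' p' where H': "is_cohomology C Y (n + 1) Z' i' H' p'" using cohomology_exists[OF Y] .
    obtain e' where i': "arr C i' Z' (cob Y (n + 1))"
      "is_kernel C (cob Y (n + 1)) (cob Y (n + 1 + 1)) (cdiff Y (n + 1)) Z' i'"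
      and e': "arr C e' (cob Y n) Z'" "i' \<cdot> e' = cdiff Y n" "is_cokernel C (cob Y n) Z' e' H' p'" and p': "cover C p' Z' H'"
      using cohomologyE[OF Y H'] .
    have Zo: "Z \<in> Obj C" using i(1) by (simp add: arr_def)
    note K = kernelD[OF i(2) D(2)] and K' = kernelD[OF i'(2) E(2)]
    note pa = cover_arr[OF p] and pa' = cover_arr[OF p']
    have "cdiff Y (n + 1) \<cdot> (f (n + 1) \<cdot> i) = Zero C Z (cob Y (n + 1 + 1))"
      using Ch_comm[OF f i(1)] K(2) comp_zero[OF fa Zo] by simp
    then obtain z where z: "arr C z Z Z'" "i' \<cdot> z = f (n + 1) \<cdot> i" using K'(3)[OF arr_comp[OF fa i(1)]] by blast
    have "i' \<cdot> (z \<cdot> e) = i' \<cdot> (e' \<cdot> f n)"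
      using square_comp[OF z(2) i'(1) z(1) fa i(1) e(1)] e(2) Ch_arrD(4)[OF f] assoc[OF i'(1) e'(1) fa] e'(2) by simp
    then have ze: "z \<cdot> e = e' \<cdot> f n" using K'(4)[OF arr_comp[OF z(1) e(1)] arr_comp[OF e'(1) fa]] by simp
    have "(p' \<cdot> z) \<cdot> e = Zero C (cob X n) H'"
      using assoc[OF pa' z(1) e(1)] ze zero_comp_comp[OF cokernelD(2)[OF e'(3,1)] pa' e'(1) fa] by simp
    then obtain h where h: "arr C h H H'" "h \<cdot> p = p' \<cdot> z"
      using cokernelD(3)[OF e(3,1) arr_comp[OF pa' z(1)]] by blast
    have "is_iso C H H' h" using qi H H' z h unfolding quasi_isos_def arr_def by blast
    then obtain g where "arr C g H' H" "g \<cdot> h = Ident C H" "h \<cdot> g = Ident C H'"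
      using h(1) by (auto simp: is_iso_def arr_def)
    then show ?thesis using i e p i' e' p' z h by blast
  qed
  show "cohomology_inj C X Y f" unfolding cohomology_inj_def
  proof (intro allI impI, elim conjE)
    fix n W x y
    assume x: "arr C x W (cob X (n + 1))" "cdiff X (n + 1) \<cdot> x = Zero C W (cob X (n + 1 + 1))"
      and y: "arr C y W (cob Y n)" and fxy: "f (n + 1) \<cdot> x = cdiff Y n \<cdot> y"
    have W: "W \<in> Obj C" using x(1) by (simp add: arr_def)
    obtain Z i e H p Z' i' e' H' p' z h g where
      i: "arr C i Z (cob X (n + 1))" "is_kernel C (cob X (n + 1)) (cob X (n + 1 + 1)) (cdiff X (n + 1)) Z i"
      and e: "arr C e (cob X n) Z" "i \<cdot> e = cdiff X n" "is_cokernel C (cob X n) Z e H p" and p: "cover C p Z H"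
      and i': "arr C i' Z' (cob Y (n + 1))" "is_kernel C (cob Y (n + 1)) (cob Y (n + 1 + 1)) (cdiff Y (n + 1)) Z' i'"
      and e': "arr C e' (cob Y n) Z'" "i' \<cdot> e' = cdiff Y n" "is_cokernel C (cob Y n) Z' e' H' p'" and p': "cover C p' Z' H'"
      and z: "arr C z Z Z'" "i' \<cdot> z = f (n + 1) \<cdot> i" and h: "arr C h H H'" "h \<cdot> p = p' \<cdot> z"
      and g: "arr C g H' H" "g \<cdot> h = Ident C H" "h \<cdot> g = Ident C H'"
      using data[of n] by blast
    note K = kernelD[OF i(2) D(2)] and K' = kernelD[OF i'(2) E(2)]
    note pa = cover_arr[OF p] and pa' = cover_arr[OF p']
    obtain c where c: "arr C c W Z" "i \<cdot> c = x" using K(3)[OF x] by blast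
    have "i' \<cdot> (z \<cdot> c) = i' \<cdot> (e' \<cdot> y)"
      using square_comp[OF z(2) i'(1) z(1) fa i(1) c(1)] c(2) fxy assoc[OF i'(1) e'(1) y] e'(2) by simp
    then have "z \<cdot> c = e' \<cdot> y" using K'(4)[OF arr_comp[OF z(1) c(1)] arr_comp[OF e'(1) y]] by simp
    then have "h \<cdot> (p \<cdot> c) = Zero C W H'"
      using square_comp[OF h(2) h(1) pa pa' z(1) c(1)] zero_comp_comp[OF cokernelD(2)[OF e'(3,1)] pa' e'(1) y] by simp
    then have "p \<cdot> c = Zero C W H"
      using assoc[OF g(1) h(1) arr_comp[OF pa c(1)]] g(2) id_left[OF arr_comp[OF pa c(1)]] comp_zero[OF g(1) W] by simp
    then obtain V d x' where d: "cover C d V W" "arr C x' V (cob X n)" "e \<cdot> x' = c \<cdot> d"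
      using cokernel_exact[OF e(3,1) c(1)] by blast
    have "cdiff X n \<cdot> x' = x \<cdot> d"
      using assoc[OF i(1) e(1) d(2)] assoc[OF i(1) c(1) cover_arr[OF d(1)]] e(2) c(2) d(3) by simp
    then show "\<exists>V e x'. cover C e V W \<and> arr C x' V (cob X n) \<and> cdiff X n \<cdot> x' = x \<cdot> e" using d by blast
  qed
  show "cohomology_surj C X Y f" unfolding cohomology_surj_def
  proof (intro allI impI, elim conjE)
    fix n W y
    assume y: "arr C y W (cob Y (n + 1))" "cdiff Y (n + 1) \<cdot> y = Zero C W (cob Y (n + 1 + 1))"
    obtain Z i e H p Z' i' e' H' p' z h g where
      i: "arr C i Z (cob X (n + 1))" "is_kernel C (cob X (n + 1)) (cob X (n + 1 + 1)) (cdiff X (n + 1)) Z i"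
      and e: "arr C e (cob X n) Z" "i \<cdot> e = cdiff X n" "is_cokernel C (cob X n) Z e H p" and p: "cover C p Z H"
      and i': "arr C i' Z' (cob Y (n + 1))" "is_kernel C (cob Y (n + 1)) (cob Y (n + 1 + 1)) (cdiff Y (n + 1)) Z' i'"
      and e': "arr C e' (cob Y n) Z'" "i' \<cdot> e' = cdiff Y n" "is_cokernel C (cob Y n) Z' e' H' p'" and p': "cover C p' Z' H'"
      and z: "arr C z Z Z'" "i' \<cdot> z = f (n + 1) \<cdot> i" and h: "arr C h H H'" "h \<cdot> p = p' \<cdot> z"
      and g: "arr C g H' H" "g \<cdot> h = Ident C H" "h \<cdot> g = Ident C H'"
      using data[of n] by blast
    note K = kernelD[OF i(2) D(2)] and K' = kernelD[OF i'(2) E(2)]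
    note pa = cover_arr[OF p] and pa' = cover_arr[OF p']
    obtain c where c: "arr C c W Z'" "i' \<cdot> c = y" using K'(3)[OF y] by blast
    have pc: "arr C (p' \<cdot> c) W H'" using pa' c(1) arr_comp by blast
    \<comment> \<open>The class of \<open>y\<close> is \<open>p' \<cdot> c\<close>. Its preimage
      under \<open>h\<close> is represented by a cycle \<open>x\<close> after the cover
      \<open>d\<close>, so \<open>c \<cdot> d\<close> and \<open>z \<cdot> x\<close> have the same
      class and differ by a boundary after another cover.\<close>
    obtain V d x where d: "cover C d V W" and x: "arr C x V Z" "p \<cdot> x = (g \<cdot> (p' \<cdot> c)) \<cdot> d"
      using cover_lift[OF p arr_comp[OF g(1) pc]] .
    note da = cover_arr[OF d]
    have Vo: "V \<in> Obj C" using da by (simp add: arr_def)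
    have cd: "arr C (c \<cdot> d) V Z'" and zx: "arr C (z \<cdot> x) V Z'" using c(1) da z(1) x(1) arr_comp by blast+
    obtain r where r: "arr C r V Z'" "c \<cdot> d = r \<boxplus> (z \<cdot> x)" using ex_diff[OF cd zx] by blast
    have pcd: "arr C (p' \<cdot> (c \<cdot> d)) V H'" using pa' cd arr_comp by blast
    have "p' \<cdot> (z \<cdot> x) = h \<cdot> (p \<cdot> x)" using square_comp[OF h(2) h(1) pa pa' z(1) x(1)] by simp
    also have "p \<cdot> x = g \<cdot> (p' \<cdot> (c \<cdot> d))" using x(2) assoc[OF g(1) pc da] assoc[OF pa' c(1) da] by simp
    also have "h \<cdot> (g \<cdot> (p' \<cdot> (c \<cdot> d))) = p' \<cdot> (c \<cdot> d)"
      using assoc[OF h(1) g(1) pcd] g(3) id_left[OF pcd] by simp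
    finally have "(p' \<cdot> r) \<boxplus> (p' \<cdot> (z \<cdot> x)) = p' \<cdot> (z \<cdot> x)" using comp_add[OF pa' r(1) zx] r(2) by simp
    then have "p' \<cdot> r = Zero C V H'" using add_eq_self[OF arr_comp[OF pa' r(1)] arr_comp[OF pa' zx]] by simp
    then obtain V' d' y' where d': "cover C d' V' V" and y': "arr C y' V' (cob Y n)" "e' \<cdot> y' = r \<cdot> d'"
      using cokernel_exact[OF e'(3,1) r(1)] by blast
    note da' = cover_arr[OF d']
    have xd: "arr C (x \<cdot> d') V' Z" using x(1) da' arr_comp by blast
    have ix: "arr C (i \<cdot> (x \<cdot> d')) V' (cob X (n + 1))" using i(1) xd arr_comp by blast
    have "y \<cdot> (d \<cdot> d') = i' \<cdot> ((c \<cdot> d) \<cdot> d')"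
      using assoc[OF i'(1) c(1) arr_comp[OF da da']] c(2) assoc[OF c(1) da da'] by simp
    also have "(c \<cdot> d) \<cdot> d' = (e' \<cdot> y') \<boxplus> (z \<cdot> (x \<cdot> d'))"
      using r(2) add_comp[OF r(1) zx da'] y'(2) assoc[OF z(1) x(1) da'] by simp
    also have "i' \<cdot> \<dots> = (cdiff Y n \<cdot> y') \<boxplus> (f (n + 1) \<cdot> (i \<cdot> (x \<cdot> d')))"
      using comp_add[OF i'(1) arr_comp[OF e'(1) y'(1)] arr_comp[OF z(1) xd]] assoc[OF i'(1) e'(1) y'(1)] e'(2)
        square_comp[OF z(2) i'(1) z(1) fa i(1) xd] by simp
    also have "\<dots> = (f (n + 1) \<cdot> (i \<cdot> (x \<cdot> d'))) \<boxplus> (cdiff Y n \<cdot> y')"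
      using add_commute[OF arr_comp[OF E(2) y'(1)] arr_comp[OF fa ix]] .
    finally show "\<exists>V e x y'. cover C e V W \<and> arr C x V (cob X (n + 1)) \<and>
       cdiff X (n + 1) \<cdot> x = Zero C V (cob X (n + 1 + 1)) \<and> arr C y' V (cob Y n) \<and>
       y \<cdot> e = (f (n + 1) \<cdot> x) \<boxplus> (cdiff Y n \<cdot> y')"
      using cover_comp[OF d d'] ix zero_comp_comp[OF K(2) D(2) i(1) xd] y'(1) by blast
  qed
qed

text \<open>Any induced map \<open>h\<close> is monic by injectivity and epic by surjectivity, and
  an abelian category is balanced.\<close>

lemma quasi_isoI:
  assumes f: "arr (Ch C) f X Y" and inj: "cohomology_inj C X Y f" and surj: "cohomology_surj C X Y f"
  shows "f \<in> quasi_isos C X Y"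
proof -
  note X = Ch_arrD(1)[OF f] and Y = Ch_arrD(2)[OF f]
  note D = Ch_objD[OF X] and E = Ch_objD[OF Y] and fa = Ch_arrD(3)[OF f]
  have main: "is_iso C H H' h" if H: "is_cohomology C X (n + 1) Z i H p" and H': "is_cohomology C Y (n + 1) Z' i' H' p'"
    and "z \<in> Hom C Z Z'" and z2: "i' \<cdot> z = f (n + 1) \<cdot> i" and "h \<in> Hom C H H'" and h2: "h \<cdot> p = p' \<cdot> z"
    for n Z i H p Z' i' H' p' z h
  proof -
    obtain e where i: "arr C i Z (cob X (n + 1))"
      "is_kernel C (cob X (n + 1)) (cob X (n + 1 + 1)) (cdiff X (n + 1)) Z i"
      and e: "arr C e (cob X n) Z" "i \<cdot> e = cdiff X n" "is_cokernel C (cob X n) Z e H p" and p: "cover C p Z H"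
      using cohomologyE[OF X H] .
    obtain e' where i': "arr C i' Z' (cob Y (n + 1))"
      "is_kernel C (cob Y (n + 1)) (cob Y (n + 1 + 1)) (cdiff Y (n + 1)) Z' i'"
      and e': "arr C e' (cob Y n) Z'" "i' \<cdot> e' = cdiff Y n" "is_cokernel C (cob Y n) Z' e' H' p'" and p': "cover C p' Z' H'"
      using cohomologyE[OF Y H'] .
    note K = kernelD[OF i(2) D(2)] and K' = kernelD[OF i'(2) E(2)]
    note pa = cover_arr[OF p] and pa' = cover_arr[OF p']
    have z: "arr C z Z Z'" and h: "arr C h H H'" using that(3,5) i(1) i'(1) pa pa' by (auto simp: arr_def)
    \<comment> \<open>Represent the class \<open>u\<close> by a cycle \<open>w\<close>. As
      \<open>h \<cdot> u = 0\<close>, the image of \<open>w\<close> bounds, so \<open>w\<close>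
      bounds by injectivity. Each of the three passages costs a cover.\<close>
    have h0: "u = Zero C W H" if u: "arr C u W H" "h \<cdot> u = Zero C W H'" for u W
    proof -
      obtain V c w where c: "cover C c V W" and w: "arr C w V Z" "p \<cdot> w = u \<cdot> c" using cover_lift[OF p u(1)] .
      note ca = cover_arr[OF c]
      have "p' \<cdot> (z \<cdot> w) = h \<cdot> (u \<cdot> c)" using square_comp[OF h2 h pa pa' z w(1)] w(2) by simp
      also have "\<dots> = Zero C V H'" using zero_comp_comp[OF u(2) h u(1) ca] .
      finally obtain V' c' y where c': "cover C c' V' V" and y: "arr C y V' (cob Y n)" "e' \<cdot> y = (z \<cdot> w) \<cdot> c'"
        using cokernel_exact[OF e'(3,1) arr_comp[OF z w(1)]] by blast
      note ca' = cover_arr[OF c']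
      have wc: "arr C (w \<cdot> c') V' Z" using w(1) ca' arr_comp by blast
      have "f (n + 1) \<cdot> (i \<cdot> (w \<cdot> c')) = i' \<cdot> (z \<cdot> (w \<cdot> c'))" using square_comp[OF z2 i'(1) z fa i(1) wc] by simp
      also have "\<dots> = cdiff Y n \<cdot> y" using y(2) assoc[OF z w(1) ca'] assoc[OF i'(1) e'(1) y(1)] e'(2) by simp
      finally have "f (n + 1) \<cdot> (i \<cdot> (w \<cdot> c')) = cdiff Y n \<cdot> y" .
      then obtain V'' c'' x where c'': "cover C c'' V'' V'" and x: "arr C x V'' (cob X n)"
        "cdiff X n \<cdot> x = (i \<cdot> (w \<cdot> c')) \<cdot> c''"
        by (rule cohomology_injE[OF inj arr_comp[OF i(1) wc] zero_comp_comp[OF K(2) D(2) i(1) wc] y(1)])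
      note ca'' = cover_arr[OF c'']
      have wcc: "arr C ((w \<cdot> c') \<cdot> c'') V'' Z" using wc ca'' arr_comp by blast
      have "i \<cdot> (e \<cdot> x) = i \<cdot> ((w \<cdot> c') \<cdot> c'')"
        using assoc[OF i(1) e(1) x(1)] e(2) x(2) assoc[OF i(1) wc ca''] by simp
      then have "e \<cdot> x = (w \<cdot> c') \<cdot> c''" using K(4)[OF arr_comp[OF e(1) x(1)] wcc] by simp
      then have "p \<cdot> ((w \<cdot> c') \<cdot> c'') = Zero C V'' H"
        using zero_comp_comp[OF cokernelD(2)[OF e(3,1)] pa e(1) x(1)] by simp
      then have "p \<cdot> (w \<cdot> (c' \<cdot> c'')) = Zero C V'' H" using assoc[OF w(1) ca' ca''] by simp
      then have "u \<cdot> (c \<cdot> (c' \<cdot> c'')) = Zero C V'' H"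
        using square_comp[OF w(2) pa w(1) u(1) ca arr_comp[OF ca' ca'']] by simp
      then show ?thesis using cover_zero[OF cover_comp[OF c cover_comp[OF c' c'']] u(1)] by simp
    qed
    \<comment> \<open>Surjectivity is applied to the universal cycle \<open>i'\<close>; it shows
      that \<open>p' \<cdot> c\<close>, a cover of \<open>H'\<close>, factors through
      \<open>h\<close>.\<close>
    obtain V c x y where c: "cover C c V Z'" and x: "arr C x V (cob X (n + 1))"
      "cdiff X (n + 1) \<cdot> x = Zero C V (cob X (n + 1 + 1))" and y: "arr C y V (cob Y n)"
      and ic: "i' \<cdot> c = (f (n + 1) \<cdot> x) \<boxplus> (cdiff Y n \<cdot> y)"
      using cohomology_surjE[OF surj i'(1) K'(2)] .
    note ca = cover_arr[OF c]
    obtain w where w: "arr C w V Z" "i \<cdot> w = x" using K(3)[OF x] by blast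
    have zw: "arr C (z \<cdot> w) V Z'" and ey: "arr C (e' \<cdot> y) V Z'" using z w(1) e'(1) y arr_comp by blast+
    have "i' \<cdot> c = i' \<cdot> ((z \<cdot> w) \<boxplus> (e' \<cdot> y))"
      using ic comp_add[OF i'(1) zw ey] square_comp[OF z2 i'(1) z fa i(1) w(1)] w(2) assoc[OF i'(1) e'(1) y] e'(2) by simp
    then have cz: "c = (z \<cdot> w) \<boxplus> (e' \<cdot> y)" using K'(4)[OF ca arr_plus[OF zw ey]] by simp
    have "p' \<cdot> c = h \<cdot> (p \<cdot> w)"
      using comp_add[OF pa' zw ey] cz zero_comp_comp[OF cokernelD(2)[OF e'(3,1)] pa' e'(1) y]
        add_zero[OF arr_comp[OF pa' zw]] square_comp[OF h2 h pa pa' z w(1)] by simp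
    then have "cover C h H H'" using cover_factor[OF _ h arr_comp[OF pa w(1)]] cover_comp[OF p' c] by simp
    then show ?thesis using iso_if_mono_cover[OF _ h0] h by (auto simp: is_iso_def arr_def)
  qed
  have "is_iso C H H' h" if "is_cohomology C X n Z i H p" "is_cohomology C Y n Z' i' H' p'"
    "z \<in> Hom C Z Z'" "i' \<cdot> z = f n \<cdot> i" "h \<in> Hom C H H'" "h \<cdot> p = p' \<cdot> z"
    for n Z i H p Z' i' H' p' z h
    using main[of "n - 1" Z i H p Z' i' H' p' z h] that by simp
  then show ?thesis using f unfolding quasi_isos_def arr_def by blast
qed

end

lemma (in ses_complexes) quasi_iso_mono_iff: "f \<in> quasi_isos C X Y \<longleftrightarrow> Q \<in> Ac C"
  using quasi_iso_exact[OF f] quasi_isoI[OF f] inj_of_exact_quotient surj_of_exact_quotient exact_quotient Q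
  unfolding Ac_iff by blast

lemma (in ses_complexes) quasi_iso_epi_iff: "q \<in> quasi_isos C Y Q \<longleftrightarrow> X \<in> Ac C"
  using quasi_iso_exact[OF q] quasi_isoI[OF q] inj_of_exact_kernel surj_of_exact_kernel exact_kernel X
  unfolding Ac_iff by blast

section \<open>Exact complexes with cycles in a prescribed class\<close>

definition iso_closed :: "('o, 'm, 'z) cat_scheme \<Rightarrow> 'o set \<Rightarrow> bool" where
  "iso_closed C S \<longleftrightarrow> (\<forall>K K' u v. K \<in> S \<and> arr C u K' K \<and> arr C v K K' \<and>
     u \<cdot>\<^bsub>C\<^esub> v = Ident C K \<and> v \<cdot>\<^bsub>C\<^esub> u = Ident C K' \<longrightarrow> K' \<in> S)"

context abelian_category
begin

lemma cotorsion_pair_iso_closed: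
  assumes "cotorsion_pair C \<D> \<E>"
  shows "iso_closed C \<D>" "iso_closed C \<E>"
  using left_class_iso_closed[OF assms] right_class_iso_closed[OF assms] unfolding iso_closed_def by blast+

text \<open>Splits an exact complex into short exact pieces: \<open>p n\<close> is the differential
  corestricted to the next cycles.\<close>

lemma tildeE:
  assumes "X \<in> tilde C S"
  obtains Z i p where "\<And>n. Z n \<in> S" "\<And>n. is_ses C (Z n) (cob X n) (Z (n + 1)) (i n) (p n)"
    "\<And>n. cdiff X n = i (n + 1) \<cdot> p n"
proof -
  have X: "X \<in> Obj (Ch C)" and ex: "loc_exact C X" using assms by (auto simp: tilde_def Ac_iff)
  note D = Ch_objD[OF X]
  have "\<forall>n. \<exists>Z i. is_kernel C (cob X n) (cob X (n + 1)) (cdiff X n) Z i"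
    using ex_kernel[OF D(1) D(1) arrD(3)[OF D(2)]] by blast
  then obtain Z i where ker: "\<And>n. is_kernel C (cob X n) (cob X (n + 1)) (cdiff X n) (Z n) (i n)" by metis
  note K = kernelD[OF ker D(2)]
  have "\<forall>n. \<exists>p. arr C p (cob X n) (Z (n + 1)) \<and> i (n + 1) \<cdot> p = cdiff X n"
    using K(3)[OF D(2,3)] by blast
  then obtain p where p: "\<And>n. arr C (p n) (cob X n) (Z (n + 1))" "\<And>n. i (n + 1) \<cdot> p n = cdiff X n" by metis
  have "is_ses C (Z n) (cob X n) (Z (n + 1)) (i n) (p n)" for n
    unfolding ses_iff
  proof
    \<comment> \<open>Exactness applied to the inclusion of the cycles yields a cover of
      \<open>Z (n + 1)\<close> that factors through \<open>p n\<close>.\<close>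
    obtain V e y where e: "cover C e V (Z (n + 1))" and y: "arr C y V (cob X n)" "cdiff X n \<cdot> y = i (n + 1) \<cdot> e"
      using loc_exactE[OF ex K(1,2)] .
    have "i (n + 1) \<cdot> (p n \<cdot> y) = i (n + 1) \<cdot> e" using assoc[OF K(1) p(1) y(1)] p(2) y(2) by simp
    then have "p n \<cdot> y = e" using K(4)[OF arr_comp[OF p(1) y(1)] cover_arr[OF e]] by simp
    then show "cover C (p n) (cob X n) (Z (n + 1))" using cover_factor[OF _ p(1) y(1)] e by simp
    have ip: "p n \<cdot> u = Zero C W (Z (n + 1))" if u: "arr C u W (cob X n)" "cdiff X n \<cdot> u = Zero C W (cob X (n + 1))" for u W
    proof -
      have W: "W \<in> Obj C" and Zo: "Z (n + 1) \<in> Obj C" using u(1) p(1)[of n] by (simp_all add: arr_def)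
      have "i (n + 1) \<cdot> (p n \<cdot> u) = i (n + 1) \<cdot> Zero C W (Z (n + 1))"
        using assoc[OF K(1) p(1) u(1)] p(2) u(2) comp_zero[OF K(1) W] by simp
      then show ?thesis using K(4)[OF arr_comp[OF p(1) u(1)] arr_zero[OF W Zo]] by simp
    qed
    show "is_kernel C (cob X n) (Z (n + 1)) (p n) (Z n) (i n)"
    proof (rule kernelI[OF p(1) K(1) ip[OF K(1,2)]])
      fix W u assume u: "arr C u W (cob X n)" "p n \<cdot> u = Zero C W (Z (n + 1))"
      have W: "W \<in> Obj C" using u(1) by (simp add: arr_def)
      have "cdiff X n \<cdot> u = Zero C W (cob X (n + 1))"
        using assoc[OF K(1) p(1) u(1)] p(2) u(2) comp_zero[OF K(1) W] by simp
      then show "\<exists>h. arr C h W (Z n) \<and> i n \<cdot> h = u" using K(3)[OF u(1)] by blast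
    next
      fix W u assume u: "arr C u W (Z n)" "i n \<cdot> u = Zero C W (cob X n)"
      have W: "W \<in> Obj C" and Zo: "Z n \<in> Obj C" using u(1) by (simp_all add: arr_def)
      show "u = Zero C W (Z n)" using K(4)[OF u(1) arr_zero[OF W Zo]] u(2) comp_zero[OF K(1) W] by simp
    qed
  qed
  moreover have "Z n \<in> S" for n using assms ker by (auto simp: tilde_def is_cycles_def)
  ultimately show thesis using that[of Z i p] p(2) by simp
qed

text \<open>The given \<open>Z n\<close> are kernels of the differentials because
  \<open>i (n + 1)\<close> is monic, but \<open>tilde\<close> speaks of every kernel; closure under
  isomorphism transfers membership.\<close>

lemma tildeI:
  assumes X: "X \<in> Obj (Ch C)" and S: "iso_closed C S" and Z: "\<And>n. Z n \<in> S"
    and ses: "\<And>n. is_ses C (Z n) (cob X n) (Z (n + 1)) (i n) (p n)"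
    and d: "\<And>n. cdiff X n = i (n + 1) \<cdot> p n"
  shows "X \<in> tilde C S"
proof -
  note D = Ch_objD[OF X] and ia = sesD(1)[OF ses] and pa = sesD(2)[OF ses]
  have "loc_exact C X" unfolding loc_exact_def
  proof (intro allI impI, elim conjE)
    fix n W x
    assume x: "arr C x W (cob X (n + 1))" "cdiff X (n + 1) \<cdot> x = Zero C W (cob X (n + 1 + 1))"
    have "i (n + 1 + 1) \<cdot> (p (n + 1) \<cdot> x) = Zero C W (cob X (n + 1 + 1))"
      using x(2) assoc[OF ia pa x(1)] d by simp
    then have "p (n + 1) \<cdot> x = Zero C W (Z (n + 1 + 1))" using ses_mono_zero[OF ses arr_comp[OF pa x(1)]] by simp
    then obtain z where z: "arr C z W (Z (n + 1))" "i (n + 1) \<cdot> z = x" using ses_liftE[OF ses x(1)] by blast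
    obtain V e y where e: "cover C e V W" and y: "arr C y V (cob X n)" "p n \<cdot> y = z \<cdot> e"
      using ses_coverE[OF ses z(1)] .
    have "cdiff X n \<cdot> y = x \<cdot> e"
      using d assoc[OF ia pa y(1)] y(2) assoc[OF ia z(1) cover_arr[OF e]] z(2) by simp
    then show "\<exists>V e y. cover C e V W \<and> arr C y V (cob X n) \<and> cdiff X n \<cdot> y = x \<cdot> e" using e y(1) by blast
  qed
  moreover have "K \<in> S" if K: "is_cycles C X n K k" for n K k
  proof -
    have "is_kernel C (cob X n) (cob X (n + 1)) (i (n + 1) \<cdot> p n) (Z n) (i n)"
      using kernel_comp_mono[OF sesD(3)[OF ses] pa ia ses_mono_zero[OF ses]] by blast
    then have "is_kernel C (cob X n) (cob X (n + 1)) (cdiff X n) (Z n) (i n)" using d by simp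
    moreover have "is_kernel C (cob X n) (cob X (n + 1)) (cdiff X n) K k" using K by (simp add: is_cycles_def)
    ultimately obtain u v where "arr C u K (Z n)" "arr C v (Z n) K" "u \<cdot> v = Ident C (Z n)" "v \<cdot> u = Ident C K"
      using kernel_unique D(2) by metis
    then show ?thesis using S Z unfolding iso_closed_def by blast
  qed
  ultimately show ?thesis using X by (auto simp: tilde_def Ac_iff)
qed

end

section \<open>The adjunction on complexes\<close>

lemma Ch_func_simps [simp]:
  "cob (omap (Ch_func F) X) n = omap F (cob X n)" "cdiff (omap (Ch_func F) X) n = mmap F (cdiff X n)"
  "mmap (Ch_func F) f n = mmap F (f n)"
  by (simp_all add: Ch_func_def)

text \<open>Preservation of zero maps ensures that differentials still compose to zero after a
  functor is applied in each degree; both adjoints are instances.\<close>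

locale zero_functor = C: abelian_category C + D: abelian_category D
  for C :: "('o, 'm, 'z) addcat_scheme" and D :: "('p, 'n, 'y) addcat_scheme" +
  fixes H :: "('o, 'm, 'p, 'n) func"
  assumes H: "is_functor C D H"
    and H_zero: "\<lbrakk>X \<in> Obj C; Y \<in> Obj C\<rbrakk> \<Longrightarrow> mmap H (Zero C X Y) = Zero D (omap H X) (omap H Y)"
begin

lemma Ch_func_obj:
  assumes X: "X \<in> Obj (Ch C)"
  shows "omap (Ch_func H) X \<in> Obj (Ch D)"
  using functor_arr[OF H Ch_objD(2)[OF X]] functor_comp_eq[OF H Ch_objD(2)[OF X] Ch_objD(2)[OF X] Ch_objD(3)[OF X]]
    H_zero[OF Ch_objD(1)[OF X] Ch_objD(1)[OF X]]
  by (simp add: Ch_obj_iff)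

lemma Ch_func_arr:
  assumes f: "arr (Ch C) f X Y"
  shows "arr (Ch D) (mmap (Ch_func H) f) (omap (Ch_func H) X) (omap (Ch_func H) Y)"
proof (rule Ch_arrI[OF Ch_func_obj[OF Ch_arrD(1)[OF f]] Ch_func_obj[OF Ch_arrD(2)[OF f]]], unfold Ch_func_simps)
  fix n
  note X = Ch_objD(2)[OF Ch_arrD(1)[OF f]] and Y = Ch_objD(2)[OF Ch_arrD(2)[OF f]] and fa = Ch_arrD(3)[OF f]
  show "arr D (mmap H (f n)) (omap H (cob X n)) (omap H (cob Y n))" using functor_arr[OF H fa] .
  show "mmap H (f (n + 1)) \<cdot>\<^bsub>D\<^esub> mmap H (cdiff X n) = mmap H (cdiff Y n) \<cdot>\<^bsub>D\<^esub> mmap H (f n)"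
    using functor_comp[OF H fa X] functor_comp[OF H Y fa] Ch_arrD(4)[OF f] by metis
qed

lemma Ch_func_functor: "is_functor (Ch C) (Ch D) (Ch_func H)"
  unfolding is_functor_def
proof (intro conjI ballI)
  show "omap (Ch_func H) X \<in> Obj (Ch D)" if "X \<in> Obj (Ch C)" for X using Ch_func_obj that .
  show "mmap (Ch_func H) f \<in> Hom (Ch D) (omap (Ch_func H) X) (omap (Ch_func H) Y)"
    if "X \<in> Obj (Ch C)" "Y \<in> Obj (Ch C)" "f \<in> Hom (Ch C) X Y" for X Y f
    using Ch_func_arr[OF arrI[OF that]] by (simp add: arr_def)
  show "mmap (Ch_func H) (Ident (Ch C) X) = Ident (Ch D) (omap (Ch_func H) X)" if "X \<in> Obj (Ch C)" for X
    using functor_id[OF H Ch_objD(1)[OF that]] by (simp add: fun_eq_iff Ch_simps)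
  show "mmap (Ch_func H) (g \<cdot>\<^bsub>Ch C\<^esub> f) = mmap (Ch_func H) g \<cdot>\<^bsub>Ch D\<^esub> mmap (Ch_func H) f"
    if "X \<in> Obj (Ch C)" "Y \<in> Obj (Ch C)" "Z \<in> Obj (Ch C)" "f \<in> Hom (Ch C) X Y" "g \<in> Hom (Ch C) Y Z" for X Y Z f g
    using functor_comp[OF H Ch_arrD(3)[OF arrI[OF that(2,3,5)]] Ch_arrD(3)[OF arrI[OF that(1,2,4)]]]
    by (simp add: fun_eq_iff Ch_simps)
qed

text \<open>In the splicing both ends of each sequence lie in \<open>S\<close>, so the hypothesis on
  \<open>H\<close> is limited to such sequences; right split and left split classes both meet
  it.\<close>

lemma Ch_func_tilde:
  assumes X: "X \<in> tilde C S" and HS: "omap H ` S \<subseteq> S'" and S': "iso_closed D S'"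
    and ses: "\<And>X Y Z f g. X \<in> S \<Longrightarrow> Z \<in> S \<Longrightarrow> is_ses C X Y Z f g \<Longrightarrow>
      is_ses D (omap H X) (omap H Y) (omap H Z) (mmap H f) (mmap H g)"
  shows "omap (Ch_func H) X \<in> tilde D S'"
proof -
  have Xo: "X \<in> Obj (Ch C)" using X by (simp add: tilde_def Ac_def)
  obtain Z i p where Z: "\<And>n. Z n \<in> S" "\<And>n. is_ses C (Z n) (cob X n) (Z (n + 1)) (i n) (p n)"
    "\<And>n. cdiff X n = i (n + 1) \<cdot>\<^bsub>C\<^esub> p n" by (rule C.tildeE[OF X]) (rule that)
  show ?thesis
  proof (rule D.tildeI[OF Ch_func_obj[OF Xo] S'], unfold Ch_func_simps)
    fix n
    show "omap H (Z n) \<in> S'" using HS Z(1) by blast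
    show "is_ses D (omap H (Z n)) (omap H (cob X n)) (omap H (Z (n + 1))) (mmap H (i n)) (mmap H (p n))"
      using ses[OF Z(1) Z(1) Z(2)] .
    show "mmap H (cdiff X n) = mmap H (i (n + 1)) \<cdot>\<^bsub>D\<^esub> mmap H (p n)"
      using functor_comp[OF H sesD(1)[OF Z(2)] sesD(2)[OF Z(2)]] Z(3) by simp
  qed
qed

end

section \<open>Additivity, and transposition of chain maps and homotopies\<close>

context abelian_adjunction
begin

sublocale F: zero_functor A B F
  by unfold_locales (rule F F_zero; assumption?)+

sublocale G: zero_functor B A G
  by unfold_locales (rule G G_zero; assumption?)+

text \<open>The images of \<open>i\<close> and \<open>j\<close> under \<open>F\<close> are jointly
  epic before \<open>F\<close> is known to preserve sums: after transposition an arrow out of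
  \<open>P\<close> is recovered from its restrictions along \<open>i\<close> and
  \<open>j\<close>.\<close>

lemma F_ext:
  assumes P: "P \<in> Obj A" and u: "arr B u (omap F P) Y" and v: "arr B v (omap F P) Y"
    and i: "arr A i X P" and j: "arr A j X' P" and p: "arr A p P X" and q: "arr A q P X'"
    and id: "(i \<cdot>\<^bsub>A\<^esub> p) \<boxplus>\<^bsub>A\<^esub> (j \<cdot>\<^bsub>A\<^esub> q) = Ident A P"
    and e: "u \<cdot>\<^bsub>B\<^esub> mmap F i = v \<cdot>\<^bsub>B\<^esub> mmap F i" "u \<cdot>\<^bsub>B\<^esub> mmap F j = v \<cdot>\<^bsub>B\<^esub> mmap F j"
  shows "u = v"
proof -
  have *: "\<phi> P Y w = ((\<phi> P Y w \<cdot>\<^bsub>A\<^esub> i) \<cdot>\<^bsub>A\<^esub> p) \<boxplus>\<^bsub>A\<^esub> ((\<phi> P Y w \<cdot>\<^bsub>A\<^esub> j) \<cdot>\<^bsub>A\<^esub> q)"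
    if w: "arr B w (omap F P) Y" for w
    using A.comp_add[OF phi_arr[OF P w] A.arr_comp[OF i p] A.arr_comp[OF j q]] id A.id_right[OF phi_arr[OF P w]]
      A.assoc[OF phi_arr[OF P w] i p] A.assoc[OF phi_arr[OF P w] j q] by simp
  have "\<phi> P Y u = \<phi> P Y v"
    using *[OF u] *[OF v] phi_comp_right[OF i u] phi_comp_right[OF i v] phi_comp_right[OF j u] phi_comp_right[OF j v] e
    by simp
  then show ?thesis using phi_inj[OF P u v] by simp
qed

text \<open>A left adjoint preserves the biproduct of \<open>X\<close> with itself, and the sum of two parallel
  morphisms is expressed through that biproduct.\<close>

lemma F_plus:
  assumes f: "arr A f X Y" and g: "arr A g X Y"
  shows "mmap F (f \<boxplus>\<^bsub>A\<^esub> g) = mmap F f \<boxplus>\<^bsub>B\<^esub> mmap F g"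
proof -
  have X: "X \<in> Obj A" using f by (simp add: arr_def)
  obtain P i j p q where bp: "is_biproduct A X X P i j p q" using A.ex_biproduct[OF X X] by blast
  then have P: "P \<in> Obj A" and i: "arr A i X P" and j: "arr A j X P" and p: "arr A p P X" and q: "arr A q P X"
    using X by (auto simp: is_biproduct_def arr_def)
  have b: "p \<cdot>\<^bsub>A\<^esub> i = Ident A X" "q \<cdot>\<^bsub>A\<^esub> j = Ident A X" "p \<cdot>\<^bsub>A\<^esub> j = Zero A X X" "q \<cdot>\<^bsub>A\<^esub> i = Zero A X X"
    "(i \<cdot>\<^bsub>A\<^esub> p) \<boxplus>\<^bsub>A\<^esub> (j \<cdot>\<^bsub>A\<^esub> q) = Ident A P"
    using bp by (auto simp: is_biproduct_def)
  note Fi = functor_arr[OF F i] and Fj = functor_arr[OF F j] and Fp = functor_arr[OF F p] and Fq = functor_arr[OF F q]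
  note FP = functor_obj[OF F P] and FX = functor_obj[OF F X]
  have Fb: "mmap F p \<cdot>\<^bsub>B\<^esub> mmap F i = Ident B (omap F X)" "mmap F q \<cdot>\<^bsub>B\<^esub> mmap F j = Ident B (omap F X)"
    "mmap F p \<cdot>\<^bsub>B\<^esub> mmap F j = Zero B (omap F X) (omap F X)" "mmap F q \<cdot>\<^bsub>B\<^esub> mmap F i = Zero B (omap F X) (omap F X)"
    using functor_comp_eq[OF F p i b(1)] functor_comp_eq[OF F q j b(2)] functor_comp_eq[OF F p j b(3)]
      functor_comp_eq[OF F q i b(4)] functor_id[OF F X] F_zero[OF X X] by simp_all
  let ?ip = "mmap F i \<cdot>\<^bsub>B\<^esub> mmap F p" and ?jq = "mmap F j \<cdot>\<^bsub>B\<^esub> mmap F q"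
  note ip = B.arr_comp[OF Fi Fp] and jq = B.arr_comp[OF Fj Fq]
  \<comment> \<open>This relation cannot be carried over by applying \<open>F\<close> to a sum; it
    is checked on the jointly epic pair instead.\<close>
  have Fid: "?ip \<boxplus>\<^bsub>B\<^esub> ?jq = Ident B (omap F P)"
  proof (rule F_ext[OF P B.arr_plus[OF ip jq] B.arr_id[OF FP] i j p q b(5)])
    show "(?ip \<boxplus>\<^bsub>B\<^esub> ?jq) \<cdot>\<^bsub>B\<^esub> mmap F i = Ident B (omap F P) \<cdot>\<^bsub>B\<^esub> mmap F i"
      using B.add_comp[OF ip jq Fi] B.assoc[OF Fi Fp Fi] B.assoc[OF Fj Fq Fi] Fb B.id_right[OF Fi]
        B.comp_zero[OF Fj FX] B.add_zero[OF Fi] B.id_left[OF Fi] by simp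
    show "(?ip \<boxplus>\<^bsub>B\<^esub> ?jq) \<cdot>\<^bsub>B\<^esub> mmap F j = Ident B (omap F P) \<cdot>\<^bsub>B\<^esub> mmap F j"
      using B.add_comp[OF ip jq Fj] B.assoc[OF Fi Fp Fj] B.assoc[OF Fj Fq Fj] Fb B.id_right[OF Fj]
        B.comp_zero[OF Fi FX] B.zero_add[OF Fj] B.id_left[OF Fj] by simp
  qed
  \<comment> \<open>\<open>c\<close> is the diagonal and \<open>h\<close> the map with components
    \<open>f\<close> and \<open>g\<close>, so \<open>f \<boxplus> g\<close> becomes the composite
    \<open>h \<cdot> c\<close>, which any functor respects.\<close>
  define c where "c = i \<boxplus>\<^bsub>A\<^esub> j"
  define h where "h = (f \<cdot>\<^bsub>A\<^esub> p) \<boxplus>\<^bsub>A\<^esub> (g \<cdot>\<^bsub>A\<^esub> q)"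
  have c: "arr A c X P" unfolding c_def using i j by (rule A.arr_plus)
  have h: "arr A h P Y" unfolding h_def using f p g q A.arr_comp A.arr_plus by blast
  note fp = A.arr_comp[OF f p] and gq = A.arr_comp[OF g q]
  have hi: "h \<cdot>\<^bsub>A\<^esub> i = f" unfolding h_def
    using A.add_comp[OF fp gq i] A.assoc[OF f p i] A.assoc[OF g q i] b A.comp_zero[OF g X] A.id_right[OF f] A.add_zero[OF f]
    by simp
  have hj: "h \<cdot>\<^bsub>A\<^esub> j = g" unfolding h_def
    using A.add_comp[OF fp gq j] A.assoc[OF f p j] A.assoc[OF g q j] b A.comp_zero[OF f X] A.id_right[OF g] A.zero_add[OF g]
    by simp
  have pc: "p \<cdot>\<^bsub>A\<^esub> c = Ident A X" and qc: "q \<cdot>\<^bsub>A\<^esub> c = Ident A X" unfolding c_def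
    using A.comp_add[OF p i j] A.comp_add[OF q i j] b A.add_zero[OF A.arr_id[OF X]] A.zero_add[OF A.arr_id[OF X]] by simp_all
  have hc: "h \<cdot>\<^bsub>A\<^esub> c = f \<boxplus>\<^bsub>A\<^esub> g" unfolding c_def using A.comp_add[OF h i j] hi hj by simp
  note Fc = functor_arr[OF F c] and Fh = functor_arr[OF F h]
  have "mmap F c = (?ip \<boxplus>\<^bsub>B\<^esub> ?jq) \<cdot>\<^bsub>B\<^esub> mmap F c" using Fid B.id_left[OF Fc] by simp
  also have "\<dots> = mmap F i \<boxplus>\<^bsub>B\<^esub> mmap F j"
    using B.add_comp[OF ip jq Fc] B.assoc[OF Fi Fp Fc] B.assoc[OF Fj Fq Fc] functor_comp_eq[OF F p c pc]
      functor_comp_eq[OF F q c qc] functor_id[OF F X] B.id_right[OF Fi] B.id_right[OF Fj] by simp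
  finally show ?thesis
    using functor_comp_eq[OF F h c hc] B.comp_add[OF Fh Fi Fj] functor_comp_eq[OF F h i hi] functor_comp_eq[OF F h j hj]
    by simp
qed

text \<open>The inverse of transposition sends \<open>a\<close> to \<open>F a\<close> followed by
  the counit \<open>e\<close>, which is additive in \<open>a\<close> because \<open>F\<close>
  is.\<close>

lemma phi_plus:
  assumes X: "X \<in> Obj A" and u: "arr B u (omap F X) Y" and v: "arr B v (omap F X) Y"
  shows "\<phi> X Y (u \<boxplus>\<^bsub>B\<^esub> v) = \<phi> X Y u \<boxplus>\<^bsub>A\<^esub> \<phi> X Y v"
proof -
  have Y: "Y \<in> Obj B" using u by (simp add: arr_def)
  note GY = functor_obj[OF G Y]
  obtain e where e: "arr B e (omap F (omap G Y)) Y" "\<phi> (omap G Y) Y e = Ident A (omap G Y)"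
    using phi_surj[OF Y A.arr_id[OF GY]] .
  have *: "e \<cdot>\<^bsub>B\<^esub> mmap F (\<phi> X Y w) = w" if w: "arr B w (omap F X) Y" for w
  proof -
    note a = phi_arr[OF X w]
    have "\<phi> X Y (e \<cdot>\<^bsub>B\<^esub> mmap F (\<phi> X Y w)) = \<phi> X Y w" using phi_comp_right[OF a e(1)] e(2) A.id_left[OF a] by simp
    then show ?thesis using phi_inj[OF X B.arr_comp[OF e(1) functor_arr[OF F a]] w] by simp
  qed
  note a = phi_arr[OF X u] and b = phi_arr[OF X v]
  have ab: "arr A (\<phi> X Y u \<boxplus>\<^bsub>A\<^esub> \<phi> X Y v) X (omap G Y)" using a b by (rule A.arr_plus)
  have "e \<cdot>\<^bsub>B\<^esub> mmap F (\<phi> X Y u \<boxplus>\<^bsub>A\<^esub> \<phi> X Y v) = u \<boxplus>\<^bsub>B\<^esub> v"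
    using F_plus[OF a b] B.comp_add[OF e(1) functor_arr[OF F a] functor_arr[OF F b]] *[OF u] *[OF v] by simp
  then show ?thesis using phi_comp_right[OF ab e(1)] e(2) A.id_left[OF ab] by simp
qed

lemma Ch_adjunction: "is_adjunction (Ch A) (Ch B) (Ch_func F) (Ch_func G) (Ch_transpose \<phi>)"
  unfolding is_adjunction_def
proof (intro conjI ballI)
  show "is_functor (Ch A) (Ch B) (Ch_func F)" "is_functor (Ch B) (Ch A) (Ch_func G)"
    by (rule F.Ch_func_functor G.Ch_func_functor)+
next
  fix X Y assume X: "X \<in> Obj (Ch A)" and Y: "Y \<in> Obj (Ch B)"
  note XD = Ch_objD[OF X] and YD = Ch_objD[OF Y] and FX = F.Ch_func_obj[OF X] and GY = G.Ch_func_obj[OF Y]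
  \<comment> \<open>Transposition is injective and natural, so the square of \<open>f\<close> in
    degree \<open>n\<close> commutes exactly if its transpose does.\<close>
  have chain: "(f (n + 1) \<cdot>\<^bsub>B\<^esub> mmap F (cdiff X n) = cdiff Y n \<cdot>\<^bsub>B\<^esub> f n) \<longleftrightarrow>
      (Ch_transpose \<phi> X Y f (n + 1) \<cdot>\<^bsub>A\<^esub> cdiff X n = mmap G (cdiff Y n) \<cdot>\<^bsub>A\<^esub> Ch_transpose \<phi> X Y f n)"
    if f: "\<And>n. arr B (f n) (omap F (cob X n)) (cob Y n)" for f n
  proof -
    let ?\<phi> = "\<phi> (cob X n) (cob Y (n + 1))"
    have "(f (n + 1) \<cdot>\<^bsub>B\<^esub> mmap F (cdiff X n) = cdiff Y n \<cdot>\<^bsub>B\<^esub> f n) \<longleftrightarrow>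
        ?\<phi> (f (n + 1) \<cdot>\<^bsub>B\<^esub> mmap F (cdiff X n)) = ?\<phi> (cdiff Y n \<cdot>\<^bsub>B\<^esub> f n)"
      using phi_inj[OF XD(1) B.arr_comp[OF f functor_arr[OF F XD(2)]] B.arr_comp[OF YD(2) f]] by metis
    then show ?thesis
      unfolding Ch_transpose_def phi_comp_right[OF XD(2) f] phi_comp_left[OF XD(1) f YD(2)] .
  qed
  show "bij_betw (Ch_transpose \<phi> X Y) (Hom (Ch B) (omap (Ch_func F) X) Y) (Hom (Ch A) X (omap (Ch_func G) Y))"
    unfolding bij_betw_def
  proof
    show "inj_on (Ch_transpose \<phi> X Y) (Hom (Ch B) (omap (Ch_func F) X) Y)"
    proof (rule inj_onI, rule ext)
      fix f g n assume "f \<in> Hom (Ch B) (omap (Ch_func F) X) Y" "g \<in> Hom (Ch B) (omap (Ch_func F) X) Y"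
        and e: "Ch_transpose \<phi> X Y f = Ch_transpose \<phi> X Y g"
      then have "arr B (f n) (omap F (cob X n)) (cob Y n)" "arr B (g n) (omap F (cob X n)) (cob Y n)"
        using Ch_arrD(3)[OF arrI[OF FX Y], of _ n] by simp_all
      then show "f n = g n" using phi_inj[OF XD(1)] fun_cong[OF e, of n] by (simp add: Ch_transpose_def)
    qed
    show "Ch_transpose \<phi> X Y ` Hom (Ch B) (omap (Ch_func F) X) Y = Hom (Ch A) X (omap (Ch_func G) Y)"
    proof (intro equalityI subsetI)
      fix g assume "g \<in> Ch_transpose \<phi> X Y ` Hom (Ch B) (omap (Ch_func F) X) Y"
      then obtain f where f: "arr (Ch B) f (omap (Ch_func F) X) Y" "g = Ch_transpose \<phi> X Y f"
        using FX Y by (auto simp: arr_def)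
      have fa: "arr B (f n) (omap F (cob X n)) (cob Y n)" for n using Ch_arrD(3)[OF f(1), of n] by simp
      have "arr (Ch A) g X (omap (Ch_func G) Y)" unfolding f(2)
      proof (rule Ch_arrI[OF X GY], unfold Ch_func_simps)
        show "arr A (Ch_transpose \<phi> X Y f n) (cob X n) (omap G (cob Y n))" for n
          using phi_arr[OF XD(1) fa] by (simp add: Ch_transpose_def)
        show "Ch_transpose \<phi> X Y f (n + 1) \<cdot>\<^bsub>A\<^esub> cdiff X n = mmap G (cdiff Y n) \<cdot>\<^bsub>A\<^esub> Ch_transpose \<phi> X Y f n" for n
          using chain[OF fa, of n] Ch_arrD(4)[OF f(1), of n] by simp
      qed
      then show "g \<in> Hom (Ch A) X (omap (Ch_func G) Y)" by (rule arrD)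
    next
      fix g assume "g \<in> Hom (Ch A) X (omap (Ch_func G) Y)"
      then have g: "arr (Ch A) g X (omap (Ch_func G) Y)" by (rule arrI[OF X GY])
      have ga: "arr A (g n) (cob X n) (omap G (cob Y n))" for n using Ch_arrD(3)[OF g, of n] by simp
      have "\<forall>n. \<exists>f. arr B f (omap F (cob X n)) (cob Y n) \<and> \<phi> (cob X n) (cob Y n) f = g n"
      proof
        fix n
        obtain f where "arr B f (omap F (cob X n)) (cob Y n)" "\<phi> (cob X n) (cob Y n) f = g n"
          by (rule phi_surj[OF YD(1) ga])
        then show "\<exists>f. arr B f (omap F (cob X n)) (cob Y n) \<and> \<phi> (cob X n) (cob Y n) f = g n" by blast
      qed
      then obtain f where f: "\<And>n. arr B (f n) (omap F (cob X n)) (cob Y n)"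
        "\<And>n. \<phi> (cob X n) (cob Y n) (f n) = g n" by metis
      have gf: "g = Ch_transpose \<phi> X Y f" using f(2) by (simp add: fun_eq_iff Ch_transpose_def)
      have "arr (Ch B) f (omap (Ch_func F) X) Y"
      proof (rule Ch_arrI[OF FX Y], unfold Ch_func_simps)
        show "arr B (f n) (omap F (cob X n)) (cob Y n)" for n by (rule f)
        show "f (n + 1) \<cdot>\<^bsub>B\<^esub> mmap F (cdiff X n) = cdiff Y n \<cdot>\<^bsub>B\<^esub> f n" for n
          using chain[OF f(1), of n] Ch_arrD(4)[OF g, of n] gf by simp
      qed
      then show "g \<in> Ch_transpose \<phi> X Y ` Hom (Ch B) (omap (Ch_func F) X) Y"
        unfolding gf by (intro imageI arrD(3))
    qed
  qed
next
  fix X X' Y Y' u f v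
  assume a: "X \<in> Obj (Ch A)" "X' \<in> Obj (Ch A)" "Y \<in> Obj (Ch B)" "Y' \<in> Obj (Ch B)"
    "u \<in> Hom (Ch A) X' X" "f \<in> Hom (Ch B) (omap (Ch_func F) X) Y" "v \<in> Hom (Ch B) Y Y'"
  note u = Ch_arrD(3)[OF arrI[OF a(2,1,5)]] and v = Ch_arrD(3)[OF arrI[OF a(3,4,7)]]
  have f: "arr B (f n) (omap F (cob X n)) (cob Y n)" for n
    using Ch_arrD(3)[OF arrI[OF F.Ch_func_obj[OF a(1)] a(3,6)], of n] by simp
  show "Ch_transpose \<phi> X' Y' (v \<cdot>\<^bsub>Ch B\<^esub> f \<cdot>\<^bsub>Ch B\<^esub> mmap (Ch_func F) u) =
      mmap (Ch_func G) v \<cdot>\<^bsub>Ch A\<^esub> Ch_transpose \<phi> X Y f \<cdot>\<^bsub>Ch A\<^esub> u"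
    using phi_natural[OF u f v] by (simp add: fun_eq_iff Ch_transpose_def Ch_simps)
qed

text \<open>A homotopy is transposed degree by degree. Its defining formula is a sum of two
  composites, so naturality alone is not enough and \<open>phi_plus\<close> enters.\<close>

lemma null_homotopic_transpose:
  assumes X: "X \<in> Obj (Ch A)" and Y: "Y \<in> Obj (Ch B)"
    and f: "\<And>n. arr B (f n) (omap F (cob X n)) (cob Y n)"
  shows "null_homotopic A X (omap (Ch_func G) Y) (Ch_transpose \<phi> X Y f) \<longleftrightarrow>
    null_homotopic B (omap (Ch_func F) X) Y f"
proof -
  note XD = Ch_objD[OF X] and YD = Ch_objD[OF Y]
  let ?\<sigma> = "\<lambda>s n. \<phi> (cob X n) (cob Y (n - 1)) (s n)"
  have main: "(f n = (cdiff Y (n - 1) \<cdot>\<^bsub>B\<^esub> s n) \<boxplus>\<^bsub>B\<^esub> (s (n + 1) \<cdot>\<^bsub>B\<^esub> mmap F (cdiff X n))) \<longleftrightarrow>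
      (Ch_transpose \<phi> X Y f n = (mmap G (cdiff Y (n - 1)) \<cdot>\<^bsub>A\<^esub> ?\<sigma> s n) \<boxplus>\<^bsub>A\<^esub> (?\<sigma> s (n + 1) \<cdot>\<^bsub>A\<^esub> cdiff X n))"
    if s: "\<And>n. arr B (s n) (omap F (cob X n)) (cob Y (n - 1))" for s n
  proof -
    \<comment> \<open>Retyping that absorbs \<open>n - 1 + 1 = n\<close> and
      \<open>n + 1 - 1 = n\<close>, so that both summands have the same endpoints.\<close>
    have d: "arr B (cdiff Y (n - 1)) (cob Y (n - 1)) (cob Y n)" using YD(2)[of "n - 1"] by simp
    have s': "arr B (s (n + 1)) (omap F (cob X (n + 1))) (cob Y n)" using s[of "n + 1"] by simp
    note ds = B.arr_comp[OF d s] and sd = B.arr_comp[OF s' functor_arr[OF F XD(2)]]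
    have "\<phi> (cob X n) (cob Y n) ((cdiff Y (n - 1) \<cdot>\<^bsub>B\<^esub> s n) \<boxplus>\<^bsub>B\<^esub> (s (n + 1) \<cdot>\<^bsub>B\<^esub> mmap F (cdiff X n))) =
        (mmap G (cdiff Y (n - 1)) \<cdot>\<^bsub>A\<^esub> ?\<sigma> s n) \<boxplus>\<^bsub>A\<^esub> (?\<sigma> s (n + 1) \<cdot>\<^bsub>A\<^esub> cdiff X n)"
      using phi_plus[OF XD(1) ds sd] phi_comp_left[OF XD(1) s d] phi_comp_right[OF XD(2) s'] by simp
    then show ?thesis
      using phi_inj[OF XD(1) f B.arr_plus[OF ds sd]] by (auto simp: Ch_transpose_def)
  qed
  show ?thesis
  proof
    assume "null_homotopic A X (omap (Ch_func G) Y) (Ch_transpose \<phi> X Y f)"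
    then obtain t where t: "\<And>n. t n \<in> Hom A (cob X n) (omap G (cob Y (n - 1)))"
      "\<And>n. Ch_transpose \<phi> X Y f n = (mmap G (cdiff Y (n - 1)) \<cdot>\<^bsub>A\<^esub> t n) \<boxplus>\<^bsub>A\<^esub> (t (n + 1) \<cdot>\<^bsub>A\<^esub> cdiff X n)"
      by (auto simp: null_homotopic_def)
    have ta: "arr A (t n) (cob X n) (omap G (cob Y (n - 1)))" for n
      using t(1) XD(1) functor_obj[OF G YD(1)] by (simp add: arr_def)
    have "\<forall>n. \<exists>s. arr B s (omap F (cob X n)) (cob Y (n - 1)) \<and> \<phi> (cob X n) (cob Y (n - 1)) s = t n"
    proof
      fix n
      obtain s where "arr B s (omap F (cob X n)) (cob Y (n - 1))" "\<phi> (cob X n) (cob Y (n - 1)) s = t n"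
        by (rule phi_surj[OF YD(1) ta])
      then show "\<exists>s. arr B s (omap F (cob X n)) (cob Y (n - 1)) \<and> \<phi> (cob X n) (cob Y (n - 1)) s = t n"
        by blast
    qed
    then obtain s where s: "\<And>n. arr B (s n) (omap F (cob X n)) (cob Y (n - 1))" "\<And>n. ?\<sigma> s n = t n" by metis
    have "\<forall>n. f n = (cdiff Y (n - 1) \<cdot>\<^bsub>B\<^esub> s n) \<boxplus>\<^bsub>B\<^esub> (s (n + 1) \<cdot>\<^bsub>B\<^esub> mmap F (cdiff X n))"
      unfolding main[OF s(1)] s(2) using t(2) by simp
    then show "null_homotopic B (omap (Ch_func F) X) Y f"
      using s(1) unfolding null_homotopic_def Ch_func_simps arr_def by blast
  next
    assume "null_homotopic B (omap (Ch_func F) X) Y f"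
    then obtain s where s: "\<And>n. s n \<in> Hom B (omap F (cob X n)) (cob Y (n - 1))"
      "\<And>n. f n = (cdiff Y (n - 1) \<cdot>\<^bsub>B\<^esub> s n) \<boxplus>\<^bsub>B\<^esub> (s (n + 1) \<cdot>\<^bsub>B\<^esub> mmap F (cdiff X n))"
      by (auto simp: null_homotopic_def)
    have sa: "arr B (s n) (omap F (cob X n)) (cob Y (n - 1))" for n
      using s(1) YD(1) functor_obj[OF F XD(1)] by (simp add: arr_def)
    have "\<forall>n. Ch_transpose \<phi> X Y f n = (mmap G (cdiff Y (n - 1)) \<cdot>\<^bsub>A\<^esub> ?\<sigma> s n) \<boxplus>\<^bsub>A\<^esub> (?\<sigma> s (n + 1) \<cdot>\<^bsub>A\<^esub> cdiff X n)"
      using main[OF sa] s(2) by blast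
    moreover have "?\<sigma> s n \<in> Hom A (cob X n) (omap G (cob Y (n - 1)))" for n using phi_arr[OF XD(1) sa] by (rule arrD)
    ultimately show "null_homotopic A X (omap (Ch_func G) Y) (Ch_transpose \<phi> X Y f)"
      unfolding null_homotopic_def Ch_func_simps by (intro exI[of _ "?\<sigma> s"]) simp
  qed
qed

lemma Ch_transpose_bij:
  assumes "X \<in> Obj (Ch A)" "Y \<in> Obj (Ch B)"
  shows "bij_betw (Ch_transpose \<phi> X Y) (Hom (Ch B) (omap (Ch_func F) X) Y) (Hom (Ch A) X (omap (Ch_func G) Y))"
  using Ch_adjunction assms by (simp add: is_adjunction_def)

text \<open>A map from \<open>F Q\<close> to \<open>E\<close> transposes to one from
  \<open>Q\<close> to \<open>G E\<close>. The homotopy condition for \<open>F Q\<close> thus relies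
  on what \<open>G\<close> does to exact complexes; the action of \<open>F\<close> on objects
  settles only the degreewise condition.\<close>

lemma dg_left_image:
  assumes Q: "Q \<in> dg_left A \<D> \<E>" and FD: "omap F ` \<D> \<subseteq> \<D>'"
    and GE: "\<And>E. E \<in> tilde B \<E>' \<Longrightarrow> omap (Ch_func G) E \<in> tilde A \<E>"
  shows "omap (Ch_func F) Q \<in> dg_left B \<D>' \<E>'"
proof -
  have Qo: "Q \<in> Obj (Ch A)" using Q by (simp add: dg_left_def)
  note FQ = F.Ch_func_obj[OF Qo]
  have "null_homotopic B (omap (Ch_func F) Q) E f" if E: "E \<in> tilde B \<E>'" and f: "f \<in> Hom (Ch B) (omap (Ch_func F) Q) E" for E f
  proof -
    have Eo: "E \<in> Obj (Ch B)" using E by (simp add: tilde_def Ac_def)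
    have fa: "arr B (f n) (omap F (cob Q n)) (cob E n)" for n using Ch_arrD(3)[OF arrI[OF FQ Eo f], of n] by simp
    have "Ch_transpose \<phi> Q E f \<in> Hom (Ch A) Q (omap (Ch_func G) E)"
      using bij_betwE[OF Ch_transpose_bij[OF Qo Eo]] f by blast
    then have "null_homotopic A Q (omap (Ch_func G) E) (Ch_transpose \<phi> Q E f)"
      using Q GE[OF E] unfolding dg_left_def by blast
    then show ?thesis using null_homotopic_transpose[OF Qo Eo fa] by simp
  qed
  moreover have "\<forall>n. omap F (cob Q n) \<in> \<D>'" using Q FD by (auto simp: dg_left_def)
  ultimately show ?thesis using FQ by (simp add: dg_left_def)
qed

lemma dg_right_image:
  assumes K: "K \<in> dg_right B \<D>' \<E>'" and GE: "omap G ` \<E>' \<subseteq> \<E>"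
    and FD: "\<And>D. D \<in> tilde A \<D> \<Longrightarrow> omap (Ch_func F) D \<in> tilde B \<D>'"
  shows "omap (Ch_func G) K \<in> dg_right A \<D> \<E>"
proof -
  have Ko: "K \<in> Obj (Ch B)" using K by (simp add: dg_right_def)
  note GK = G.Ch_func_obj[OF Ko]
  have "null_homotopic A D (omap (Ch_func G) K) g" if D: "D \<in> tilde A \<D>" and g: "g \<in> Hom (Ch A) D (omap (Ch_func G) K)" for D g
  proof -
    have Do: "D \<in> Obj (Ch A)" using D by (simp add: tilde_def Ac_def)
    obtain f where f: "f \<in> Hom (Ch B) (omap (Ch_func F) D) K" "g = Ch_transpose \<phi> D K f"
      using g bij_betw_imp_surj_on[OF Ch_transpose_bij[OF Do Ko]] by blast
    have fa: "arr B (f n) (omap F (cob D n)) (cob K n)" for n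
      using Ch_arrD(3)[OF arrI[OF F.Ch_func_obj[OF Do] Ko f(1)], of n] by simp
    have "null_homotopic B (omap (Ch_func F) D) K f"
      using K FD[OF D] f(1) unfolding dg_right_def by blast
    then show ?thesis using null_homotopic_transpose[OF Do Ko fa] f(2) by simp
  qed
  moreover have "\<forall>n. omap G (cob K n) \<in> \<E>" using K GE by (auto simp: dg_right_def)
  ultimately show ?thesis using GK by (simp add: dg_right_def)
qed

end

section \<open>Cofibrations and fibrations as degreewise short exact sequences\<close>

lemma (in abelian_category) mono_cokernel_ses:
  assumes f: "arr C f X Y" and m: "\<And>W g. arr C g W X \<Longrightarrow> f \<cdot> g = Zero C W Y \<Longrightarrow> g = Zero C W X"
    and q: "is_cokernel C X Y f Q q"
  shows "is_ses C X Y Q f q"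
proof -
  have "cover (op C) f Y X"
    by (rule preadditive_category.coverI[OF preadditive_op]) (use f m in \<open>simp_all add: op_iff\<close>)
  moreover have "is_kernel (op C) Y X f Q q" using q by (simp add: op_iff)
  ultimately have "is_cokernel (op C) Q Y q X f" by (rule abelian_category.cokernel_of_kernel[OF abelian_op])
  then have "is_kernel C Y Q q X f" by (simp add: op_iff)
  moreover have "Q \<in> Obj C" using q by (simp add: is_cokernel_def)
  ultimately show ?thesis using f q by (simp add: is_ses_def arr_def)
qed

lemma (in abelian_category) ses_complexesI:
  assumes "arr (Ch C) f X Y" "arr (Ch C) q Y Q"
    "\<And>n. is_ses C (cob X n) (cob Y n) (cob Q n) (f n) (q n)"
  shows "ses_complexes C X Y Q f q"
  using assms by (intro ses_complexes.intro abelian_category_axioms ses_complexes_axioms.intro)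

lemma (in abelian_category) cofibration_ses:
  assumes f: "arr (Ch C) f X Y" and m: "is_mono (Ch C) X Y f" and q: "is_cokernel (Ch C) X Y f Q q"
  shows "ses_complexes C X Y Q f q"
  using mono_cokernel_ses[OF Ch_arrD(3)[OF f] Ch_monoD[OF m f] Ch_cokernel_degreewise[OF q f]]
  by (intro ses_complexesI[OF f Ch_cokernelD(1)[OF q f]]) blast

lemma (in abelian_category) fibration_ses:
  assumes p: "arr (Ch C) p X Y" and e: "is_epi (Ch C) X Y p" and k: "is_kernel (Ch C) X Y p K k"
  shows "ses_complexes C K X Y k p"
  using Ch_epiD[OF e p] Ch_kernel_degreewise[OF k p]
  by (intro ses_complexesI[OF Ch_kernelD(1)[OF k p] p]) (simp add: ses_iff)

lemma (in ses_complexes) Ch_ses: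
  shows "is_mono (Ch C) X Y f" "is_cokernel (Ch C) X Y f Q q"
    "is_epi (Ch C) Y Q q" "is_kernel (Ch C) Y Q q X f"
proof -
  show k: "is_kernel (Ch C) Y Q q X f" by (rule Ch_kernel_from_degreewise[OF q f sesD(3)[OF ses]])
  show "is_mono (Ch C) X Y f" by (rule Ch_kernel_mono[OF k q])
  show "is_cokernel (Ch C) X Y f Q q" by (rule Ch_cokernel_from_degreewise[OF f q sesD(4)[OF ses]])
  show "is_epi (Ch C) Y Q q" by (rule Ch_epi_from_degreewise[OF q]) (use ses in \<open>simp add: ses_iff\<close>)
qed

text \<open>The complex \<open>disc C 0 W\<close> has \<open>W\<close> in degree zero. Its
  approximation by a complex of \<open>dg_left\<close> is epic in that degree, where the
  approximating complex has an object of \<open>\<D>\<close>.\<close>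

lemma (in abelian_category) enough_left:
  assumes ind: "induces_model_structure C \<D> \<E>" and W: "W \<in> Obj C"
  shows "\<exists>P\<in>\<D>. \<exists>g. cover C g P W"
proof -
  obtain E P f g where P: "P \<in> dg_left C \<D> \<E>" and s: "is_ses (Ch C) E P (disc C 0 W) f g"
    using ind disc_obj[OF W, of 0] unfolding induces_model_structure_def complete_cotorsion_pair_def by blast
  have "cover C (g 0) (cob P 0) W" using Ch_ses_degreewise[OF s, of 0] by (simp add: ses_iff disc_def)
  then show ?thesis using P by (auto simp: dg_left_def)
qed

text \<open>The embedding of \<open>disc C 0 W\<close> into a complex of \<open>dg_right\<close> is
  evaluated in degree zero; being monic, it is a cover in \<open>op C\<close>.\<close>

lemma (in abelian_category) enough_right:
  assumes ind: "induces_model_structure C \<D> \<E>" and W: "W \<in> Obj C"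
  shows "\<exists>E\<in>\<E>. \<exists>g. cover (op C) g E W"
proof -
  obtain E P f g where E: "E \<in> dg_right C \<D> \<E>" and s: "is_ses (Ch C) (disc C 0 W) E P f g"
    using ind disc_obj[OF W, of 0] unfolding induces_model_structure_def complete_cotorsion_pair_def by blast
  have s0: "is_ses C W (cob E 0) (cob P 0) (f 0) (g 0)" using Ch_ses_degreewise[OF s, of 0] by (simp add: disc_def)
  have "cover (op C) (f 0) (cob E 0) W"
    using sesD(1)[OF s0] ses_mono[OF s0] by (auto simp: cover_def op_iff is_mono_def arr_def)
  then show ?thesis using E by (auto simp: dg_right_def)
qed

text \<open>Each half draws on both functors: the splitting condition of one keeps the sequences
  exact, while the other functor's action on exact complexes gives the dg-condition on the cokernel
  or kernel.\<close>

lemma (in abelian_adjunction) quillen: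
  assumes cpA: "cotorsion_pair A \<D> \<E>" and cpB: "cotorsion_pair B \<D>' \<E>'"
    and indA: "induces_model_structure A \<D> \<E>" and indB: "induces_model_structure B \<D>' \<E>'"
    and Fs: "right_split A B F \<D>" and FD: "omap F ` \<D> \<subseteq> \<D>'"
    and Gs: "left_split B A G \<E>'" and GE: "omap G ` \<E>' \<subseteq> \<E>"
  shows "quillen_adjunction (Ch A) (induced_model A \<D> \<E>) (Ch B) (induced_model B \<D>' \<E>')
    (Ch_func F) (Ch_func G) (Ch_transpose \<phi>)"
proof -
  have Ftilde: "omap (Ch_func F) D \<in> tilde B \<D>'" if "D \<in> tilde A \<D>" for D
    by (rule F.Ch_func_tilde[OF that FD B.cotorsion_pair_iso_closed(1)[OF cpB]])
      (use Fs in \<open>simp add: right_split_def\<close>)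
  have Gtilde: "omap (Ch_func G) E \<in> tilde A \<E>" if "E \<in> tilde B \<E>'" for E
    by (rule G.Ch_func_tilde[OF that GE A.cotorsion_pair_iso_closed(2)[OF cpA]])
      (use Gs in \<open>simp add: left_split_def\<close>)
  \<comment> \<open>The splitting hypothesis applies in every degree because a complex of
    \<open>dg_left\<close> has all its objects in \<open>\<D>\<close>.\<close>
  have Fses: "ses_complexes B (omap (Ch_func F) X) (omap (Ch_func F) Y) (omap (Ch_func F) Q)
      (mmap (Ch_func F) f) (mmap (Ch_func F) q)"
    if s: "ses_complexes A X Y Q f q" and Q: "Q \<in> dg_left A \<D> \<E>" for X Y Q f q
    using F.Ch_func_arr[OF ses_complexes.f[OF s]] F.Ch_func_arr[OF ses_complexes.q[OF s]]
      ses_complexes.ses[OF s] Q Fs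
    by (intro B.ses_complexesI) (simp_all add: right_split_def dg_left_def)
  have Gses: "ses_complexes A (omap (Ch_func G) K) (omap (Ch_func G) X) (omap (Ch_func G) Y)
      (mmap (Ch_func G) k) (mmap (Ch_func G) p)"
    if s: "ses_complexes B K X Y k p" and K: "K \<in> dg_right B \<D>' \<E>'" for X Y K k p
    using G.Ch_func_arr[OF ses_complexes.f[OF s]] G.Ch_func_arr[OF ses_complexes.q[OF s]]
      ses_complexes.ses[OF s] K Gs
    by (intro A.ses_complexesI) (simp_all add: left_split_def dg_right_def)
  show ?thesis unfolding quillen_adjunction_def
  proof (intro conjI ballI Ch_adjunction)
    fix X Y assume X: "X \<in> Obj (Ch A)" and Y: "Y \<in> Obj (Ch A)"
    have *: "mmap (Ch_func F) f \<in> Cof (induced_model B \<D>' \<E>') (omap (Ch_func F) X) (omap (Ch_func F) Y) \<and>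
        (f \<in> Weq (induced_model A \<D> \<E>) X Y \<longrightarrow>
         mmap (Ch_func F) f \<in> Weq (induced_model B \<D>' \<E>') (omap (Ch_func F) X) (omap (Ch_func F) Y))"
      if f: "f \<in> Cof (induced_model A \<D> \<E>) X Y" for f
    proof -
      obtain Q q where m: "is_mono (Ch A) X Y f" and Q: "Q \<in> dg_left A \<D> \<E>" and q: "is_cokernel (Ch A) X Y f Q q"
        using f by (auto simp: induced_model_def)
      have fa: "arr (Ch A) f X Y" using m X Y by (simp add: is_mono_def arr_def)
      note s = A.cofibration_ses[OF fa m q]
      note Fs = Fses[OF s Q]
      have "omap (Ch_func F) Q \<in> dg_left B \<D>' \<E>'" using dg_left_image[OF Q FD Gtilde] .
      then have "mmap (Ch_func F) f \<in> Cof (induced_model B \<D>' \<E>') (omap (Ch_func F) X) (omap (Ch_func F) Y)"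
        using ses_complexes.Ch_ses(1,2)[OF Fs] by (auto simp: induced_model_def)
      moreover have "mmap (Ch_func F) f \<in> quasi_isos B (omap (Ch_func F) X) (omap (Ch_func F) Y)"
        if "f \<in> quasi_isos A X Y"
      proof -
        \<comment> \<open>Compatibility of the two pairs enters here: the cokernel of a trivial
          cofibration is acyclic and lies in \<open>dg_left\<close>, hence in the exact class, which
          \<open>F\<close> preserves.\<close>
        have "Q \<in> tilde A \<D>"
          using that Q indA ses_complexes.quasi_iso_mono_iff[OF s] by (simp add: induces_model_structure_def)
        then have "omap (Ch_func F) Q \<in> Ac B" using Ftilde by (simp add: tilde_def)
        then show ?thesis using ses_complexes.quasi_iso_mono_iff[OF Fs] by simp
      qed
      ultimately show ?thesis by (simp add: induced_model_def)
    qed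
    show "mmap (Ch_func F) ` Cof (induced_model A \<D> \<E>) X Y
        \<subseteq> Cof (induced_model B \<D>' \<E>') (omap (Ch_func F) X) (omap (Ch_func F) Y)"
      "mmap (Ch_func F) ` (Cof (induced_model A \<D> \<E>) X Y \<inter> Weq (induced_model A \<D> \<E>) X Y)
        \<subseteq> Cof (induced_model B \<D>' \<E>') (omap (Ch_func F) X) (omap (Ch_func F) Y) \<inter>
          Weq (induced_model B \<D>' \<E>') (omap (Ch_func F) X) (omap (Ch_func F) Y)"
      using * by blast+
  next
    fix X Y assume X: "X \<in> Obj (Ch B)" and Y: "Y \<in> Obj (Ch B)"
    have *: "mmap (Ch_func G) p \<in> Fib (induced_model A \<D> \<E>) (omap (Ch_func G) X) (omap (Ch_func G) Y) \<and>
        (p \<in> Weq (induced_model B \<D>' \<E>') X Y \<longrightarrow>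
         mmap (Ch_func G) p \<in> Weq (induced_model A \<D> \<E>) (omap (Ch_func G) X) (omap (Ch_func G) Y))"
      if p: "p \<in> Fib (induced_model B \<D>' \<E>') X Y" for p
    proof -
      obtain K k where e: "is_epi (Ch B) X Y p" and K: "K \<in> dg_right B \<D>' \<E>'" and k: "is_kernel (Ch B) X Y p K k"
        using p by (auto simp: induced_model_def)
      have pa: "arr (Ch B) p X Y" using e X Y by (simp add: is_epi_def arr_def)
      note s = B.fibration_ses[OF pa e k]
      note Gs = Gses[OF s K]
      have "omap (Ch_func G) K \<in> dg_right A \<D> \<E>" using dg_right_image[OF K GE Ftilde] .
      then have "mmap (Ch_func G) p \<in> Fib (induced_model A \<D> \<E>) (omap (Ch_func G) X) (omap (Ch_func G) Y)"
        using ses_complexes.Ch_ses(3,4)[OF Gs] by (auto simp: induced_model_def)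
      moreover have "mmap (Ch_func G) p \<in> quasi_isos A (omap (Ch_func G) X) (omap (Ch_func G) Y)"
        if "p \<in> quasi_isos B X Y"
      proof -
        have "K \<in> tilde B \<E>'"
          using that K indB ses_complexes.quasi_iso_epi_iff[OF s] by (simp add: induces_model_structure_def)
        then have "omap (Ch_func G) K \<in> Ac A" using Gtilde by (simp add: tilde_def)
        then show ?thesis using ses_complexes.quasi_iso_epi_iff[OF Gs] by simp
      qed
      ultimately show ?thesis by (simp add: induced_model_def)
    qed
    show "mmap (Ch_func G) ` Fib (induced_model B \<D>' \<E>') X Y
        \<subseteq> Fib (induced_model A \<D> \<E>) (omap (Ch_func G) X) (omap (Ch_func G) Y)"
      "mmap (Ch_func G) ` (Fib (induced_model B \<D>' \<E>') X Y \<inter> Weq (induced_model B \<D>' \<E>') X Y)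
        \<subseteq> Fib (induced_model A \<D> \<E>) (omap (Ch_func G) X) (omap (Ch_func G) Y) \<inter>
          Weq (induced_model A \<D> \<E>) (omap (Ch_func G) X) (omap (Ch_func G) Y)"
      using * by blast+
  qed
qed

theorem theorem3p9:
  fixes A :: "('o, 'm) addcat" and B :: "('p, 'n) addcat"
    and F :: "('o, 'm, 'p, 'n) func" and G :: "('p, 'n, 'o, 'm) func"
    and \<phi> :: "'o \<Rightarrow> 'p \<Rightarrow> 'n \<Rightarrow> 'm"
    and \<D> \<E> :: "'o set" and \<D>' \<E>' :: "'p set"
  assumes "grothendieck_category TYPE('u) A" and "grothendieck_category TYPE('u) B"
    and "is_adjunction A B F G \<phi>"
    and "cotorsion_pair A \<D> \<E>" and "cotorsion_pair B \<D>' \<E>'"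
    and "induces_model_structure A \<D> \<E>" and "induces_model_structure B \<D>' \<E>'"
  shows "((right_split A B F \<D> \<and> omap F ` \<D> \<subseteq> \<D>') \<longleftrightarrow> (left_split B A G \<E>' \<and> omap G ` \<E>' \<subseteq> \<E>))
    \<and> ((right_split A B F \<D> \<and> omap F ` \<D> \<subseteq> \<D>') \<or> (left_split B A G \<E>' \<and> omap G ` \<E>' \<subseteq> \<E>)
       \<longrightarrow> quillen_adjunction (Ch A) (induced_model A \<D> \<E>) (Ch B) (induced_model B \<D>' \<E>')
             (Ch_func F) (Ch_func G) (Ch_transpose \<phi>))"
proof -
  have "abelian_category A" "abelian_category B" using assms(1,2) by (simp_all add: grothendieck_category_def)
  then interpret abelian_adjunction A B F G \<phi>
    using assms(3) by (intro abelian_adjunction.intro abelian_adjunction_axioms.intro)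
  \<comment> \<open>The existence input is covers by objects of \<open>\<D>\<close>, from the pairs
    over \<open>A\<close>, in one direction, and embeddings into objects of \<open>\<E>'\<close>,
    from the pairs over \<open>B\<close>, in the other.\<close>
  have equiv: "(right_split A B F \<D> \<and> omap F ` \<D> \<subseteq> \<D>') \<longleftrightarrow> (left_split B A G \<E>' \<and> omap G ` \<E>' \<subseteq> \<E>)"
    using left_split_of_right_split[OF assms(4,5) A.enough_left[OF assms(6)]]
      right_split_of_left_split[OF assms(4,5) B.enough_right[OF assms(7)]] by blast
  then show ?thesis using quillen[OF assms(4-7)] by blast
qed

end
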